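(* Let $(u_i)_{i\ge0}$ be given by $u_0=0$, $u_{i+1}=u_i^2+i+1$, and $N_i=u_i^2-u_i+i$. Fix $k\ge 1$ and consider a uniformly random closed lambda-term of size $n$ with at most $k$ De Bruijn levels, $n\to\infty$. (1) If $N_j<k<N_{j+1}$ for some $j\ge0$, then both the expected number of unary nodes and the expected number of binary nodes at each of the De Bruijn levels $0,\dots,k-j-1$ are $O(1)$, while each is $\Theta(n)$ at each of the levels $k-j,\dots,k$. (2) If $k=N_j$, then both the expected number of unary nodes and the expected number of binary nodes at each of the levels $0,\dots,k-j-1$ are $O(1)$, each is $\Theta(\sqrt n)$ at level $k-j$, and each of the levels $k-j+1,\dots,k$ contains in expectation $\Theta(n)$ unary nodes as well as $\Theta(n)$ binary nodes.
   Context: Lambda-terms are considered modulo $\alpha$-equivalence and represented by their skeleton, a rooted plane unary-binary tree (leaves = variables, unary nodes = abstractions, binary nodes = applications); size = total number of nodes. The De Bruijn level of a node is the number of unary nodes strictly above it on the path from the root (root at level $0$). A closed lambda-term has at most $k$ De Bruijn levels if every node has level at most $k$; such terms correspond bijectively to rooted plane unary-binary trees with all levels $\le k$ in which each leaf at level $L$ (necessarily $L\ge1$) carries a label in $\{1,\dots,L\}$.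
   Formalization: The Θ(n) claims for the expected number of unary nodes are stated only for levels below k (k-j,...,k-1 in (1); k-j+1,...,k-1 in (2)): a unary node at level k would have a child at level k+1, so level k contains no unary nodes. *)

theory Defs
  imports "HOL-Probability.Probability" "HOL-Library.Landau_Symbols"
begin

text \<open>
  Lambda-terms modulo alpha-equivalence, in De Bruijn notation. Indices start at 1: in a closed
  term a leaf with \<open>L\<close> abstractions above it carries an index in \<open>{1..L}\<close>.
\<close>

datatype lam = Var nat | Abs lam | App lam lam

fun closed_below :: "nat \<Rightarrow> lam \<Rightarrow> bool" where
  "closed_below L (Var i) \<longleftrightarrow> 1 \<le> i \<and> i \<le> L"
| "closed_below L (Abs t) \<longleftrightarrow> closed_below (Suc L) t"
| "closed_below L (App s t) \<longleftrightarrow> closed_below L s \<and> closed_below L t"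

datatype kind = Leaf | Unary | Binary

text \<open>
  The nodes of the skeleton, each recorded by its kind and its De Bruijn level, where the root
  has level \<open>L\<close>. A unary node does not count towards its own level.
\<close>

fun nodes :: "nat \<Rightarrow> lam \<Rightarrow> (kind \<times> nat) multiset" where
  "nodes L (Var i) = {#(Leaf, L)#}"
| "nodes L (Abs t) = add_mset (Unary, L) (nodes (Suc L) t)"
| "nodes L (App s t) = add_mset (Binary, L) (nodes L s + nodes L t)"

definition closed_terms :: "nat \<Rightarrow> nat \<Rightarrow> lam set" where
  "closed_terms k n =
     {t. closed_below 0 t \<and> (\<forall>(c, l) \<in># nodes 0 t. l \<le> k) \<and> size (nodes 0 t) = n}"

text \<open>
  For \<open>k \<ge> 1\<close> and the finitely many \<open>n\<close> where \<open>closed_terms k n\<close> is empty the value is unspecified; this is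
  irrelevant for statements about \<open>n \<longlongrightarrow> \<infinity>\<close>.
\<close>

definition expected_nodes :: "kind \<Rightarrow> nat \<Rightarrow> nat \<Rightarrow> nat \<Rightarrow> real" where
  "expected_nodes c l k n =
     measure_pmf.expectation (pmf_of_set (closed_terms k n)) (\<lambda>t. real (count (nodes 0 t) (c, l)))"

fun u_seq :: "nat \<Rightarrow> nat" where
  "u_seq 0 = 0"
| "u_seq (Suc i) = (u_seq i)\<^sup>2 + i + 1"

text \<open>The subtraction on natural numbers is never truncated, since \<open>u \<le> u\<^sup>2\<close>.\<close>

definition N_seq :: "nat \<Rightarrow> nat" where
  "N_seq i = (u_seq i)\<^sup>2 - u_seq i + i"

lemma finite_closed_below: "finite {t. closed_below L t \<and> size (nodes L t) \<le> n}"
proof (induction n arbitrary: L)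
  case 0
  have "size (nodes L t) \<noteq> 0" for t by (cases t) auto
  then show ?case by auto
next
  case (Suc n)
  let ?S = "\<lambda>L. {t. closed_below L t \<and> size (nodes L t) \<le> n}"
  have "{t. closed_below L t \<and> size (nodes L t) \<le> Suc n}
      \<subseteq> Var ` {1..L} \<union> Abs ` ?S (Suc L) \<union> case_prod App ` (?S L \<times> ?S L)"
  proof
    fix t assume "t \<in> {t. closed_below L t \<and> size (nodes L t) \<le> Suc n}"
    then show "t \<in> Var ` {1..L} \<union> Abs ` ?S (Suc L) \<union> case_prod App ` (?S L \<times> ?S L)"
      by (cases t) auto
  qed
  then show ?case
    by (rule finite_subset) (use Suc in auto)
qed

lemma finite_closed_terms: "finite (closed_terms k n)"
  by (rule finite_subset[OF _ finite_closed_below[of 0 n]]) (auto simp: closed_terms_def)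

text \<open>
  A unary node on level \<open>k\<close> would have its child on level \<open>k + 1\<close>. Hence the top level \<open>k\<close>
  contains no unary nodes at all, and a linear lower bound for unary nodes can only be
  claimed on levels strictly below \<open>k\<close>; the lemma \<open>unary_top_not_linear\<close> refutes it at \<open>k\<close>.
\<close>

lemma ex_node_at_root: "\<exists>c. (c, L) \<in># nodes L t"
  by (cases t) auto

lemma unary_child: "(Unary, l) \<in># nodes L t \<Longrightarrow> \<exists>c. (c, Suc l) \<in># nodes L t"
proof (induction t arbitrary: L)
  case (Abs t)
  then show ?case using ex_node_at_root[of "Suc L" t] by auto
qed auto

lemma no_unary_top:
  assumes "t \<in> closed_terms k n"
  shows "count (nodes 0 t) (Unary, k) = 0"
proof -
  have "(c, Suc k) \<notin># nodes 0 t" for c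
    using assms by (fastforce simp: closed_terms_def)
  then show ?thesis
    using unary_child[of k 0 t] by (auto simp: count_eq_zero_iff)
qed

lemma expected_unary_top:
  assumes "closed_terms k n \<noteq> {}"
  shows "expected_nodes Unary k k n = 0"
  using assms by (simp add: expected_nodes_def integral_pmf_of_set finite_closed_terms no_unary_top)

lemma closed_terms_even:
  assumes "k \<ge> 1"
  shows "closed_terms k (2 * m + 2) \<noteq> {}"
proof -
  define t where "t = ((App (Var 1)) ^^ m) (Var 1)"
  have "closed_below 1 t" "\<forall>x \<in># nodes 1 t. snd x = 1" "size (nodes 1 t) = 2 * m + 1"
    unfolding t_def by (induction m) auto
  then have "Abs t \<in> closed_terms k (2 * m + 2)"
    using assms by (auto simp: closed_terms_def)
  then show ?thesis by blast
qed

lemma unary_top_not_linear: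
  assumes "k \<ge> 1"
  shows "(\<lambda>n. expected_nodes Unary k k n) \<notin> \<Theta>(\<lambda>n. real n)"
proof
  assume "(\<lambda>n. expected_nodes Unary k k n) \<in> \<Theta>(\<lambda>n. real n)"
  then have "(\<lambda>n. expected_nodes Unary k k n) \<in> \<Omega>(\<lambda>n. real n)"
    by (rule bigthetaD2)
  then obtain c where "c > 0"
    and "\<forall>\<^sub>F n in at_top. norm (expected_nodes Unary k k n) \<ge> c * norm (real n)"
    by (rule landau_omega.bigE)
  then obtain n0 where n0: "norm (expected_nodes Unary k k n) \<ge> c * norm (real n)" if "n \<ge> n0" for n
    by (auto simp: eventually_at_top_linorder)
  show False
    using n0[of "2 * n0 + 2"] expected_unary_top[OF closed_terms_even[OF assms, of n0]] \<open>c > 0\<close>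
    by (auto simp: mult_le_0_iff)
qed

end

theory Submission
  imports Defs "HOL-Computational_Algebra.Formal_Power_Series" "HOL-Real_Asymp.Real_Asymp"
begin

text \<open>
  Let \<open>w i\<close> be the (shifted) generating function of the terms rooted at level \<open>i\<close>, rescaled so that the
  dominant singularity is at 1. It satisfies \<open>w i = h i + (w i)\<^sup>2\<close>, where \<open>h i\<close> is affine in \<open>w (i + 1)\<close>,
  and the series counting the nodes on level \<open>l\<close> is a product of \<open>D i = 1/(1 - 2 w i)\<close> for \<open>i \<le> l\<close> with a
  factor from level \<open>l\<close>. Level \<open>i\<close> is critical if \<open>w i\<close> has the value \<open>1/2\<close> at 1. The numbers \<open>N_seq j\<close>
  are those \<open>k\<close> for which two consecutive levels \<open>k - j\<close> and \<open>k - j + 1\<close> are critical; in between, only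
  level \<open>k - j\<close> is.

  The coefficients are estimated up to constant factors without complex analysis. At a critical level
  \<open>4 h\<close> is a probability distribution and \<open>D\<^sup>2 = 1/(1 - 4 h)\<close> its renewal sequence. From
  \<open>X D' = 2 (X h' D\<^sup>2) D\<close> and boundedness of \<open>X h' D\<^sup>2\<close>, \<open>n\<close> times the \<open>n\<close>-th coefficient of
  \<open>D\<close> is of the order of the partial sums of these coefficients, which a Tauberian estimate controls, and \<open>X w' = X h' D\<close> then gives
  the order of \<open>w\<close>: exponents \<open>-1/2\<close> and \<open>-3/2\<close> for \<open>D\<close> and \<open>w\<close> if \<open>4 h\<close> has finite mean, and \<open>-3/4\<close>
  and \<open>-5/4\<close> if level \<open>i + 1\<close> is critical too. Subcritical levels inherit the decay of \<open>h\<close>.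
\<close>

unbundle no vec_syntax
unbundle fps_syntax

section \<open>Polynomial bounds for sequences and convolutions\<close>

text \<open>Orders of magnitude suffice because an expectation is a quotient of two coefficients:
  one of the product of the \<open>D i\<close>, one of \<open>w 0\<close>. The exponents combine to
  \<open>-1/2 + 3/2 = 1\<close> for a single critical factor, to \<open>-3/4 + 5/4 = 1/2\<close> on
  the lower of two critical levels and to \<open>-1/4 + 5/4 = 1\<close> once both critical factors
  occur. The upper bound \<open>n\<close> is trivial, so the linear cases only need lower bounds,
  and for these one keeps the critical factors and a single positive coefficient of everything else.

  The delicate point is the boundedness of \<open>X h' D\<^sup>2\<close>. With finite mean it
  follows from \<open>D\<^sup>2 \<le> 1\<close>. With infinite mean the tail of \<open>4 h\<close>
  dominates \<open>n h n\<close> up to a constant, and the convolution of this tail with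
  \<open>D\<^sup>2\<close> is the constant sequence 1. The second obstacle is parity: the top level
  only has terms of odd size, so a pointwise lower bound can fail on a critical level. Lower bounds
  are proved for block sums and, on levels below \<open>k\<close>, made pointwise by a
  superadditivity of the coefficients.\<close>

lemma powr_comparable:
  fixes x y K e :: real
  assumes "0 < x" "0 < y" "x \<le> K * y" "y \<le> K * x"
  shows "x powr e \<le> K powr \<bar>e\<bar> * y powr e"
proof -
  have K: "K > 0" using assms by (smt (verit) mult_nonneg_nonneg mult_nonpos_nonneg)
  show ?thesis
  proof (cases "e \<ge> 0")
    case True
    have "x powr e \<le> (K * y) powr e" using assms True by (intro powr_mono2) auto
    then show ?thesis using True K assms by (simp add: powr_mult)
  next
    case False
    \<comment> \<open>A negative power is decreasing, so here \<open>y \<le> K * x\<close> does the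
      work; the absolute value in the constant covers both signs of \<open>e\<close>.\<close>
    have "x powr e \<le> (y / K) powr e"
      using assms False K by (intro powr_mono2') (auto simp: field_simps)
    also have "\<dots> = K powr \<bar>e\<bar> * y powr e"
      using False K assms by (simp add: powr_divide powr_minus field_simps)
    finally show ?thesis .
  qed
qed

text \<open>The shift by 1 avoids \<open>0 powr e\<close> at index 0. An upper bound can absorb
  finitely many indices into its constant; a lower bound cannot, since initial coefficients may
  vanish, so \<open>lbound\<close> is only eventual.\<close>

definition ubound :: "real \<Rightarrow> (nat \<Rightarrow> real) \<Rightarrow> bool" where
  "ubound e a \<longleftrightarrow> (\<exists>C\<ge>0. \<forall>n. a n \<le> C * (real n + 1) powr e)"

definition lbound :: "real \<Rightarrow> (nat \<Rightarrow> real) \<Rightarrow> bool" where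
  "lbound e a \<longleftrightarrow> (\<exists>c>0. \<forall>\<^sub>F n in sequentially. c * (real n + 1) powr e \<le> a n)"

lemma uboundI:
  assumes "\<And>n. a n \<le> C * (real n + 1) powr e"
  shows "ubound e a"
  unfolding ubound_def
proof (intro exI conjI allI)
  fix n show "a n \<le> max C 0 * (real n + 1) powr e"
    using assms[of n] by (smt (verit) mult_right_mono powr_ge_zero)
qed auto

lemma lboundI:
  assumes "c > 0" "\<And>n. n \<ge> N \<Longrightarrow> c * (real n + 1) powr e \<le> a n"
  shows "lbound e a"
  unfolding lbound_def eventually_sequentially using assms by blast

lemma lboundE:
  assumes "lbound e a"
  obtains c N where "c > 0" "\<And>n. n \<ge> N \<Longrightarrow> c * (real n + 1) powr e \<le> a n"
  using assms unfolding lbound_def eventually_sequentially by blast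

lemma ubound_mono:
  assumes "ubound e a" "e \<le> e'"
  shows "ubound e' a"
proof -
  obtain C where C: "C \<ge> 0" "\<And>n. a n \<le> C * (real n + 1) powr e"
    using assms by (auto simp: ubound_def)
  have "a n \<le> C * (real n + 1) powr e'" for n
    using C(2)[of n] C(1) powr_mono[OF assms(2), of "real n + 1"]
    by (smt (verit) mult_left_mono of_nat_0_le_iff)
  then show ?thesis by (rule uboundI)
qed

lemma ubound_summable:
  assumes "ubound e a" "e < -1" "\<And>n. 0 \<le> a n"
  shows "summable a"
proof -
  obtain C where C: "C \<ge> 0" "\<And>n. a n \<le> C * (real n + 1) powr e"
    using assms by (auto simp: ubound_def)
  have "summable (\<lambda>n. real n powr e)" using assms by (simp add: summable_real_powr_iff)
  then have "summable (\<lambda>n. (real n + 1) powr e)"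
    by (subst (asm) summable_Suc_iff[symmetric]) (simp add: add.commute)
  then have "summable (\<lambda>n. C * (real n + 1) powr e)" by (rule summable_mult)
  then show ?thesis by (rule summable_comparison_test') (use C assms in auto)
qed

lemma ubound_add:
  assumes "ubound e a" "ubound e b"
  shows "ubound e (\<lambda>n. a n + b n)"
proof -
  obtain C C' where "\<And>n. a n \<le> C * (real n + 1) powr e" "\<And>n. b n \<le> C' * (real n + 1) powr e"
    using assms by (auto simp: ubound_def)
  then have "a n + b n \<le> (C + C') * (real n + 1) powr e" for n
    by (metis add_mono distrib_right)
  then show ?thesis by (rule uboundI)
qed

lemma ubound_cmult:
  assumes "ubound e a" "c \<ge> 0"
  shows "ubound e (\<lambda>n. c * a n)"
proof -
  obtain C where "\<And>n. a n \<le> C * (real n + 1) powr e"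
    using assms by (auto simp: ubound_def)
  then have "c * a n \<le> (c * C) * (real n + 1) powr e" for n
    using assms(2) by (metis mult.assoc mult_left_mono)
  then show ?thesis by (rule uboundI)
qed

lemma ubound_finite_support:
  assumes "\<And>n. n > N \<Longrightarrow> a n \<le> 0"
  shows "ubound e a"
proof -
  define C where "C = (\<Sum>n\<le>N. \<bar>a n\<bar> * (real n + 1) powr (-e))"
  have "a n \<le> C * (real n + 1) powr e" for n
  proof (cases "n \<le> N")
    case True
    have "\<bar>a n\<bar> * (real n + 1) powr (-e) \<le> C" unfolding C_def
      using True by (intro member_le_sum) auto
    then have "\<bar>a n\<bar> * (real n + 1) powr (-e) * (real n + 1) powr e \<le> C * (real n + 1) powr e"
      by (rule mult_right_mono) auto
    then show ?thesis by (simp add: powr_minus field_simps)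
  next
    case False
    have "C \<ge> 0" unfolding C_def by (intro sum_nonneg) auto
    then show ?thesis using assms[of n] False by (smt (verit) mult_nonneg_nonneg not_le_imp_less powr_ge_zero)
  qed
  then show ?thesis by (rule uboundI)
qed

lemma ubound_shift:
  assumes "ubound e a" 
  shows "ubound e (\<lambda>n. if n < s then 0 else a (n - s))"
proof -
  obtain C where C: "C \<ge> 0" "\<And>n. a n \<le> C * (real n + 1) powr e"
    using assms by (auto simp: ubound_def)
  have "(if n < s then 0 else a (n - s)) \<le> C * (real s + 1) powr \<bar>e\<bar> * (real n + 1) powr e" for n
  proof (cases "n < s")
    case False
    have "(real (n - s) + 1) powr e \<le> (real s + 1) powr \<bar>e\<bar> * (real n + 1) powr e"
    proof (rule powr_comparable)
      have "real n + 1 \<le> real s + 1 + real (n - s)" by simp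
      also have "\<dots> \<le> (real s + 1) * (real (n - s) + 1)" by (simp add: algebra_simps)
      finally show "real n + 1 \<le> (real s + 1) * (real (n - s) + 1)" .
      have "real (n - s) + 1 \<le> real n + 1" by simp
      also have "\<dots> \<le> (real s + 1) * (real n + 1)" by (simp add: algebra_simps)
      finally show "real (n - s) + 1 \<le> (real s + 1) * (real n + 1)" .
    qed auto
    then show ?thesis using C(2)[of "n - s"] C(1) False
      by (smt (verit) mult.assoc mult_left_mono)
  qed (use C in auto)
  then show ?thesis by (rule uboundI)
qed

lemma lbound_shift:
  assumes "lbound e a"
  shows "lbound e (\<lambda>n. a (n - s))"
proof -
  obtain c N where c: "c > 0" "\<And>n. n \<ge> N \<Longrightarrow> c * (real n + 1) powr e \<le> a n"
    by (rule lboundE[OF assms]) blast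
  have K: "(real s + 1) powr (-\<bar>e\<bar>) > 0" by (simp add: add_nonneg_eq_0_iff)
  have "c * (real s + 1) powr (-\<bar>e\<bar>) * (real n + 1) powr e \<le> a (n - s)" if n: "n \<ge> N + s" for n
  proof -
    have "(real n + 1) powr e \<le> (real s + 1) powr \<bar>e\<bar> * (real (n - s) + 1) powr e"
    proof (rule powr_comparable)
      have "real n + 1 \<le> real s + 1 + real (n - s)" by simp
      also have "\<dots> \<le> (real s + 1) * (real (n - s) + 1)" by (simp add: algebra_simps)
      finally show "real n + 1 \<le> (real s + 1) * (real (n - s) + 1)" .
      have "real (n - s) + 1 \<le> real n + 1" by simp
      also have "\<dots> \<le> (real s + 1) * (real n + 1)" by (simp add: algebra_simps)
      finally show "real (n - s) + 1 \<le> (real s + 1) * (real n + 1)" .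
    qed auto
    then have "(real s + 1) powr (-\<bar>e\<bar>) * (real n + 1) powr e \<le> (real (n - s) + 1) powr e"
      by (simp add: powr_minus field_simps)
    then have "c * ((real s + 1) powr (-\<bar>e\<bar>) * (real n + 1) powr e) \<le> c * (real (n - s) + 1) powr e"
      using c by (intro mult_left_mono) auto
    also have "\<dots> \<le> a (n - s)" using n by (intro c) auto
    finally show ?thesis by (simp add: mult.assoc)
  qed
  then show ?thesis using c(1) K by (intro lboundI[of "c * (real s + 1) powr (-\<bar>e\<bar>)" "N + s"]) auto
qed

lemma lbound_le:
  assumes "lbound e a" "c > 0" "\<And>n. n \<ge> N \<Longrightarrow> c * a n \<le> b n"
  shows "lbound e b"
proof -
  obtain c' N' where c: "c' > 0" "\<And>n. n \<ge> N' \<Longrightarrow> c' * (real n + 1) powr e \<le> a n"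
    by (rule lboundE[OF assms(1)]) blast
  have "(c * c') * (real n + 1) powr e \<le> b n" if n: "n \<ge> max N N'" for n
  proof -
    have "c * (c' * (real n + 1) powr e) \<le> c * a n" using assms c n by (intro mult_left_mono) auto
    also have "\<dots> \<le> b n" using assms n by auto
    finally show ?thesis by (simp add: mult.assoc)
  qed
  then show ?thesis using assms(2) c(1) by (intro lboundI[of "c * c'" "max N N'"]) auto
qed

text \<open>One of the indices \<open>i\<close>, \<open>j\<close> is at least half of
  \<open>i + j\<close>. If it is \<open>j\<close>, the decay of \<open>g\<close> survives and
  \<open>f\<close> is summed, which needs \<open>1 < \<gamma>\<close>. If it is \<open>i\<close>,
  then \<open>f\<close> has decay to spare: \<open>\<delta>\<close> of it pays for the result and
  the surplus \<open>\<gamma> - \<delta>\<close> is handed to \<open>j\<close>, where it completes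
  \<open>\<delta>\<close> to the summable exponent.\<close>

lemma ubound_fps_mult:
  fixes f g :: "real fps"
  assumes f: "ubound (-\<gamma>) (fps_nth f)" "\<And>n. 0 \<le> f $ n"
    and g: "ubound (-\<delta>) (fps_nth g)" "\<And>n. 0 \<le> g $ n"
    and "1 < \<gamma>" "0 \<le> \<delta>" "\<delta> \<le> \<gamma>"
  shows "ubound (-\<delta>) (fps_nth (f * g))"
proof -
  obtain C where C: "C \<ge> 0" "\<And>n. f $ n \<le> C * (real n + 1) powr (-\<gamma>)"
    using f by (auto simp: ubound_def)
  obtain C' where C': "C' \<ge> 0" "\<And>n. g $ n \<le> C' * (real n + 1) powr (-\<delta>)"
    using g by (auto simp: ubound_def)
  define p where "p = (\<lambda>n::nat. (real n + 1) powr (-\<gamma>))"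
  have p0: "p n \<ge> 0" for n by (simp add: p_def)
  have "ubound (-\<gamma>) p" by (rule uboundI[of _ 1]) (simp add: p_def)
  then have ps: "summable p" using p0 \<open>1 < \<gamma>\<close> by (intro ubound_summable[of "-\<gamma>"]) auto
  have key: "(real i + 1) powr (-\<gamma>) * (real j + 1) powr (-\<delta>)
      \<le> 2 powr \<delta> * (real (i + j) + 1) powr (-\<delta>) * (p i + p j)" for i j
  proof (cases "i \<le> j")
    case True
    have "(real j + 1) powr (-\<delta>) \<le> 2 powr \<bar>-\<delta>\<bar> * (real (i + j) + 1) powr (-\<delta>)"
      using True by (intro powr_comparable) auto
    then have "p i * (real j + 1) powr (-\<delta>) \<le> p i * (2 powr \<delta> * (real (i + j) + 1) powr (-\<delta>))"
      using p0 assms by (intro mult_left_mono) auto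
    also have "\<dots> \<le> 2 powr \<delta> * (real (i + j) + 1) powr (-\<delta>) * (p i + p j)"
      using p0[of j] by (simp add: algebra_simps)
    finally show ?thesis by (simp add: p_def)
  next
    case False
    have "(real i + 1) powr (-\<delta>) \<le> 2 powr \<bar>-\<delta>\<bar> * (real (i + j) + 1) powr (-\<delta>)"
      using False by (intro powr_comparable) auto
    moreover have "(real i + 1) powr (-(\<gamma>-\<delta>)) \<le> (real j + 1) powr (-(\<gamma>-\<delta>))"
      using False assms by (intro powr_mono2') auto
    ultimately have "(real i + 1) powr (-\<delta>) * (real i + 1) powr (-(\<gamma>-\<delta>))
      \<le> 2 powr \<delta> * (real (i + j) + 1) powr (-\<delta>) * (real j + 1) powr (-(\<gamma>-\<delta>))"
      using assms by (intro mult_mono) auto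
    then have "(real i + 1) powr (-\<gamma>)
      \<le> 2 powr \<delta> * (real (i + j) + 1) powr (-\<delta>) * (real j + 1) powr (-(\<gamma>-\<delta>))"
      by (simp add: powr_add[symmetric])
    then have "(real i + 1) powr (-\<gamma>) * (real j + 1) powr (-\<delta>)
      \<le> 2 powr \<delta> * (real (i + j) + 1) powr (-\<delta>) * (real j + 1) powr (-(\<gamma>-\<delta>)) * (real j + 1) powr (-\<delta>)"
      by (intro mult_right_mono) auto
    also have "\<dots> = 2 powr \<delta> * (real (i + j) + 1) powr (-\<delta>) * p j"
      by (simp add: p_def powr_add[symmetric] mult.assoc)
    also have "\<dots> \<le> 2 powr \<delta> * (real (i + j) + 1) powr (-\<delta>) * (p i + p j)"
      using p0[of i] by (intro mult_left_mono) auto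
    finally show ?thesis .
  qed
  have "(f * g) $ n \<le> (C * C' * 2 powr \<delta> * (2 * suminf p)) * (real n + 1) powr (-\<delta>)" for n
  proof -
    have "(f * g) $ n = (\<Sum>i=0..n. f $ i * g $ (n - i))" by (simp add: fps_mult_nth)
    also have "\<dots> \<le> (\<Sum>i=0..n. C * C' * (2 powr \<delta> * (real n + 1) powr (-\<delta>) * (p i + p (n - i))))"
    proof (rule sum_mono)
      fix i assume i: "i \<in> {0..n}"
      have "f $ i * g $ (n - i) \<le> (C * (real i + 1) powr (-\<gamma>)) * (C' * (real (n - i) + 1) powr (-\<delta>))"
        using C C' f g by (intro mult_mono) auto
      also have "\<dots> = C * C' * ((real i + 1) powr (-\<gamma>) * (real (n - i) + 1) powr (-\<delta>))" by simp
      also have "\<dots> \<le> C * C' * (2 powr \<delta> * (real (i + (n - i)) + 1) powr (-\<delta>) * (p i + p (n - i)))"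
        using key[of i "n - i"] C C' by (intro mult_left_mono) auto
      finally show "f $ i * g $ (n - i) \<le> C * C' * (2 powr \<delta> * (real n + 1) powr (-\<delta>) * (p i + p (n - i)))"
        using i by simp
    qed
    also have "\<dots> = C * C' * 2 powr \<delta> * (real n + 1) powr (-\<delta>) * ((\<Sum>i=0..n. p i) + (\<Sum>i=0..n. p (n - i)))"
      by (simp add: sum_distrib_left[symmetric] sum.distrib mult.assoc)
    also have "(\<Sum>i=0..n. p (n - i)) = (\<Sum>i=0..n. p i)"
      using sum.atLeastAtMost_rev[of p 0 n] by simp
    also have "C * C' * 2 powr \<delta> * (real n + 1) powr (-\<delta>) * ((\<Sum>i=0..n. p i) + (\<Sum>i=0..n. p i))
        \<le> C * C' * 2 powr \<delta> * (real n + 1) powr (-\<delta>) * (suminf p + suminf p)"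
      using C C' sum_le_suminf[OF ps, of "{0..n}"] p0 by (intro mult_left_mono) auto
    finally show ?thesis by (simp add: algebra_simps)
  qed
  then show ?thesis by (rule uboundI)
qed

lemma fps_mult_nonneg:
  fixes f g :: "real fps"
  assumes "\<And>n. 0 \<le> f $ n" "\<And>n. 0 \<le> g $ n"
  shows "0 \<le> (f * g) $ n"
  unfolding fps_mult_nth using assms by (intro sum_nonneg mult_nonneg_nonneg) auto

lemma fps_mult_nth_ge:
  fixes f g :: "real fps"
  assumes "\<And>n. 0 \<le> f $ n" "\<And>n. 0 \<le> g $ n"
  shows "f $ i * g $ j \<le> (f * g) $ (i + j)"
proof -
  have "f $ i * g $ (i + j - i) \<le> (\<Sum>m=0..i+j. f $ m * g $ (i + j - m))"
    by (rule member_le_sum[of i _ "\<lambda>m. f $ m * g $ (i + j - m)"]) (use assms in auto)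
  then show ?thesis by (simp add: fps_mult_nth)
qed

lemma fps_mult_mono:
  fixes f g f' g' :: "real fps"
  assumes "\<And>n. 0 \<le> f $ n" "\<And>n. f $ n \<le> f' $ n" "\<And>n. 0 \<le> g $ n" "\<And>n. g $ n \<le> g' $ n"
  shows "(f * g) $ n \<le> (f' * g') $ n"
  unfolding fps_mult_nth using assms by (intro sum_mono mult_mono) (auto intro: order_trans)

lemma fps_mult_sums:
  fixes f g :: "real fps"
  assumes "\<And>n. 0 \<le> f $ n" "\<And>n. 0 \<le> g $ n" "0 \<le> x"
    and a: "(\<lambda>n. f $ n * x ^ n) sums a" and b: "(\<lambda>n. g $ n * x ^ n) sums b"
  shows "(\<lambda>n. (f * g) $ n * x ^ n) sums (a * b)"
proof -
  have "(\<lambda>k. \<Sum>i\<le>k. (f $ i * x ^ i) * (g $ (k - i) * x ^ (k - i))) sums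
      ((\<Sum>k. f $ k * x ^ k) * (\<Sum>k. g $ k * x ^ k))"
    using assms sums_summable[OF a] sums_summable[OF b] by (intro Cauchy_product_sums) auto
  moreover have "(\<Sum>i\<le>k. (f $ i * x ^ i) * (g $ (k - i) * x ^ (k - i))) = (f * g) $ k * x ^ k" for k
  proof -
    have "(\<Sum>i\<le>k. (f $ i * x ^ i) * (g $ (k - i) * x ^ (k - i))) = (\<Sum>i\<le>k. f $ i * g $ (k - i) * x ^ k)"
      by (intro sum.cong refl) (simp add: power_add[symmetric] mult.assoc mult.left_commute)
    then show ?thesis by (simp add: fps_mult_nth sum_distrib_right atMost_atLeast0)
  qed
  ultimately show ?thesis using sums_unique[OF a] sums_unique[OF b] by simp
qed

text \<open>The pairs with \<open>i + j \<le> n\<close> form a triangle inside a square. Bounds on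
  partial sums of this kind give summability before any limit is available.\<close>

lemma fps_mult_partial_sum_le:
  fixes f g :: "real fps"
  assumes "\<And>n. 0 \<le> f $ n" "\<And>n. 0 \<le> g $ n" "0 \<le> x"
  shows "(\<Sum>m\<le>n. (f * g) $ m * x ^ m) \<le> (\<Sum>i\<le>n. f $ i * x ^ i) * (\<Sum>j\<le>n. g $ j * x ^ j)"
proof -
  have "(\<Sum>m\<le>n. (f * g) $ m * x ^ m) = (\<Sum>m\<le>n. \<Sum>i\<le>m. (f $ i * x ^ i) * (g $ (m - i) * x ^ (m - i)))"
    unfolding fps_mult_nth sum_distrib_right atMost_atLeast0
    by (intro sum.cong refl) (simp add: power_add[symmetric] mult.assoc mult.left_commute)
  also have "\<dots> = (\<Sum>(i,j)\<in>{(i,j). i + j \<le> n}. (f $ i * x ^ i) * (g $ j * x ^ j))"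
    by (rule sum.triangle_reindex_eq[symmetric])
  also have "\<dots> \<le> (\<Sum>(i,j)\<in>{..n} \<times> {..n}. (f $ i * x ^ i) * (g $ j * x ^ j))"
    using assms by (intro sum_mono2) auto
  also have "\<dots> = (\<Sum>i\<le>n. f $ i * x ^ i) * (\<Sum>j\<le>n. g $ j * x ^ j)"
    by (simp add: sum_product sum.cartesian_product)
  finally show ?thesis .
qed

lemma fps_geometric_unfold:
  fixes f :: "real fps"
  assumes "f $ 0 = 0"
  shows "inverse (1 - f) * (1 - f) = 1" "inverse (1 - f) = 1 + f * inverse (1 - f)"
proof -
  show 1: "inverse (1 - f) * (1 - f) = 1" by (rule inverse_mult_eq_1) (simp add: assms)
  then show "inverse (1 - f) = 1 + f * inverse (1 - f)" by (simp add: algebra_simps)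
qed

lemma fps_geometric_nonneg:
  fixes f :: "real fps"
  assumes "f $ 0 = 0" "\<And>n. 0 \<le> f $ n"
  shows "0 \<le> inverse (1 - f) $ n"
proof (induction n rule: less_induct)
  case (less n)
  have "inverse (1 - f) $ n = (1 + f * inverse (1 - f)) $ n"
    using fps_geometric_unfold(2)[OF assms(1)] by simp
  also have "\<dots> = (if n = 0 then 1 else 0) + (\<Sum>i=0..n. f $ i * inverse (1 - f) $ (n - i))"
    by (simp add: fps_mult_nth)
  also have "\<dots> \<ge> 0"
  proof -
    have "0 \<le> f $ i * inverse (1 - f) $ (n - i)" if "i \<in> {0..n}" for i
      using that less[of "n - i"] assms by (cases "i = 0") (auto intro: mult_nonneg_nonneg)
    then show ?thesis by (intro add_nonneg_nonneg sum_nonneg) auto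
  qed
  finally show ?case .
qed

text \<open>Summability has to come first: the partial sums \<open>P\<close> satisfy
  \<open>P \<le> 1 + a * P\<close>, hence are at most \<open>1 / (1 - a)\<close>. Only then can the
  limit be read off from \<open>T = 1 + a * T\<close>.\<close>

lemma fps_geometric_sums:
  fixes f :: "real fps"
  assumes f: "f $ 0 = 0" "\<And>n. 0 \<le> f $ n" and "0 \<le> x"
    and a: "(\<lambda>n. f $ n * x ^ n) sums a" "a < 1"
  shows "(\<lambda>n. inverse (1 - f) $ n * x ^ n) sums (1 / (1 - a))"
proof -
  define D where "D = inverse (1 - f)"
  have D0: "0 \<le> D $ n" for n unfolding D_def by (rule fps_geometric_nonneg[OF f])
  have D: "D = 1 + f * D" unfolding D_def by (rule fps_geometric_unfold(2)[OF f(1)])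
  have Dn: "D $ n * x ^ n = (if n = 0 then 1 else 0) + (f * D) $ n * x ^ n" for n
    by (subst (1) D) (simp add: algebra_simps)
  have bd: "(\<Sum>m\<le>n. D $ m * x ^ m) \<le> 1 / (1 - a)" for n
  proof -
    have "(\<Sum>m\<le>n. D $ m * x ^ m) = 1 + (\<Sum>m\<le>n. (f * D) $ m * x ^ m)"
      by (simp add: Dn sum.distrib)
    also have "\<dots> \<le> 1 + (\<Sum>i\<le>n. f $ i * x ^ i) * (\<Sum>j\<le>n. D $ j * x ^ j)"
      using fps_mult_partial_sum_le[OF f(2) D0 \<open>0 \<le> x\<close>, of n] by simp
    also have "\<dots> \<le> 1 + a * (\<Sum>j\<le>n. D $ j * x ^ j)"
    proof -
      have "(\<Sum>i\<le>n. f $ i * x ^ i) \<le> a"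
        using sum_le_suminf[OF sums_summable[OF a(1)], of "{..n}"] sums_unique[OF a(1)] f \<open>0 \<le> x\<close> by auto
      then show ?thesis using D0 \<open>0 \<le> x\<close> by (intro add_left_mono mult_right_mono sum_nonneg) auto
    qed
    finally show ?thesis using a(2) by (simp add: field_simps)
  qed
  have sD: "summable (\<lambda>n. D $ n * x ^ n)"
    using D0 \<open>0 \<le> x\<close> bd by (intro bounded_imp_summable[of _ "1 / (1 - a)"]) auto
  then obtain T where T: "(\<lambda>n. D $ n * x ^ n) sums T" by blast
  have "(\<lambda>n. (if n = 0 then 1 else 0) + (f * D) $ n * x ^ n) sums (1 + a * T)"
    by (intro sums_add fps_mult_sums f D0 \<open>0 \<le> x\<close> a T) (use sums_single[of 0 "\<lambda>_. 1::real"] in simp)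
  then have "T = 1 + a * T" using T sums_unique2 by (simp add: Dn[symmetric])
  then have "T = 1 / (1 - a)" using a(2) by (simp add: field_simps)
  then show ?thesis using T by (simp add: D_def)
qed

section \<open>Abelian and Tauberian estimates: from the growth near the singularity to partial
  sums\<close>

lemma abelian_partial_sums_upper:
  fixes d :: "nat \<Rightarrow> real"
  assumes "\<And>n. 0 \<le> d n"
    and F: "\<And>t. 0 < t \<Longrightarrow> t \<le> 1 \<Longrightarrow> (\<lambda>n. d n * exp (-t) ^ n) sums F t"
    and ub: "\<And>t. 0 < t \<Longrightarrow> t \<le> 1 \<Longrightarrow> F t \<le> b * t powr (-\<beta>)"
  shows "ubound \<beta> (\<lambda>n. \<Sum>m\<le>n. d m)"
proof -
  have "(\<Sum>m\<le>n. d m) \<le> (exp 1 * b) * (real n + 1) powr \<beta>" for n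
  proof -
    \<comment> \<open>For \<open>m \<le> n\<close> the weight \<open>exp (-t) ^ m\<close> is then at
      least \<open>exp (-1)\<close>, whence the factor \<open>exp 1\<close>.\<close>
    define t where "t = 1 / (real n + 1)"
    have t: "0 < t" "t \<le> 1" by (auto simp: t_def)
    have "(\<Sum>m\<le>n. d m) \<le> (\<Sum>m\<le>n. exp 1 * (d m * exp (-t) ^ m))"
    proof (rule sum_mono)
      fix m assume m: "m \<in> {..n}"
      have "exp 1 * exp (-t) ^ m = exp (1 - t * real m)"
        by (simp add: exp_of_nat_mult[symmetric] exp_add[symmetric] mult.commute)
      also have "\<dots> \<ge> exp 0" using m by (subst exp_le_cancel_iff) (simp add: t_def field_simps)
      finally have "d m * 1 \<le> d m * (exp 1 * exp (-t) ^ m)" using assms(1) by (intro mult_left_mono) auto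
      then show "d m \<le> exp 1 * (d m * exp (-t) ^ m)" by (simp add: mult.left_commute)
    qed
    also have "\<dots> = exp 1 * (\<Sum>m\<le>n. d m * exp (-t) ^ m)" by (simp add: sum_distrib_left)
    also have "\<dots> \<le> exp 1 * F t"
      using sum_le_suminf[OF sums_summable[OF F[OF t]], of "{..n}"] sums_unique[OF F[OF t]] assms(1)
      by (intro mult_left_mono) auto
    also have "\<dots> \<le> exp 1 * (b * t powr (-\<beta>))" using ub[OF t] by (intro mult_left_mono) auto
    also have "t powr (-\<beta>) = (real n + 1) powr \<beta>"
      by (simp add: t_def powr_divide powr_minus field_simps)
    finally show ?thesis by (simp add: mult.assoc)
  qed
  then show ?thesis by (rule uboundI)
qed

text \<open>Splitting at \<open>n\<close> with \<open>t = A/n\<close>, the tail is at most \<open>exp (-A/2) F (t/2)\<close>; \<open>A\<close> is a large constant.\<close>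

lemma tauberian_partial_sums_lower:
  fixes d :: "nat \<Rightarrow> real"
  assumes d: "\<And>n. 0 \<le> d n" and "a > 0" and "\<beta> > 0"
    and F: "\<And>t. 0 < t \<Longrightarrow> t \<le> 1 \<Longrightarrow> (\<lambda>n. d n * exp (-t) ^ n) sums F t"
    and lb: "\<And>t. 0 < t \<Longrightarrow> t \<le> 1 \<Longrightarrow> a * t powr (-\<beta>) \<le> F t"
    and ub: "\<And>t. 0 < t \<Longrightarrow> t \<le> 1 \<Longrightarrow> F t \<le> b * t powr (-\<beta>)"
  shows "lbound \<beta> (\<lambda>n. \<Sum>m\<le>n. d m)"
proof -
  have b: "b > 0"
    using lb[of 1] ub[of 1] \<open>a > 0\<close> by simp
  \<comment> \<open>Chosen so that the tail, of size \<open>exp (-A/2) * b * 2 powr \<beta>\<close>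
    relative to \<open>t powr (-\<beta>)\<close>, uses up at most half of the lower constant
    \<open>a\<close>.\<close>
  define A where "A = max 1 (2 * ln (2 * b * 2 powr \<beta> / a))"
  have A: "A \<ge> 1" by (simp add: A_def)
  have eA: "exp (-A/2) * (b * 2 powr \<beta>) \<le> a / 2"
  proof -
    have "2 * b * 2 powr \<beta> / a = exp (ln (2 * b * 2 powr \<beta> / a))"
      using b \<open>a > 0\<close> by (subst exp_ln) auto
    also have "\<dots> \<le> exp (A / 2)" by (subst exp_le_cancel_iff) (simp add: A_def)
    finally show ?thesis using \<open>a > 0\<close> by (simp add: exp_minus field_simps)
  qed
  have "a / 2 * A powr (-\<beta>) * (real n + 1) powr \<beta> \<le> (\<Sum>m\<le>n. d m)" if n: "n \<ge> nat \<lceil>A\<rceil>" for n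
  proof -
    define t where "t = A / (real n + 1)"
    have t: "0 < t" "t \<le> 1" using A n by (auto simp: t_def field_simps)
    have t2: "0 < t/2" "t/2 \<le> 1" using t by auto
    have "d m * exp (-t) ^ m \<le> (if m \<in> {..n} then d m else 0) + exp (-A/2) * (d m * exp (-(t/2)) ^ m)" for m
    proof (cases "m \<le> n")
      case True
      have "d m * exp (-t) ^ m \<le> d m * 1"
        using d t by (intro mult_left_mono power_le_one) auto
      then show ?thesis using True d by (simp add: add_increasing2)
    next
      case False
      have "exp (-t) ^ m = exp (- (t * real m))"
        by (simp add: exp_of_nat_mult[symmetric] mult.commute)
      also have "\<dots> \<le> exp (-A/2 - t/2 * real m)"
      proof (subst exp_le_cancel_iff)
        have "A = t * (real n + 1)" by (simp add: t_def)
        also have "\<dots> \<le> t * real m" using False t by (intro mult_left_mono) auto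
        finally show "- (t * real m) \<le> -A/2 - t/2 * real m" by (simp add: field_simps)
      qed
      also have "\<dots> = exp (-A/2) * exp (-(t/2)) ^ m"
        by (simp add: exp_of_nat_mult[symmetric] exp_add[symmetric] mult.commute)
      finally have "d m * exp (-t) ^ m \<le> d m * (exp (-A/2) * exp (-(t/2)) ^ m)"
        using d by (intro mult_left_mono) auto
      then show ?thesis using False by (simp add: mult.left_commute)
    qed
    moreover have "(\<lambda>m. (if m \<in> {..n} then d m else 0) + exp (-A/2) * (d m * exp (-(t/2)) ^ m)) sums
      ((\<Sum>m\<in>{..n}. d m) + exp (-A/2) * F (t/2))"
      by (rule sums_add[OF sums_If_finite_set sums_mult[OF F[OF t2]]]) simp
    ultimately have "F t \<le> (\<Sum>m\<le>n. d m) + exp (-A/2) * F (t/2)"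
      by (rule sums_le[OF _ F[OF t]])
    also have "exp (-A/2) * F (t/2) \<le> exp (-A/2) * (b * (t/2) powr (-\<beta>))"
      using ub[OF t2] by (intro mult_left_mono) auto
    also have "\<dots> = exp (-A/2) * (b * 2 powr \<beta>) * t powr (-\<beta>)"
      using t by (simp add: powr_divide powr_minus field_simps)
    also have "\<dots> \<le> a / 2 * t powr (-\<beta>)" using eA by (intro mult_right_mono) auto
    finally have "F t \<le> (\<Sum>m\<le>n. d m) + a / 2 * t powr (-\<beta>)" by simp
    then have "a / 2 * t powr (-\<beta>) \<le> (\<Sum>m\<le>n. d m)" using lb[OF t] by (simp add: field_simps)
    moreover have "t powr (-\<beta>) = A powr (-\<beta>) * (real n + 1) powr \<beta>"
      using A by (simp add: t_def powr_divide powr_minus field_simps)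
    ultimately show ?thesis by (simp add: mult.assoc)
  qed
  then show ?thesis using A \<open>a > 0\<close> by (intro lboundI[of "a / 2 * A powr (-\<beta>)" "nat \<lceil>A\<rceil>"]) auto
qed

text \<open>Only the terms in which \<open>f\<close> has index at least \<open>N\<close> are kept.
  There \<open>f\<close> is at least \<open>c * (real n + 1) powr (-\<alpha>)\<close>, because the
  power decreases, and this comes out of the sum. So \<open>g\<close> enters through its partial
  sums alone, which is what the Tauberian estimate provides.\<close>

lemma lbound_fps_mult:
  fixes f g :: "real fps"
  assumes f: "lbound (-\<alpha>) (fps_nth f)" "\<And>n. 0 \<le> f $ n" "0 \<le> \<alpha>"
    and g: "lbound \<beta> (\<lambda>n. \<Sum>m\<le>n. g $ m)" "\<And>n. 0 \<le> g $ n"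
  shows "lbound (\<beta> - \<alpha>) (fps_nth (f * g))"
proof -
  obtain c N where c: "c > 0" "\<And>n. n \<ge> N \<Longrightarrow> c * (real n + 1) powr (-\<alpha>) \<le> f $ n"
    by (rule lboundE[OF f(1)]) blast
  obtain c' N' where c': "c' > 0" "\<And>n. n \<ge> N' \<Longrightarrow> c' * (real n + 1) powr \<beta> \<le> (\<Sum>m\<le>n-N. g $ m)"
    by (rule lboundE[OF lbound_shift[OF g(1), of N]]) blast
  have "c * c' * (real n + 1) powr (\<beta> - \<alpha>) \<le> (f * g) $ n" if n: "n \<ge> max N N'" for n
  proof -
    have "c * (real n + 1) powr (-\<alpha>) * (c' * (real n + 1) powr \<beta>)
        \<le> c * (real n + 1) powr (-\<alpha>) * (\<Sum>m\<le>n-N. g $ m)"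
      using n c c' by (intro mult_left_mono) auto
    also have "\<dots> = (\<Sum>m\<le>n-N. c * (real n + 1) powr (-\<alpha>) * g $ m)" by (simp add: sum_distrib_left)
    also have "\<dots> \<le> (\<Sum>m\<le>n-N. g $ m * f $ (n - m))"
    proof (rule sum_mono)
      fix m assume m: "m \<in> {..n-N}"
      have "c * (real n + 1) powr (-\<alpha>) \<le> c * (real (n - m) + 1) powr (-\<alpha>)"
        using c f(3) by (intro mult_left_mono powr_mono2') auto
      also have "\<dots> \<le> f $ (n - m)" using m n by (intro c) auto
      finally show "c * (real n + 1) powr (-\<alpha>) * g $ m \<le> g $ m * f $ (n - m)"
        using g(2)[of m] by (simp add: mult.commute mult_left_mono)
    qed
    also have "\<dots> \<le> (\<Sum>m=0..n. g $ m * f $ (n - m))"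
      using f g by (intro sum_mono2) auto
    also have "\<dots> = (f * g) $ n" by (subst mult.commute) (simp add: fps_mult_nth)
    finally show ?thesis by (simp add: powr_add[symmetric] powr_diff powr_minus field_simps)
  qed
  then show ?thesis using c c' by (intro lboundI[of "c * c'" "max N N'"]) auto
qed

text \<open>Serves exponents below 1, where neither factor is summable and
  \<open>ubound_fps_mult\<close> does not apply. The factor with the larger index is bounded
  pointwise, the other one is summed.\<close>

lemma ubound_fps_mult_partial_sums:
  fixes f g :: "real fps"
  assumes f: "ubound (-a) (fps_nth f)" "\<And>n. 0 \<le> f $ n" "ubound (1 - a) (\<lambda>n. \<Sum>m\<le>n. f $ m)" "0 \<le> a"
    and g: "ubound (-b) (fps_nth g)" "\<And>n. 0 \<le> g $ n" "ubound (1 - b) (\<lambda>n. \<Sum>m\<le>n. g $ m)" "0 \<le> b"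
  shows "ubound (1 - a - b) (fps_nth (f * g))"
proof -
  obtain C where C: "C \<ge> 0" "\<And>n. f $ n \<le> C * (real n + 1) powr (-a)"
    using f by (auto simp: ubound_def)
  obtain C' where C': "C' \<ge> 0" "\<And>n. g $ n \<le> C' * (real n + 1) powr (-b)"
    using g by (auto simp: ubound_def)
  obtain S where S: "S \<ge> 0" "\<And>n. (\<Sum>m\<le>n. f $ m) \<le> S * (real n + 1) powr (1 - a)"
    using f by (auto simp: ubound_def)
  obtain S' where S': "S' \<ge> 0" "\<And>n. (\<Sum>m\<le>n. g $ m) \<le> S' * (real n + 1) powr (1 - b)"
    using g by (auto simp: ubound_def)
  have "(f * g) $ n \<le> (C' * 2 powr b * S + C * 2 powr a * S') * (real n + 1) powr (1 - a - b)" for n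
  proof -
    let ?p = "C' * 2 powr b * (real n + 1) powr (-b)" and ?q = "C * 2 powr a * (real n + 1) powr (-a)"
    have pq: "?p \<ge> 0" "?q \<ge> 0" using C C' by auto
    have "(f * g) $ n = (\<Sum>i=0..n. f $ i * g $ (n - i))" by (simp add: fps_mult_nth)
    also have "\<dots> \<le> (\<Sum>i=0..n. ?p * f $ i + ?q * g $ (n - i))"
    proof (rule sum_mono)
      fix i assume i: "i \<in> {0..n}"
      show "f $ i * g $ (n - i) \<le> ?p * f $ i + ?q * g $ (n - i)"
      proof (cases "i \<le> n - i")
        case True
        have "(real (n-i) + 1) powr (-b) \<le> 2 powr \<bar>-b\<bar> * (real n + 1) powr (-b)"
          using i True by (intro powr_comparable) auto
        then have "C' * (real (n-i) + 1) powr (-b) \<le> C' * (2 powr b * (real n + 1) powr (-b))"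
          using C' g(4) by (intro mult_left_mono) auto
        then have "g $ (n - i) \<le> ?p" using C'(2)[of "n - i"] by (simp only: mult.assoc order_trans)
        then have "f $ i * g $ (n - i) \<le> f $ i * ?p" using f by (intro mult_left_mono) auto
        moreover have "0 \<le> ?q * g $ (n - i)" by (rule mult_nonneg_nonneg[OF pq(2) g(2)])
        ultimately show ?thesis by (simp add: mult.commute)
      next
        case False
        have "(real i + 1) powr (-a) \<le> 2 powr \<bar>-a\<bar> * (real n + 1) powr (-a)"
          using i False by (intro powr_comparable) auto
        then have "C * (real i + 1) powr (-a) \<le> C * (2 powr a * (real n + 1) powr (-a))"
          using C f(4) by (intro mult_left_mono) auto
        then have "f $ i \<le> ?q" using C(2)[of i] by (simp only: mult.assoc order_trans)
        then have "f $ i * g $ (n - i) \<le> ?q * g $ (n - i)" using g by (intro mult_right_mono) auto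
        moreover have "0 \<le> ?p * f $ i" by (rule mult_nonneg_nonneg[OF pq(1) f(2)])
        ultimately show ?thesis by simp
      qed
    qed
    also have "\<dots> = ?p * (\<Sum>i=0..n. f $ i) + ?q * (\<Sum>i=0..n. g $ (n - i))"
      by (simp add: sum.distrib sum_distrib_left)
    also have "(\<Sum>i=0..n. g $ (n - i)) = (\<Sum>i\<le>n. g $ i)"
      using sum.atLeastAtMost_rev[of "\<lambda>i. g $ i" 0 n] by (simp add: atMost_atLeast0)
    also have "?p * (\<Sum>i=0..n. f $ i) + ?q * (\<Sum>i\<le>n. g $ i)
        \<le> ?p * (S * (real n + 1) powr (1 - a)) + ?q * (S' * (real n + 1) powr (1 - b))"
      using S(2)[of n] S'(2)[of n] pq by (intro add_mono mult_left_mono) (auto simp: atMost_atLeast0)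
    also have "\<dots> = C' * 2 powr b * S * ((real n + 1) powr (-b) * (real n + 1) powr (1 - a))
        + C * 2 powr a * S' * ((real n + 1) powr (-a) * (real n + 1) powr (1 - b))"
      by (simp add: mult_ac)
    also have "\<dots> = (C' * 2 powr b * S + C * 2 powr a * S') * (real n + 1) powr (1 - a - b)"
      unfolding powr_add[symmetric] by (simp add: algebra_simps)
    finally show ?thesis .
  qed
  then show ?thesis by (rule uboundI)
qed

text \<open>A telescoping bound: with \<open>y\<close> and \<open>x\<close> the square roots of
  consecutive integers, \<open>0 \<le> (y - x) * (y - x)\<close> and
  \<open>y * y = x * x + 1\<close> give \<open>1 / y \<le> 2 * y - 2 * x\<close>.\<close>

lemma sum_inverse_sqrt_le: "(\<Sum>m\<le>n. (real m + 1) powr (-1/2)) \<le> 2 * (real n + 1) powr (1/2)"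
proof (induction n)
  case (Suc n)
  define x y where "x = sqrt (real n + 1)" and "y = sqrt (real n + 2)"
  have xy: "0 < x" "x \<le> y" "y * y = x * x + 1" by (auto simp: x_def y_def)
  have "2 * x * y + 1 \<le> 2 * (y * y)"
  proof -
    have "0 \<le> (y - x) * (y - x)" by simp
    then show ?thesis using xy by (simp add: algebra_simps)
  qed
  then have "2 * x + 1 / y \<le> 2 * y" using xy by (simp add: field_simps)
  moreover have "(real (Suc n) + 1) powr (-1/2) = 1 / y"
    unfolding minus_divide_left[symmetric] powr_minus_divide by (simp add: y_def powr_half_sqrt add_ac)
  moreover have "(real (Suc n) + 1) powr (1/2) = y" "(real n + 1) powr (1/2) = x"
    by (auto simp: x_def y_def powr_half_sqrt add_ac)
  ultimately show ?case using Suc by simp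
qed simp

lemma ubound_partial_sums_half:
  assumes "ubound (-1/2) a"
  shows "ubound (1/2) (\<lambda>n. \<Sum>m\<le>n. a m)"
proof -
  obtain C where C: "C \<ge> 0" "\<And>n. a n \<le> C * (real n + 1) powr (-1/2)"
    using assms by (auto simp: ubound_def)
  have "(\<Sum>m\<le>n. a m) \<le> (C * 2) * (real n + 1) powr (1/2)" for n
  proof -
    have "(\<Sum>m\<le>n. a m) \<le> C * (\<Sum>m\<le>n. (real m + 1) powr (-1/2))"
      unfolding sum_distrib_left by (intro sum_mono C)
    also have "\<dots> \<le> C * (2 * (real n + 1) powr (1/2))"
      by (intro mult_left_mono sum_inverse_sqrt_le C)
    finally show ?thesis by simp
  qed
  then show ?thesis by (rule uboundI)
qed

text \<open>
  Multiplication with \<open>window L\<close> sums a sequence over blocks of \<open>L\<close> consecutive indices. Lower bounds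
  are proved for block sums first, since single coefficients can vanish for reasons of parity.
\<close>

definition window :: "nat \<Rightarrow> real fps" where
  "window L = Abs_fps (\<lambda>n. if n < L then 1 else 0)"

lemma window_nonneg [simp]: "0 \<le> window L $ n"
  by (simp add: window_def)

lemma mult_window_nth: "(f * window L) $ n = (\<Sum>i=0..n. if n - i < L then f $ i else 0)"
  unfolding fps_mult_nth window_def by (intro sum.cong) auto

lemma fps_X_deriv_nth [simp]: "(fps_X * fps_deriv f) $ n = of_nat n * (f $ n :: 'a :: comm_ring_1)"
  by (cases n) auto

text \<open>The operator multiplies coefficient \<open>n\<close> by \<open>n\<close> and so forgets
  coefficient 0, which is why that one is bounded separately by \<open>C0\<close>.\<close>

lemma ubound_of_X_deriv:
  assumes "ubound e (fps_nth (fps_X * fps_deriv f))" "f $ 0 \<le> C0"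
  shows "ubound (e - 1) (fps_nth f)"
proof -
  obtain C where C: "C \<ge> 0" "\<And>n. real n * f $ n \<le> C * (real n + 1) powr e"
    using assms unfolding ubound_def fps_X_deriv_nth by auto
  have "f $ n \<le> max (2 * C) C0 * (real n + 1) powr (e - 1)" for n
  proof (cases "n = 0")
    case False
    have "(real n + 1) * f $ n \<le> 2 * (C * (real n + 1) powr e)"
    proof (cases "f $ n \<ge> 0")
      case True
      have "(real n + 1) * f $ n \<le> (2 * real n) * f $ n"
        using True False by (intro mult_right_mono) auto
      then show ?thesis using C(2)[of n] by simp
    next
      case False
      then have "(real n + 1) * f $ n \<le> 0" by (simp add: mult_nonneg_nonpos)
      then show ?thesis using C(1) by (smt (verit) mult_nonneg_nonneg powr_ge_zero)
    qed
    then have "f $ n \<le> (2 * C) * (real n + 1) powr (e - 1)"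
      by (simp add: powr_diff field_simps)
    also have "\<dots> \<le> max (2 * C) C0 * (real n + 1) powr (e - 1)" by (intro mult_right_mono) auto
    finally show ?thesis .
  qed (use assms in auto)
  then show ?thesis by (rule uboundI)
qed

lemma X_deriv_window_le:
  fixes f :: "real fps"
  assumes "\<And>n. 0 \<le> f $ n"
  shows "(fps_X * fps_deriv f * window L) $ n \<le> real n * (f * window L) $ n"
  unfolding mult_window_nth sum_distrib_left fps_X_deriv_nth
  using assms by (intro sum_mono) (auto intro: mult_right_mono)

lemma X_deriv_window_ge:
  fixes f :: "real fps"
  assumes "\<And>n. 0 \<le> f $ n"
  shows "(real n - real L) * (f * window L) $ n \<le> (fps_X * fps_deriv f * window L) $ n"
  unfolding mult_window_nth sum_distrib_left fps_X_deriv_nth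
proof (rule sum_mono)
  fix i assume "i \<in> {0..n}"
  show "(real n - real L) * (if n - i < L then f $ i else 0) \<le> (if n - i < L then of_nat i * f $ i else 0)"
  proof (cases "n - i < L")
    case True
    then have "(real n - real L) * f $ i \<le> real i * f $ i" using assms by (intro mult_right_mono) auto
    then show ?thesis using True by simp
  qed simp
qed

lemma lbound_window_of_X_deriv:
  fixes f :: "real fps"
  assumes "lbound e (fps_nth (fps_X * fps_deriv f * window L))" "\<And>n. 0 \<le> f $ n"
  shows "lbound (e - 1) (fps_nth (f * window L))"
proof -
  obtain c N where c: "c > 0" "\<And>n. n \<ge> N \<Longrightarrow> c * (real n + 1) powr e \<le> (fps_X * fps_deriv f * window L) $ n"
    by (rule lboundE[OF assms(1)]) blast
  have "c * (real n + 1) powr (e - 1) \<le> (f * window L) $ n" if "n \<ge> N" for n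
  proof -
    have "c * (real n + 1) powr e \<le> real n * (f * window L) $ n"
      using c(2)[OF that] X_deriv_window_le[OF assms(2), of L n] by linarith
    also have "\<dots> \<le> (real n + 1) * (f * window L) $ n"
      using assms by (intro mult_right_mono fps_mult_nonneg) auto
    finally show ?thesis by (simp add: powr_diff field_simps)
  qed
  then show ?thesis using c by (intro lboundI)
qed

lemma lbound_X_deriv_window:
  fixes f :: "real fps"
  assumes "lbound (e - 1) (fps_nth (f * window L))" "\<And>n. 0 \<le> f $ n"
  shows "lbound e (fps_nth (fps_X * fps_deriv f * window L))"
proof -
  obtain c N where c: "c > 0" "\<And>n. n \<ge> N \<Longrightarrow> c * (real n + 1) powr (e - 1) \<le> (f * window L) $ n"
    by (rule lboundE[OF assms(1)]) blast
  have "c / 2 * (real n + 1) powr e \<le> (fps_X * fps_deriv f * window L) $ n"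
    if n: "n \<ge> max N (2 * L + 1)" for n
  proof -
    have "c / 2 * (real n + 1) powr e = ((real n + 1) / 2) * (c * (real n + 1) powr (e - 1))"
      by (simp add: powr_diff field_simps)
    also have "\<dots> \<le> ((real n + 1) / 2) * (f * window L) $ n"
      using c n by (intro mult_left_mono) auto
    \<comment> \<open>From \<open>n = 2 * L + 1\<close> on, \<open>real n - real L\<close> is at
      least half of \<open>real n + 1\<close>.\<close>
    also have "\<dots> \<le> (real n - real L) * (f * window L) $ n"
      using n assms by (intro mult_right_mono fps_mult_nonneg) auto
    also have "\<dots> \<le> (fps_X * fps_deriv f * window L) $ n"
      by (rule X_deriv_window_ge[OF assms(2)])
    finally show ?thesis .
  qed
  then show ?thesis using c(1) by (intro lboundI[of "c / 2" "max N (2 * L + 1)"]) auto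
qed

text \<open>A large block sum forces a large coefficient \<open>f $ i\<close> in the block, and
  \<open>p (n - i) * f $ i \<le> f $ n\<close> carries it to any \<open>n\<close> slightly beyond
  the block. In the applications \<open>p\<close> consists of coefficients that are eventually
  positive, so this is where parity gaps are closed.\<close>

lemma lbound_unwindow:
  fixes f :: "real fps"
  assumes f: "lbound e (fps_nth (f * window L))" "\<And>n. 0 \<le> f $ n"
    and p: "\<And>i. i \<ge> s \<Longrightarrow> p i > 0" "\<And>i j. p i * f $ j \<le> f $ (i + j)"
  shows "lbound e (fps_nth f)"
proof -
  \<comment> \<open>The block ends at \<open>n - (s + L)\<close> and has length \<open>L\<close>, so
    its distances from \<open>n\<close> lie in this interval, where \<open>p\<close> is
    positive.\<close>
  define q where "q = Min (p ` {s..s + 2 * L})"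
  have q: "q > 0" "\<And>i. s \<le> i \<Longrightarrow> i \<le> s + 2 * L \<Longrightarrow> q \<le> p i"
    unfolding q_def using p(1) by (auto intro!: Min_le)
  have "q / (real L + 1) * (f * window L) $ (n - (s + L)) \<le> f $ n" if n: "n \<ge> s + L" for n
  proof -
    let ?m = "n - (s + L)"
    have "(f * window L) $ ?m = (\<Sum>i\<in>{i\<in>{0..?m}. ?m - i < L}. f $ i)"
      unfolding mult_window_nth by (subst sum.inter_filter) auto
    also have "\<dots> \<le> (\<Sum>i\<in>{i\<in>{0..?m}. ?m - i < L}. f $ n / q)"
    proof (rule sum_mono)
      fix i assume i: "i \<in> {i\<in>{0..?m}. ?m - i < L}"
      then have "q \<le> p (n - i)" using n by (intro q) auto
      then have "q * f $ i \<le> p (n - i) * f $ i" using f by (intro mult_right_mono) auto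
      also have "\<dots> \<le> f $ n" using p(2)[of "n - i" i] i n by auto
      finally show "f $ i \<le> f $ n / q" using q by (simp add: field_simps)
    qed
    also have "\<dots> = real (card {i\<in>{0..?m}. ?m - i < L}) * (f $ n / q)" by simp
    also have "\<dots> \<le> (real L + 1) * (f $ n / q)"
    proof (rule mult_right_mono)
      have "card {i\<in>{0..?m}. ?m - i < L} \<le> card ((\<lambda>j. ?m - j) ` {..<L})"
      proof (rule card_mono)
        show "{i\<in>{0..?m}. ?m - i < L} \<subseteq> (\<lambda>j. ?m - j) ` {..<L}"
        proof
          fix i assume "i \<in> {i\<in>{0..?m}. ?m - i < L}"
          then have "i = ?m - (?m - i)" "?m - i \<in> {..<L}" by auto
          then show "i \<in> (\<lambda>j. ?m - j) ` {..<L}" by (rule image_eqI)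
        qed
      qed simp
      also have "\<dots> \<le> L" using card_image_le[of "{..<L}"] by simp
      finally show "real (card {i\<in>{0..?m}. ?m - i < L}) \<le> real L + 1" by simp
    qed (use f q in auto)
    finally show ?thesis using q by (simp add: field_simps)
  qed
  then show ?thesis
    using q by (intro lbound_le[OF lbound_shift[OF f(1), of "s + L"], of "q / (real L + 1)" "s + L"]) auto
qed

section \<open>Power series solving a quadratic equation\<close>

text \<open>A contraction argument. Inserting the bound
  \<open>M * (real m + 1) powr (-\<gamma>)\<close> for smaller indices \<open>m\<close>, the shift
  from \<open>n\<close> to \<open>n - i\<close> costs almost nothing for \<open>i < K\<close> and
  \<open>n\<close> large, and at most \<open>2 powr \<gamma>\<close> for \<open>i \<ge> K\<close>,
  where \<open>p\<close> has little mass. The total factor stays below 1 because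
  \<open>suminf p < 1\<close>.\<close>

lemma ubound_half_convolution_recurrence:
  fixes x p :: "nat \<Rightarrow> real"
  assumes p: "\<And>n. 0 \<le> p n" "p 0 = 0" "summable p" "suminf p < 1" and "0 \<le> C" "0 \<le> \<gamma>"
    and x: "\<And>n. x n \<le> C * (real n + 1) powr (-\<gamma>) + (\<Sum>i\<in>{i\<in>{0..n}. 2 * i \<le> n}. p i * x (n - i))"
  shows "ubound (-\<gamma>) x"
proof -
  define P where "P = suminf p"
  have P: "0 \<le> P" "P < 1" using p by (auto simp: P_def suminf_nonneg)
  \<comment> \<open>Halfway between \<open>P\<close> and 1: the gap \<open>(1 - P) / 2\<close> pays
    \<open>(1 - P) / 4\<close> for the tail of \<open>p\<close> and as much for the shift of the
    index.\<close>
  define \<theta> where "\<theta> = (1 + P) / 2"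
  have \<theta>: "0 < \<theta>" "\<theta> < 1" using P by (auto simp: \<theta>_def)
  obtain K where K: "(\<Sum>i. p (i + K)) * 2 powr \<gamma> < (1 - P) / 4"
  proof -
    have "(\<lambda>k. (\<Sum>i. p (i + k)) * 2 powr \<gamma>) \<longlonglongrightarrow> 0 * 2 powr \<gamma>"
      by (intro tendsto_mult suminf_exist_split2 p tendsto_const)
    then have "\<forall>\<^sub>F k in sequentially. (\<Sum>i. p (i + k)) * 2 powr \<gamma> < (1 - P) / 4"
      by (rule order_tendstoD(2)) (use P in simp)
    then show ?thesis using that by (auto simp: eventually_sequentially)
  qed
  obtain N where N: "N \<ge> K" "\<And>n. n \<ge> N \<Longrightarrow> (real (n - K) + 1) powr (-\<gamma>) \<le> (1 + (1 - P) / 4) * (real n + 1) powr (-\<gamma>)"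
  proof -
    have "(\<lambda>n. (real n - real K + 1) / (real n + 1)) \<longlonglongrightarrow> 1" by real_asymp
    then have "(\<lambda>n. ((real n - real K + 1) / (real n + 1)) powr (-\<gamma>)) \<longlonglongrightarrow> 1 powr (-\<gamma>)"
      by (intro tendsto_powr tendsto_const) auto
    then have "\<forall>\<^sub>F n in sequentially. ((real n - real K + 1) / (real n + 1)) powr (-\<gamma>) < 1 + (1 - P) / 4"
      by (rule order_tendstoD(2)) (use P in simp)
    then obtain N where N: "\<And>n. n \<ge> N \<Longrightarrow> ((real n - real K + 1) / (real n + 1)) powr (-\<gamma>) < 1 + (1 - P) / 4"
      by (auto simp: eventually_sequentially)
    have "(real (n - K) + 1) powr (-\<gamma>) \<le> (1 + (1 - P) / 4) * (real n + 1) powr (-\<gamma>)" if "n \<ge> max N K" for n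
    proof -
      have "(real (n - K) + 1) powr (-\<gamma>) = ((real n - real K + 1) / (real n + 1)) powr (-\<gamma>) * (real n + 1) powr (-\<gamma>)"
        using that by (subst powr_mult[symmetric]) (auto simp: of_nat_diff)
      also have "\<dots> \<le> (1 + (1 - P) / 4) * (real n + 1) powr (-\<gamma>)"
        using N[of n] that by (intro mult_right_mono) auto
      finally show ?thesis .
    qed
    then show ?thesis using that[of "max N K"] by auto
  qed
  \<comment> \<open>The first entry gives \<open>C + \<theta> * M \<le> M\<close>, the induction
    step beyond \<open>N\<close>; the second settles all \<open>n \<le> N\<close> directly.\<close>
  define M where "M = max (C / (1 - \<theta>)) (Max ((\<lambda>n. x n * (real n + 1) powr \<gamma>) ` {..N}))"
  have M1: "C + \<theta> * M \<le> M"
  proof -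
    have "C / (1 - \<theta>) \<le> M" by (simp add: M_def)
    then show ?thesis using \<theta> by (simp add: field_simps)
  qed
  have M0: "0 \<le> M" using \<open>0 \<le> C\<close> \<theta> by (simp add: M_def le_max_iff_disj)
  have "x n \<le> M * (real n + 1) powr (-\<gamma>)" for n
  proof (induction n rule: less_induct)
    case (less n)
    show ?case
    proof (cases "n \<le> N")
      case True
      have "x n * (real n + 1) powr \<gamma> \<le> M"
        unfolding M_def using True by (intro max.coboundedI2 Max_ge) auto
      then show ?thesis by (simp add: powr_minus field_simps)
    next
      case False
      define y where "y = M * (real n + 1) powr (-\<gamma>)"
      have y: "y \<ge> 0" using M0 by (simp add: y_def)
      define q where "q = (\<lambda>i. if K \<le> i then p i else 0)"
      have q: "summable q" "suminf q = (\<Sum>i. p (i + K))"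
      proof -
        have "summable (\<lambda>i. q (i + K))" using p(3) by (simp add: q_def summable_iff_shift)
        then show s: "summable q" by (simp add: summable_iff_shift)
        show "suminf q = (\<Sum>i. p (i + K))"
          using suminf_split_initial_segment[OF s, of K] by (simp add: q_def)
      qed
      have "(\<Sum>i\<in>{i\<in>{0..n}. 2 * i \<le> n}. p i * x (n - i)) \<le>
        (\<Sum>i\<in>{i\<in>{0..n}. 2 * i \<le> n}. (p i * (1 + (1 - P) / 4) + q i * 2 powr \<gamma>) * y)"
      proof (rule sum_mono)
        fix i assume i: "i \<in> {i\<in>{0..n}. 2 * i \<le> n}"
        show "p i * x (n - i) \<le> (p i * (1 + (1 - P) / 4) + q i * 2 powr \<gamma>) * y"
        \<comment> \<open>The summand for \<open>i = 0\<close> refers to \<open>x n\<close> itself,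
          out of reach of the induction hypothesis; it vanishes by \<open>p 0 = 0\<close>.\<close>
        proof (cases "i = 0")
          case True
          then show ?thesis using p y by (auto simp: q_def)
        next
          case i0: False
          have IH: "x (n - i) \<le> M * (real (n - i) + 1) powr (-\<gamma>)"
            using less[of "n - i"] i i0 False by auto
          show ?thesis
          proof (cases "K \<le> i")
            case True
            have "(real (n - i) + 1) powr (-\<gamma>) \<le> 2 powr \<bar>-\<gamma>\<bar> * (real n + 1) powr (-\<gamma>)"
              using i by (intro powr_comparable) auto
            then have "M * (real (n - i) + 1) powr (-\<gamma>) \<le> M * (2 powr \<gamma> * (real n + 1) powr (-\<gamma>))"
              using M0 \<open>0 \<le> \<gamma>\<close> by (intro mult_left_mono) auto
            then have "x (n - i) \<le> 2 powr \<gamma> * y" using IH by (simp add: y_def mult.left_commute)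
            then have "p i * x (n - i) \<le> p i * (2 powr \<gamma> * y)" using p by (intro mult_left_mono) auto
            also have "\<dots> = q i * 2 powr \<gamma> * y" using True by (simp add: q_def)
            also have "\<dots> \<le> (p i * (1 + (1 - P) / 4) + q i * 2 powr \<gamma>) * y"
              using p P y by (intro mult_right_mono) auto
            finally show ?thesis .
          next
            case iK: False
            have "(real (n - i) + 1) powr (-\<gamma>) \<le> (real (n - K) + 1) powr (-\<gamma>)"
              using iK False N(1) \<open>0 \<le> \<gamma>\<close> by (intro powr_mono2') auto
            also have "\<dots> \<le> (1 + (1 - P) / 4) * (real n + 1) powr (-\<gamma>)" using False by (intro N) auto
            finally have "M * (real (n - i) + 1) powr (-\<gamma>) \<le> M * ((1 + (1 - P) / 4) * (real n + 1) powr (-\<gamma>))"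
              using M0 by (intro mult_left_mono) auto
            then have "x (n - i) \<le> (1 + (1 - P) / 4) * y" using IH by (simp add: y_def mult.left_commute)
            then have "p i * x (n - i) \<le> p i * ((1 + (1 - P) / 4) * y)" using p by (intro mult_left_mono) auto
            also have "\<dots> = (p i * (1 + (1 - P) / 4) + q i * 2 powr \<gamma>) * y"
              using iK by (simp add: q_def)
            finally show ?thesis .
          qed
        qed
      qed
      also have "\<dots> = ((\<Sum>i\<in>{i\<in>{0..n}. 2 * i \<le> n}. p i) * (1 + (1 - P) / 4)
          + (\<Sum>i\<in>{i\<in>{0..n}. 2 * i \<le> n}. q i) * 2 powr \<gamma>) * y"
        by (simp only: sum_distrib_right[symmetric] sum.distrib)
      also have "\<dots> \<le> (P * (1 + (1 - P) / 4) + suminf q * 2 powr \<gamma>) * y"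
      proof -
        have "(\<Sum>i\<in>{i\<in>{0..n}. 2 * i \<le> n}. p i) \<le> P"
          unfolding P_def using p by (intro sum_le_suminf) auto
        moreover have "(\<Sum>i\<in>{i\<in>{0..n}. 2 * i \<le> n}. q i) \<le> suminf q"
          using p q by (intro sum_le_suminf) (auto simp: q_def)
        ultimately show ?thesis using y P by (intro mult_right_mono add_mono) auto
      qed
      also have "\<dots> \<le> \<theta> * y"
      proof (rule mult_right_mono[OF _ y])
        have "P * (1 + (1 - P) / 4) \<le> P + (1 - P) / 4"
          using P mult_right_mono[of P 1 "(1 - P) / 4"] by (simp add: algebra_simps)
        then show "P * (1 + (1 - P) / 4) + suminf q * 2 powr \<gamma> \<le> \<theta>"
          using K q by (simp add: \<theta>_def field_simps)
      qed
      finally have "x n \<le> C * (real n + 1) powr (-\<gamma>) + \<theta> * y" using x[of n] by linarith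
      also have "\<dots> = (C + \<theta> * M) * (real n + 1) powr (-\<gamma>)" by (simp add: y_def algebra_simps)
      also have "\<dots> \<le> M * (real n + 1) powr (-\<gamma>)" using M1 by (intro mult_right_mono) auto
      finally show ?thesis .
    qed
  qed
  then show ?thesis by (rule uboundI)
qed

lemma fps_mult_nth_half:
  fixes f g :: "real fps"
  assumes "\<And>n. 0 \<le> f $ n" "\<And>n. 0 \<le> g $ n"
  shows "(f * g) $ n \<le> (\<Sum>i\<in>{i\<in>{0..n}. 2 * i \<le> n}. f $ i * g $ (n - i))
    + (\<Sum>i\<in>{i\<in>{0..n}. 2 * i \<le> n}. g $ i * f $ (n - i))"
proof -
  let ?A = "{i\<in>{0..n}. 2 * i \<le> n}" and ?B = "{i\<in>{0..n}. \<not> 2 * i \<le> n}"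
  have "{0..n} = ?A \<union> ?B" by auto
  then have "(f * g) $ n = (\<Sum>i\<in>?A \<union> ?B. f $ i * g $ (n - i))"
    unfolding fps_mult_nth by (rule sum.cong) simp
  then have 1: "(f * g) $ n = (\<Sum>i\<in>?A. f $ i * g $ (n - i)) + (\<Sum>i\<in>?B. f $ i * g $ (n - i))"
    by (subst (asm) sum.union_disjoint) auto
  have "(\<Sum>i\<in>?B. f $ i * g $ (n - i)) = (\<Sum>i\<in>(\<lambda>i. n - i) ` ?B. g $ i * f $ (n - i))"
    by (subst sum.reindex) (auto simp: inj_on_def intro!: sum.cong)
  also have "\<dots> \<le> (\<Sum>i\<in>?A. g $ i * f $ (n - i))"
    using assms by (intro sum_mono2) auto
  finally show ?thesis using 1 by linarith
qed

text \<open>Linearising \<open>w = h + w\<^sup>2\<close>, by differentiation or by marking a node,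
  leaves a factor \<open>1 - 2 * w\<close>; this is its inverse.\<close>

definition fps_res :: "real fps \<Rightarrow> real fps" where
  "fps_res w = inverse (1 - 2 * w)"

lemma fps_two_mult_nth [simp]: "(2 * f) $ n = 2 * f $ n" for f :: "real fps"
  unfolding numeral_fps_const by (rule fps_mult_left_const_nth)

locale quadratic_fps =
  fixes w h :: "real fps"
  assumes w_zero: "w $ 0 = 0" and w_nonneg: "\<And>n. 0 \<le> w $ n" and h_nonneg: "\<And>n. 0 \<le> h $ n"
    and w_eq: "w = h + w\<^sup>2"
begin

abbreviation D where "D \<equiv> fps_res w"

lemma h_zero: "h $ 0 = 0"
  using arg_cong[OF w_eq, of "\<lambda>f. f $ 0"] by (simp add: w_zero power2_eq_square)

lemma D_nonneg: "0 \<le> D $ n"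
  unfolding fps_res_def by (rule fps_geometric_nonneg) (auto simp: w_zero w_nonneg)

lemma D_zero: "D $ 0 = 1"
  by (simp add: fps_res_def w_zero)

lemma D_mult: "D * (1 - 2 * w) = 1"
  unfolding fps_res_def by (rule fps_geometric_unfold) (simp add: w_zero)

lemma D_rec: "D = 1 + 2 * w * D"
  using D_mult by (simp add: algebra_simps)

lemma D_square: "D\<^sup>2 * (1 - 4 * h) = 1"
proof -
  have "(1 - 2 * w)\<^sup>2 = 1 - 4 * h" using w_eq by algebra
  then show ?thesis using D_mult by (metis power_mult_distrib one_power2)
qed

text \<open>A single product out of \<open>w * w\<close>, all other contributions being nonnegative.
  Together with the analogous inequality for \<open>D\<close> it supplies the hypothesis of
  \<open>lbound_unwindow\<close>.\<close>

lemma w_superadditive: "w $ i * w $ j \<le> w $ (i + j)"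
proof -
  have "w $ (i + j) = h $ (i + j) + (w * w) $ (i + j)"
    by (subst w_eq) (simp add: power2_eq_square)
  then show ?thesis using fps_mult_nth_ge[of w w i j] w_nonneg h_nonneg[of "i + j"] by simp
qed

lemma D_superadditive: "2 * w $ i * D $ j \<le> D $ (i + j)"
proof -
  have "D $ (i + j) = (1 :: real fps) $ (i + j) + (2 * w * D) $ (i + j)"
    by (subst D_rec) simp
  then show ?thesis using fps_mult_nth_ge[of "2 * w" D i j] w_nonneg D_nonneg by simp
qed

lemma w_deriv: "fps_X * fps_deriv w = (fps_X * fps_deriv h) * D"
proof -
  have "fps_deriv w = fps_deriv h + fps_deriv (w * w)"
    by (subst w_eq) (simp add: power2_eq_square)
  also have "fps_deriv (w * w) = 2 * w * fps_deriv w" by (simp add: algebra_simps)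
  finally have "fps_deriv w * (1 - 2 * w) = fps_deriv h" by (simp add: algebra_simps)
  moreover have "fps_X * fps_deriv w * (D * (1 - 2 * w)) = fps_X * (fps_deriv w * (1 - 2 * w)) * D"
    by (simp only: mult_ac)
  ultimately have "fps_X * fps_deriv w * (D * (1 - 2 * w)) = fps_X * fps_deriv h * D" by simp
  then show ?thesis by (simp only: D_mult mult_1_right)
qed

lemma D_deriv: "fps_X * fps_deriv D = 2 * (fps_X * fps_deriv h * D\<^sup>2) * D"
proof -
  have "fps_deriv (D * (1 - 2 * w)) = 0" by (simp only: D_mult) simp
  then have 1: "fps_deriv D * (1 - 2 * w) = 2 * fps_deriv w * D"
    by (simp add: algebra_simps)
  have "fps_X * fps_deriv D * (D * (1 - 2 * w)) = fps_X * (fps_deriv D * (1 - 2 * w)) * D"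
    by (simp only: mult_ac)
  then have "fps_X * fps_deriv D = fps_X * (2 * fps_deriv w * D) * D"
    by (simp only: D_mult 1 mult_1_right)
  then have "fps_X * fps_deriv D = 2 * (fps_X * fps_deriv w) * D\<^sup>2"
    by (simp only: power2_eq_square mult_ac)
  then show ?thesis by (simp only: w_deriv power2_eq_square mult_ac)
qed

text \<open>The contraction is \<open>2 * w\<close>, of total mass \<open>2 * W < 1\<close>. For
  \<open>w\<close> the two halves of the convolution \<open>w * w\<close> coincide by symmetry. For
  \<open>D\<close> the half with small index of \<open>w\<close> is the recurrence; in the other
  half \<open>w\<close> has the large index and already decays, and \<open>D\<close> is summable, so
  this half joins the inhomogeneous term.\<close>

lemma subcritical:
  assumes \<gamma>: "1 < \<gamma>" and h: "ubound (-\<gamma>) (fps_nth h)" and W: "fps_nth w sums W" "W < 1/2"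
  shows "ubound (-\<gamma>) (fps_nth w)" "ubound (-\<gamma>) (fps_nth D)"
proof -
  have p: "summable (\<lambda>n. 2 * w $ n)" "(\<Sum>n. 2 * w $ n) < 1"
    using W by (auto simp: suminf_mult sums_summable sums_unique[symmetric] intro: summable_mult)
  show w: "ubound (-\<gamma>) (fps_nth w)"
  proof -
    obtain C where C: "C \<ge> 0" "\<And>n. h $ n \<le> C * (real n + 1) powr (-\<gamma>)"
      using h by (auto simp: ubound_def)
    show ?thesis
    proof (rule ubound_half_convolution_recurrence[where p = "\<lambda>n. 2 * w $ n" and C = C])
      fix n
      have "w $ n = h $ n + (w * w) $ n" by (subst w_eq) (simp add: power2_eq_square)
      also have "(w * w) $ n \<le> (\<Sum>i\<in>{i\<in>{0..n}. 2 * i \<le> n}. 2 * w $ i * w $ (n - i))"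
        using fps_mult_nth_half[of w w n] w_nonneg by (simp add: sum_distrib_left mult_ac)
      finally show "w $ n \<le> C * (real n + 1) powr (-\<gamma>) + (\<Sum>i\<in>{i\<in>{0..n}. 2 * i \<le> n}. 2 * w $ i * w $ (n - i))"
        using C(2)[of n] by simp
    qed (use w_nonneg w_zero p C \<gamma> in auto)
  qed
  show "ubound (-\<gamma>) (fps_nth D)"
  proof -
    obtain C where C: "C \<ge> 0" "\<And>n. w $ n \<le> C * (real n + 1) powr (-\<gamma>)"
      using w by (auto simp: ubound_def)
    have "(\<lambda>n. D $ n * (1::real) ^ n) sums (1 / (1 - 2 * W))"
      unfolding fps_res_def
      by (rule fps_geometric_sums) (use W w_zero w_nonneg in \<open>auto intro: sums_mult\<close>)
    then have D: "summable (fps_nth D)" by (simp add: sums_iff)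
    let ?C = "1 + 2 * C * 2 powr \<gamma> * suminf (fps_nth D)"
    have C': "?C \<ge> 0" using C D D_nonneg by (intro add_nonneg_nonneg mult_nonneg_nonneg suminf_nonneg) auto
    show ?thesis
    proof (rule ubound_half_convolution_recurrence[where p = "\<lambda>n. 2 * w $ n" and C = ?C])
      fix n :: nat
      let ?A = "{i\<in>{0..n}. 2 * i \<le> n}"
      have "D $ n = (if n = 0 then 1 else 0) + (2 * w * D) $ n" by (subst D_rec) simp
      also have "(if n = 0 then 1 else 0) \<le> (real n + 1) powr (-\<gamma>)" by simp
      also have "(2 * w * D) $ n \<le> (\<Sum>i\<in>?A. 2 * w $ i * D $ (n - i)) + (\<Sum>i\<in>?A. D $ i * (2 * w $ (n - i)))"
        using fps_mult_nth_half[of "2 * w" D n] w_nonneg D_nonneg by simp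
      also have "(\<Sum>i\<in>?A. D $ i * (2 * w $ (n - i))) \<le> (\<Sum>i\<in>?A. D $ i * (2 * (C * (2 powr \<gamma> * (real n + 1) powr (-\<gamma>)))))"
      proof (rule sum_mono)
        fix i assume i: "i \<in> ?A"
        have "(real (n - i) + 1) powr (-\<gamma>) \<le> 2 powr \<bar>-\<gamma>\<bar> * (real n + 1) powr (-\<gamma>)"
          using i by (intro powr_comparable) auto
        then have "C * (real (n - i) + 1) powr (-\<gamma>) \<le> C * (2 powr \<gamma> * (real n + 1) powr (-\<gamma>))"
          using C \<gamma> by (intro mult_left_mono) auto
        then have "2 * w $ (n - i) \<le> 2 * (C * (2 powr \<gamma> * (real n + 1) powr (-\<gamma>)))"
          using C(2)[of "n - i"] by linarith
        then show "D $ i * (2 * w $ (n - i)) \<le> D $ i * (2 * (C * (2 powr \<gamma> * (real n + 1) powr (-\<gamma>))))"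
          by (rule mult_left_mono[OF _ D_nonneg])
      qed
      also have "\<dots> = (\<Sum>i\<in>?A. D $ i) * (2 * (C * (2 powr \<gamma> * (real n + 1) powr (-\<gamma>))))"
        by (rule sum_distrib_right[symmetric])
      also have "\<dots> \<le> suminf (fps_nth D) * (2 * (C * (2 powr \<gamma> * (real n + 1) powr (-\<gamma>))))"
        using C D D_nonneg by (intro mult_right_mono sum_le_suminf) auto
      finally show "D $ n \<le> ?C * (real n + 1) powr (-\<gamma>) + (\<Sum>i\<in>?A. 2 * w $ i * D $ (n - i))"
        by (simp add: algebra_simps)
    qed (use w_nonneg w_zero p C' \<gamma> in auto)
  qed
qed

end

lemma ubound_X_deriv:
  fixes f :: "real fps"
  assumes "ubound (e - 1) (fps_nth f)" "\<And>n. 0 \<le> f $ n"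
  shows "ubound e (fps_nth (fps_X * fps_deriv f))"
proof -
  obtain C where C: "C \<ge> 0" "\<And>n. f $ n \<le> C * (real n + 1) powr (e - 1)"
    using assms by (auto simp: ubound_def)
  have "(fps_X * fps_deriv f) $ n \<le> C * (real n + 1) powr e" for n
  proof -
    have "real n * f $ n \<le> (real n + 1) * f $ n" using assms by (intro mult_right_mono) auto
    also have "\<dots> \<le> (real n + 1) * (C * (real n + 1) powr (e - 1))" by (intro mult_left_mono C) auto
    also have "\<dots> = C * (real n + 1) powr e" by (simp add: powr_diff)
    finally show ?thesis unfolding fps_X_deriv_nth .
  qed
  then show ?thesis by (rule uboundI)
qed

lemma one_minus_exp_bounds:
  fixes t :: real
  assumes "0 < t" "t \<le> 1"
  shows "t / 2 \<le> 1 - exp (-t)" "1 - exp (-t) \<le> t"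
proof -
  have "1 + t \<le> exp t" by (rule exp_ge_add_one_self)
  then have "exp (-t) \<le> 1 / (1 + t)" using assms by (simp add: exp_minus field_simps)
  also have "\<dots> \<le> 1 - t / 2" using assms by (simp add: field_simps)
  finally show "t / 2 \<le> 1 - exp (-t)" by simp
  show "1 - exp (-t) \<le> t" using exp_ge_add_one_self[of "-t"] by simp
qed

locale critical_fps = quadratic_fps +
  assumes w_sums: "fps_nth w sums (1/2)"
begin

lemma h_sums: "fps_nth h sums (1/4)"
proof -
  have "(\<lambda>n. (w * w) $ n * 1 ^ n) sums (1/2 * (1/2))"
    by (rule fps_mult_sums) (use w_nonneg w_sums in auto)
  then have "(\<lambda>n. w $ n - (w * w) $ n) sums (1/2 - 1/2 * (1/2))"
    by (intro sums_diff w_sums) simp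
  moreover have "w $ n - (w * w) $ n = h $ n" for n
    using arg_cong[OF w_eq, of "\<lambda>f. f $ n"] by (simp add: power2_eq_square)
  ultimately show ?thesis by simp
qed

lemma exp_sums:
  fixes t :: real and f :: "real fps"
  assumes "0 \<le> t" "\<And>n. 0 \<le> f $ n" "summable (fps_nth f)"
  shows "summable (\<lambda>n. f $ n * exp (-t) ^ n)"
    "(\<Sum>n. f $ n * exp (-t) ^ n) \<le> suminf (fps_nth f)"
proof -
  have le: "f $ n * exp (-t) ^ n \<le> f $ n" for n
    using mult_left_mono[OF power_le_one[of "exp (-t)" n] assms(2)[of n]] assms(1) by simp
  then show "summable (\<lambda>n. f $ n * exp (-t) ^ n)"
    using assms by (intro summable_comparison_test'[OF assms(3)]) auto
  then show "(\<Sum>n. f $ n * exp (-t) ^ n) \<le> suminf (fps_nth f)"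
    using le assms by (intro suminf_le) auto
qed

text \<open>Evaluation at \<open>exp (-t)\<close>, so that \<open>t\<close> measures the distance
  from the singularity in the form used by the Abelian and Tauberian estimates.\<close>

definition H :: "real \<Rightarrow> real" where
  "H t = (\<Sum>n. h $ n * exp (-t) ^ n)"

lemma H_sums: "0 \<le> t \<Longrightarrow> (\<lambda>n. h $ n * exp (-t) ^ n) sums H t"
  unfolding H_def using exp_sums(1)[of t h] h_nonneg h_sums by (auto simp: sums_iff)

lemma w_exp_sums:
  assumes "0 \<le> t"
  shows "(\<lambda>n. w $ n * exp (-t) ^ n) sums ((1 - sqrt (1 - 4 * H t)) / 2)"
proof -
  define y where "y = (\<Sum>n. w $ n * exp (-t) ^ n)"
  have y: "(\<lambda>n. w $ n * exp (-t) ^ n) sums y"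
    unfolding y_def using exp_sums(1)[of t w] w_nonneg w_sums assms by (auto simp: sums_iff)
  \<comment> \<open>This selects the root of the quadratic equation with the negative sign of the
    square root.\<close>
  have y2: "y \<le> 1/2"
    unfolding y_def using exp_sums(2)[of t w] w_nonneg w_sums assms by (auto simp: sums_iff)
  have "(\<lambda>n. h $ n * exp (-t) ^ n + (w * w) $ n * exp (-t) ^ n) sums (H t + y * y)"
    by (intro sums_add H_sums assms fps_mult_sums w_nonneg y) auto
  moreover have "h $ n * exp (-t) ^ n + (w * w) $ n * exp (-t) ^ n = w $ n * exp (-t) ^ n" for n
    using arg_cong[OF w_eq, of "\<lambda>f. f $ n"] by (simp add: power2_eq_square algebra_simps)
  ultimately have "(\<lambda>n. w $ n * exp (-t) ^ n) sums (H t + y * y)" by simp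
  then have "y = H t + y * y" by (rule sums_unique2[OF y])
  then have "1 - 4 * H t = (1 - 2 * y)\<^sup>2" by (simp add: power2_eq_square algebra_simps)
  then have "(1 - sqrt (1 - 4 * H t)) / 2 = y" using y2 by simp
  then show ?thesis using y by simp
qed

lemma D_exp_sums:
  assumes "0 \<le> t" "H t < 1/4"
  shows "(\<lambda>n. D $ n * exp (-t) ^ n) sums (1 / sqrt (1 - 4 * H t))"
    "(\<lambda>n. D\<^sup>2 $ n * exp (-t) ^ n) sums (1 / (1 - 4 * H t))"
proof -
  have "(\<lambda>n. inverse (1 - 2 * w) $ n * exp (-t) ^ n) sums (1 / (1 - (1 - sqrt (1 - 4 * H t))))"
  proof (rule fps_geometric_sums)
    have "(\<lambda>n. 2 * (w $ n * exp (-t) ^ n)) sums (2 * ((1 - sqrt (1 - 4 * H t)) / 2))"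
      by (intro sums_mult w_exp_sums assms)
    moreover have "2 * ((1 - sqrt (1 - 4 * H t)) / 2) = 1 - sqrt (1 - 4 * H t)" by simp
    ultimately show "(\<lambda>n. (2 * w) $ n * exp (-t) ^ n) sums (1 - sqrt (1 - 4 * H t))"
      by (simp only: mult.assoc fps_two_mult_nth)
  qed (use w_zero w_nonneg assms in auto)
  then show 1: "(\<lambda>n. D $ n * exp (-t) ^ n) sums (1 / sqrt (1 - 4 * H t))"
    by (simp add: fps_res_def)
  have "(\<lambda>n. (D * D) $ n * exp (-t) ^ n) sums (1 / sqrt (1 - 4 * H t) * (1 / sqrt (1 - 4 * H t)))"
    by (intro fps_mult_sums D_nonneg 1) auto
  then show "(\<lambda>n. D\<^sup>2 $ n * exp (-t) ^ n) sums (1 / (1 - 4 * H t))"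
    using assms by (simp add: power2_eq_square)
qed

text \<open>
  Reading \<open>4 h\<close> as a probability distribution on the positive integers, \<open>r\<close> is its tail and \<open>D\<^sup>2\<close> is
  the associated renewal sequence.
\<close>

definition r :: "nat \<Rightarrow> real" where
  "r n = 1 - 4 * (\<Sum>m\<le>n. h $ m)"

lemma r_eq_tail: "r n = 4 * (\<Sum>m. h $ (m + Suc n))"
  using suminf_minus_initial_segment[of "fps_nth h" "Suc n"] h_sums
  by (simp add: r_def sums_iff lessThan_Suc_atMost)

lemma r_nonneg: "0 \<le> r n"
  unfolding r_eq_tail using h_nonneg h_sums
  by (intro mult_nonneg_nonneg suminf_nonneg summable_ignore_initial_segment) (auto simp: sums_iff)

lemma r_le_1: "r n \<le> 1"
  unfolding r_def using h_nonneg by (simp add: sum_nonneg)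

lemma D_square_nonneg: "0 \<le> D\<^sup>2 $ n"
  unfolding power2_eq_square by (intro fps_mult_nonneg D_nonneg)

text \<open>The series of tails is \<open>(1 - 4 * h) / (1 - X)\<close>, and
  \<open>D\<^sup>2\<close> is the inverse of \<open>1 - 4 * h\<close>.\<close>

lemma D_square_conv_r: "D\<^sup>2 * Abs_fps r = Abs_fps (\<lambda>_. 1)"
proof -
  have "Abs_fps r = (1 - 4 * h) * Abs_fps (\<lambda>_. 1)"
  proof (rule fps_ext)
    fix n
    have "((1 - 4 * h) * Abs_fps (\<lambda>_. 1)) $ n = (\<Sum>i=0..n. (if i = 0 then 1 else 0) - 4 * h $ i)"
      unfolding fps_mult_nth by (intro sum.cong) auto
    also have "\<dots> = r n" by (simp add: sum_subtractf r_def sum_distrib_left atMost_atLeast0)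
    finally show "Abs_fps r $ n = ((1 - 4 * h) * Abs_fps (\<lambda>_. 1)) $ n" by simp
  qed
  then show ?thesis using D_square by (metis mult.assoc mult_1_left)
qed

lemma D_square_conv_r_nth: "(\<Sum>i=0..n. D\<^sup>2 $ i * r (n - i)) = 1"
  using arg_cong[OF D_square_conv_r, of "\<lambda>f. f $ n"] by (simp add: fps_mult_nth)

text \<open>A renewal sequence consists of probabilities: since \<open>r 0 = 1\<close>, the
  coefficient is a single summand of a nonnegative sum with value 1.\<close>

lemma D_square_le_1: "D\<^sup>2 $ n \<le> 1"
proof -
  have "D\<^sup>2 $ n * r (n - n) \<le> (\<Sum>i=0..n. D\<^sup>2 $ i * r (n - i))"
    using D_square_nonneg r_nonneg by (intro member_le_sum) auto
  then show ?thesis unfolding D_square_conv_r_nth by (simp add: r_def h_zero)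
qed

lemma X_deriv_h_nonneg: "0 \<le> (fps_X * fps_deriv h) $ n"
  unfolding fps_X_deriv_nth using h_nonneg by simp

lemma h_pos_somewhere: "\<exists>m>0. h $ m > 0"
proof (rule ccontr)
  assume "\<not> ?thesis"
  then have "h $ m = 0" for m
    using h_zero h_nonneg[of m] by (metis antisym_conv2 gr_zeroI)
  then have "fps_nth h = (\<lambda>_. 0)" by (rule ext)
  then have "(0::real) = 1/4" by (intro sums_unique2[OF _ h_sums]) simp
  then show False by simp
qed

end

text \<open>The exponent is \<open>\<delta> = 1\<close> if \<open>4 h\<close> has finite mean and
  \<open>\<delta> = 1/2\<close> if the next level is critical as well. Near the singularity
  \<open>D\<close> and \<open>D\<^sup>2\<close> then grow like
  \<open>t powr (-(\<delta> / 2))\<close> and \<open>t powr (-\<delta>)\<close>.\<close>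

locale critical_exponent_fps = critical_fps +
  fixes \<delta> a b :: real
  assumes a: "a > 0" and \<delta>: "\<delta> > 0"
    and H_lower: "\<And>t. 0 < t \<Longrightarrow> t \<le> 1 \<Longrightarrow> a * t powr \<delta> \<le> 1 - 4 * H t"
    and H_upper: "\<And>t. 0 < t \<Longrightarrow> t \<le> 1 \<Longrightarrow> 1 - 4 * H t \<le> b * t powr \<delta>"
begin

lemma b: "b > 0"
  using H_lower[of 1] H_upper[of 1] a by simp

lemma H_lt: "0 < t \<Longrightarrow> t \<le> 1 \<Longrightarrow> H t < 1/4"
  using H_lower[of t] mult_pos_pos[OF a, of "t powr \<delta>"] by simp

lemma D_partial_sums:
  "ubound (\<delta> / 2) (\<lambda>n. \<Sum>m\<le>n. D $ m)" "lbound (\<delta> / 2) (\<lambda>n. \<Sum>m\<le>n. D $ m)"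
proof -
  have F: "(\<lambda>n. D $ n * exp (-t) ^ n) sums (1 / sqrt (1 - 4 * H t))" if "0 < t" "t \<le> 1" for t
    using that by (intro D_exp_sums H_lt) auto
  have sq: "sqrt (t powr \<delta>) = t powr (\<delta> / 2)" if "0 < t" for t
    using that by (simp add: powr_half_sqrt[symmetric] powr_powr)
  have ub: "1 / sqrt (1 - 4 * H t) \<le> (1 / sqrt a) * t powr (-(\<delta> / 2))" if t: "0 < t" "t \<le> 1" for t
  proof -
    have "sqrt (a * t powr \<delta>) \<le> sqrt (1 - 4 * H t)" using H_lower[OF t] by simp
    then have "1 / sqrt (1 - 4 * H t) \<le> 1 / sqrt (a * t powr \<delta>)"
      using a t H_lt[OF t] by (intro divide_left_mono) (auto intro!: mult_pos_pos)
    also have "\<dots> = (1 / sqrt a) * t powr (-(\<delta> / 2))"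
      using t by (simp add: real_sqrt_mult sq powr_minus_divide)
    finally show ?thesis .
  qed
  have lb: "(1 / sqrt b) * t powr (-(\<delta> / 2)) \<le> 1 / sqrt (1 - 4 * H t)" if t: "0 < t" "t \<le> 1" for t
  proof -
    have "sqrt (1 - 4 * H t) \<le> sqrt (b * t powr \<delta>)" using H_upper[OF t] by simp
    then have "1 / sqrt (b * t powr \<delta>) \<le> 1 / sqrt (1 - 4 * H t)"
      using b t H_lt[OF t] by (intro divide_left_mono) (auto intro!: mult_pos_pos)
    moreover have "1 / sqrt (b * t powr \<delta>) = (1 / sqrt b) * t powr (-(\<delta> / 2))"
      using t by (simp add: real_sqrt_mult sq powr_minus_divide)
    ultimately show ?thesis by simp
  qed
  show "ubound (\<delta> / 2) (\<lambda>n. \<Sum>m\<le>n. D $ m)"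
    by (rule abelian_partial_sums_upper[OF D_nonneg F ub])
  show "lbound (\<delta> / 2) (\<lambda>n. \<Sum>m\<le>n. D $ m)"
    by (rule tauberian_partial_sums_lower[OF D_nonneg _ _ F lb ub]) (use b \<delta> in auto)
qed

lemma D_square_partial_sums: "lbound \<delta> (\<lambda>n. \<Sum>m\<le>n. D\<^sup>2 $ m)"
proof (rule tauberian_partial_sums_lower[OF D_square_nonneg, where a = "1 / b" and b = "1 / a"])
  fix t :: real assume t: "0 < t" "t \<le> 1"
  show "(\<lambda>n. D\<^sup>2 $ n * exp (-t) ^ n) sums (1 / (1 - 4 * H t))"
    using t by (intro D_exp_sums H_lt) auto
  have "1 / (1 - 4 * H t) \<le> 1 / (a * t powr \<delta>)"
    using a t H_lower[OF t] H_lt[OF t] by (intro divide_left_mono) (auto intro!: mult_pos_pos)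
  then show "1 / (1 - 4 * H t) \<le> 1 / a * t powr (-\<delta>)" using t by (simp add: powr_minus_divide)
  have "1 / (b * t powr \<delta>) \<le> 1 / (1 - 4 * H t)"
    using b t H_upper[OF t] H_lt[OF t] by (intro divide_left_mono) (auto intro!: mult_pos_pos)
  then show "1 / b * t powr (-\<delta>) \<le> 1 / (1 - 4 * H t)" using t by (simp add: powr_minus_divide)
qed (use b \<delta> in auto)

lemma D_ubound:
  assumes "\<And>n. (fps_X * fps_deriv h * D\<^sup>2) $ n \<le> C"
  shows "ubound (\<delta> / 2 - 1) (fps_nth D)"
proof (rule ubound_of_X_deriv[where ?C0.0 = 1])
  let ?V = "fps_X * fps_deriv h * D\<^sup>2"
  have "0 \<le> ?V $ 0" by (simp add: fps_mult_nth)
  then have C: "C \<ge> 0" using assms[of 0] by linarith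
  obtain S where S: "S \<ge> 0" "\<And>n. (\<Sum>m\<le>n. D $ m) \<le> S * (real n + 1) powr (\<delta> / 2)"
    using D_partial_sums(1) by (auto simp: ubound_def)
  have "(fps_X * fps_deriv D) $ n \<le> (2 * C * S) * (real n + 1) powr (\<delta> / 2)" for n
  proof -
    have "(fps_X * fps_deriv D) $ n = 2 * (?V * D) $ n"
      unfolding D_deriv mult.assoc[of 2] fps_two_mult_nth ..
    also have "(?V * D) $ n = (\<Sum>i=0..n. D $ i * ?V $ (n - i))"
      by (subst mult.commute) (simp add: fps_mult_nth)
    also have "\<dots> \<le> (\<Sum>i=0..n. D $ i * C)"
      by (intro sum_mono mult_left_mono assms D_nonneg)
    also have "\<dots> = C * (\<Sum>i\<le>n. D $ i)" by (simp add: sum_distrib_left atMost_atLeast0 mult.commute)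
    also have "\<dots> \<le> C * (S * (real n + 1) powr (\<delta> / 2))" by (intro mult_left_mono S C)
    finally show ?thesis by simp
  qed
  then show "ubound (\<delta> / 2) (fps_nth (fps_X * fps_deriv D))" by (rule uboundI)
qed (simp add: D_zero)

text \<open>The counterpart of \<open>D_ubound\<close>. The window is attached to
  \<open>X h' D\<^sup>2\<close>, whose single coefficients need not stay away from 0, and travels
  through the product with \<open>D\<close>.\<close>

lemma D_window_lbound:
  assumes "lbound 0 (fps_nth (fps_X * fps_deriv h * D\<^sup>2 * window L))"
  shows "lbound (\<delta> / 2 - 1) (fps_nth (D * window L))"
proof (rule lbound_window_of_X_deriv[OF _ D_nonneg])
  let ?V = "fps_X * fps_deriv h * D\<^sup>2"
  have V: "0 \<le> ?V $ n" for n by (rule fps_mult_nonneg[OF X_deriv_h_nonneg D_square_nonneg])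
  have "lbound (-0) (fps_nth (?V * window L))" unfolding minus_zero by (rule assms)
  then have "lbound (\<delta> / 2 - 0) (fps_nth (?V * window L * D))"
    by (rule lbound_fps_mult[OF _ fps_mult_nonneg[OF V window_nonneg] order_refl D_partial_sums(2) D_nonneg])
  moreover have "fps_X * fps_deriv D * window L = 2 * (?V * window L * D)"
    unfolding D_deriv by (simp only: mult_ac)
  moreover have "lbound e (fps_nth f) \<Longrightarrow> lbound e (fps_nth (2 * f))" for e f
    by (rule lbound_le[of _ _ 2 0]) auto
  ultimately show "lbound (\<delta> / 2) (fps_nth (fps_X * fps_deriv D * window L))"
    by (simp only: diff_zero)
qed

end

section \<open>The two kinds of critical levels\<close>

lemma lbound_mult_coeff:
  fixes f g :: "real fps"
  assumes "lbound e (fps_nth g)" "f $ m > 0" "\<And>n. 0 \<le> f $ n" "\<And>n. 0 \<le> g $ n"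
  shows "lbound e (fps_nth (f * g))"
proof (rule lbound_le[OF lbound_shift[OF assms(1), of m] assms(2), of m])
  fix n assume "n \<ge> m"
  then show "f $ m * g $ (n - m) \<le> (f * g) $ n"
    using fps_mult_nth_ge[of f g m "n - m"] assms by simp
qed

context critical_fps
begin

text \<open>The exponent 3 gives finite mean and a summable tail with room to spare. It costs
  nothing, since the levels above the last critical one decay as fast as desired.\<close>

context
  assumes h_decay: "ubound (-3) (fps_nth h)"
begin

lemma X_deriv_h_ubound: "ubound (-2) (fps_nth (fps_X * fps_deriv h))"
  by (rule ubound_X_deriv) (use h_decay h_nonneg in auto)

lemma summable_X_deriv_h: "summable (fps_nth (fps_X * fps_deriv h))"
  by (rule ubound_summable[OF X_deriv_h_ubound _ X_deriv_h_nonneg]) simp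

definition \<mu> where "\<mu> = (\<Sum>n. (fps_X * fps_deriv h) $ n)"

text \<open>With \<open>x = exp (-t)\<close> and \<open>n \<ge> 1\<close>, the quantity
  \<open>1 - x ^ n\<close> lies between \<open>1 - x\<close> and \<open>n * (1 - x)\<close>. Summing
  against \<open>h\<close> gives the mass \<open>1/4\<close> below and the mean \<open>\<mu>\<close>
  above; the constant \<open>1/2\<close> comes from \<open>t / 2 \<le> 1 - exp (-t)\<close>.\<close>

lemma finite_mean_exponent: "critical_exponent_fps w h 1 (1/2) (4 * \<mu>)"
proof
  fix t :: real assume t: "0 < t" "t \<le> 1"
  define x where "x = exp (-t)"
  have x: "0 \<le> x" "x \<le> 1" using t by (auto simp: x_def)
  have s: "(\<lambda>n. h $ n - h $ n * x ^ n) sums (1/4 - H t)"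
    unfolding x_def using t by (intro sums_diff h_sums H_sums) simp
  have s1: "(\<lambda>n. (1 - x) * h $ n) sums ((1 - x) * (1/4))"
    by (intro sums_mult h_sums)
  have s2: "(\<lambda>n. (1 - x) * (fps_X * fps_deriv h) $ n) sums ((1 - x) * \<mu>)"
    unfolding \<mu>_def by (rule sums_mult[OF summable_sums[OF summable_X_deriv_h]])
  have "(1 - x) * h $ n \<le> h $ n - h $ n * x ^ n" for n
  proof (cases n)
    case (Suc m)
    have "x ^ n \<le> x" using x power_le_one[of x m] mult_left_mono[of "x ^ m" 1 x] Suc by simp
    then have "h $ n * x ^ n \<le> h $ n * x" using h_nonneg by (rule mult_left_mono)
    then show ?thesis by (simp add: algebra_simps)
  qed (simp add: h_zero)
  then have "(1 - x) * (1/4) \<le> 1/4 - H t" using s1 s by (rule sums_le)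
  then show "1/2 * t powr 1 \<le> 1 - 4 * H t"
    using one_minus_exp_bounds(1)[OF t] t by (simp add: x_def)
  have "h $ n - h $ n * x ^ n \<le> (1 - x) * (fps_X * fps_deriv h) $ n" for n
  proof -
    have "1 + real n * (x - 1) \<le> (1 + (x - 1)) ^ n" using x by (intro Bernoulli_inequality) auto
    then have "1 - x ^ n \<le> real n * (1 - x)" by (simp add: algebra_simps)
    then have "h $ n * (1 - x ^ n) \<le> h $ n * (real n * (1 - x))" using h_nonneg by (rule mult_left_mono)
    then show ?thesis unfolding fps_X_deriv_nth by (simp add: algebra_simps)
  qed
  then have 1: "1/4 - H t \<le> (1 - x) * \<mu>" using s s2 by (rule sums_le)
  have "\<mu> \<ge> 0" unfolding \<mu>_def using summable_X_deriv_h X_deriv_h_nonneg by (intro suminf_nonneg) auto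
  then have "(1 - x) * \<mu> \<le> t * \<mu>" using one_minus_exp_bounds(2)[OF t] by (intro mult_right_mono) (auto simp: x_def)
  then have "1 - 4 * H t \<le> 4 * (t * \<mu>)" using 1 by linarith
  then show "1 - 4 * H t \<le> 4 * \<mu> * t powr 1" using t by (simp add: mult.commute[of t] mult.assoc)
qed auto

lemma finite_mean_V_le: "(fps_X * fps_deriv h * D\<^sup>2) $ n \<le> \<mu>"
proof -
  have "(fps_X * fps_deriv h * D\<^sup>2) $ n = (\<Sum>i=0..n. (fps_X * fps_deriv h) $ i * D\<^sup>2 $ (n - i))"
    by (rule fps_mult_nth)
  also have "\<dots> \<le> (\<Sum>i=0..n. (fps_X * fps_deriv h) $ i * 1)"
    by (intro sum_mono mult_left_mono D_square_le_1 X_deriv_h_nonneg)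
  also have "\<dots> \<le> \<mu>"
    unfolding \<mu>_def mult_1_right
    by (rule sum_le_suminf[OF summable_X_deriv_h finite_atLeastAtMost X_deriv_h_nonneg])
  finally show ?thesis .
qed

lemma r_summable: "summable r"
proof -
  obtain C where C: "C \<ge> 0" "\<And>n. h $ n \<le> C * (real n + 1) powr (-3)"
    using h_decay by (auto simp: ubound_def)
  define p where "p = (\<lambda>n::nat. (real n + 1) powr (-3/2))"
  have "ubound (-3/2) p" by (rule uboundI[of _ 1]) (simp add: p_def)
  then have ps: "summable p" by (rule ubound_summable) (auto simp: p_def)
  have "r n \<le> (4 * (C * suminf p)) * (real n + 1) powr (-3/2)" for n
  proof -
    have "(\<Sum>m. h $ (m + Suc n)) \<le> (\<Sum>m. (C * (real n + 1) powr (-3/2)) * p m)"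
    proof (rule suminf_le)
      fix m
      \<comment> \<open>The exponent 3 is shared equally: one half yields decay in \<open>n\<close>,
        the other a convergent sum over \<open>m\<close>, and \<open>-3/2\<close> is below
        \<open>-1\<close> for both purposes.\<close>
      have "(real (m + Suc n) + 1) powr (-3/2) \<le> (real m + 1) powr (-3/2)"
        by (intro powr_mono2') auto
      moreover have "(real (m + Suc n) + 1) powr (-3/2) \<le> (real n + 1) powr (-3/2)"
        by (intro powr_mono2') auto
      ultimately have "(real (m + Suc n) + 1) powr (-3/2) * (real (m + Suc n) + 1) powr (-3/2)
          \<le> (real n + 1) powr (-3/2) * (real m + 1) powr (-3/2)"
        by (intro mult_mono) auto
      then have "(real (m + Suc n) + 1) powr (-3) \<le> (real n + 1) powr (-3/2) * p m"
        by (simp only: powr_add[symmetric] p_def) simp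
      then have "C * (real (m + Suc n) + 1) powr (-3) \<le> C * ((real n + 1) powr (-3/2) * p m)"
        using C(1) by (rule mult_left_mono)
      then show "h $ (m + Suc n) \<le> (C * (real n + 1) powr (-3/2)) * p m"
        using C(2)[of "m + Suc n"] by linarith
    next
      show "summable (\<lambda>m. h $ (m + Suc n))"
        using h_sums by (intro summable_ignore_initial_segment) (auto simp: sums_iff)
      show "summable (\<lambda>m. (C * (real n + 1) powr (-3/2)) * p m)" by (rule summable_mult[OF ps])
    qed
    also have "\<dots> = (C * (real n + 1) powr (-3/2)) * suminf p" by (rule suminf_mult[OF ps])
    finally show ?thesis by (simp add: r_eq_tail mult_ac)
  qed
  then have "ubound (-3/2) r" by (rule uboundI)
  then show ?thesis by (rule ubound_summable) (auto simp: r_nonneg)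
qed

text \<open>
  The elementary half of the renewal theorem: the mass of \<open>r\<close> beyond \<open>L\<close> is below \<open>1/2\<close>, so the
  identity \<open>D\<^sup>2 * r = 1\<close> forces mass \<open>1/2\<close> of \<open>D\<^sup>2\<close> into every window of length \<open>L\<close>. No aperiodicity is
  needed, which matters for \<open>k = 1\<close>, where level 1 is critical and only has terms of odd size.
\<close>

lemma D_square_window_ge: "\<exists>L. \<forall>n. 1/2 \<le> (D\<^sup>2 * window L) $ n"
proof -
  have "\<forall>\<^sub>F L in sequentially. (\<Sum>m. r (m + L)) < 1/2"
    using suminf_exist_split2[OF r_summable] by (rule order_tendstoD) simp
  then obtain L where L: "(\<Sum>m. r (m + L)) < 1/2" by (auto simp: eventually_sequentially)
  define q where "q = (\<lambda>m. if L \<le> m then r m else 0)"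
  have q: "summable q" "suminf q = (\<Sum>m. r (m + L))"
  proof -
    have "summable (\<lambda>i. q (i + L))" using r_summable by (simp add: q_def summable_iff_shift)
    then show s: "summable q" by (simp add: summable_iff_shift)
    show "suminf q = (\<Sum>i. r (i + L))"
      using suminf_split_initial_segment[OF s, of L] by (simp add: q_def)
  qed
  have "1/2 \<le> (D\<^sup>2 * window L) $ n" for n
  proof -
    have "1 = (\<Sum>i=0..n. D\<^sup>2 $ i * r (n - i))" by (rule D_square_conv_r_nth[symmetric])
    \<comment> \<open>Inside the window \<open>r\<close> is replaced by 1, outside of it
      \<open>D\<^sup>2\<close> is.\<close>
    also have "\<dots> \<le> (\<Sum>i=0..n. (if n - i < L then D\<^sup>2 $ i else 0) + q (n - i))"
    proof (rule sum_mono)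
      fix i
      show "D\<^sup>2 $ i * r (n - i) \<le> (if n - i < L then D\<^sup>2 $ i else 0) + q (n - i)"
        using mult_left_mono[OF r_le_1[of "n - i"] D_square_nonneg[of i]]
          mult_right_mono[OF D_square_le_1[of i] r_nonneg[of "n - i"]] by (simp add: q_def)
    qed
    also have "\<dots> = (D\<^sup>2 * window L) $ n + (\<Sum>i=0..n. q (n - i))"
      by (simp only: sum.distrib mult_window_nth)
    also have "(\<Sum>i=0..n. q (n - i)) = (\<Sum>i=0..n. q i)"
      using sum.atLeastAtMost_rev[of q 0 n] by simp
    also have "\<dots> \<le> suminf q" using q(1) r_nonneg by (intro sum_le_suminf) (auto simp: q_def)
    finally show ?thesis using L q(2) by simp
  qed
  then show ?thesis by blast
qed

proposition critical_finite_mean: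
  shows "ubound (-1/2) (fps_nth D)" "lbound (1/2) (\<lambda>n. \<Sum>m\<le>n. D $ m)" "ubound (-3/2) (fps_nth w)"
    and "\<exists>L. lbound (-1/2) (fps_nth (D * window L)) \<and> lbound (-3/2) (fps_nth (w * window L))"
proof -
  interpret critical_exponent_fps w h 1 "1/2" "4 * \<mu>" by (rule finite_mean_exponent)
  show D: "ubound (-1/2) (fps_nth D)" using D_ubound[OF finite_mean_V_le] by simp
  show "lbound (1/2) (\<lambda>n. \<Sum>m\<le>n. D $ m)" using D_partial_sums(2) .
  have "ubound (-1/2) (fps_nth (fps_X * fps_deriv w))"
    unfolding w_deriv
    using ubound_fps_mult[of 2 "fps_X * fps_deriv h" "1/2" D] X_deriv_h_ubound X_deriv_h_nonneg D D_nonneg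
    by simp
  from ubound_of_X_deriv[OF this, of 0] show "ubound (-3/2) (fps_nth w)" by (simp add: w_zero)
  obtain L where L: "\<And>n. 1/2 \<le> (D\<^sup>2 * window L) $ n" using D_square_window_ge by blast
  \<comment> \<open>A single positive coefficient of \<open>X h'\<close> carries the lower bounds
    for block sums over to the products.\<close>
  obtain m where m: "m > 0" "h $ m > 0" using h_pos_somewhere by blast
  have Xm: "(fps_X * fps_deriv h) $ m > 0" unfolding fps_X_deriv_nth using m by simp
  have "lbound 0 (fps_nth (fps_X * fps_deriv h * (D\<^sup>2 * window L)))"
  proof (rule lbound_mult_coeff[OF _ Xm X_deriv_h_nonneg])
    show "lbound 0 (fps_nth (D\<^sup>2 * window L))" using L by (intro lboundI[of "1/2" 0]) auto
    show "0 \<le> (D\<^sup>2 * window L) $ n" for n using L[of n] by simp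
  qed
  then have DL: "lbound (-1/2) (fps_nth (D * window L))"
    using D_window_lbound[of L] by (simp add: mult.assoc)
  have "lbound (-1/2) (fps_nth (fps_X * fps_deriv h * (D * window L)))"
    by (rule lbound_mult_coeff[OF DL Xm X_deriv_h_nonneg fps_mult_nonneg[OF D_nonneg window_nonneg]])
  then have "lbound (-1/2) (fps_nth (fps_X * fps_deriv w * window L))"
    unfolding w_deriv by (simp only: mult.assoc)
  from lbound_window_of_X_deriv[OF this w_nonneg] DL
  show "\<exists>L. lbound (-1/2) (fps_nth (D * window L)) \<and> lbound (-3/2) (fps_nth (w * window L))" by auto
qed

end

section \<open>Critical levels whose distribution has infinite mean\<close>

lemma r_diff_window: "r n - r (n + L) = 4 * (h * window L) $ (n + L)"
proof -
  have "(h * window L) $ (n + L) = (\<Sum>i\<in>{i\<in>{0..n+L}. n + L - i < L}. h $ i)"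
    unfolding mult_window_nth by (subst sum.inter_filter) auto
  also have "{i\<in>{0..n+L}. n + L - i < L} = {..n+L} - {..n}" by auto
  also have "(\<Sum>i\<in>\<dots>. h $ i) = (\<Sum>i\<le>n+L. h $ i) - (\<Sum>i\<le>n. h $ i)"
    by (intro sum_diff) auto
  finally show ?thesis by (simp add: r_def)
qed

lemma r_antimono: "m \<le> n \<Longrightarrow> r n \<le> r m"
  unfolding r_def using h_nonneg by (intro diff_left_mono mult_left_mono sum_mono2) auto

text \<open>The tail beyond \<open>n\<close> contains \<open>n + 1\<close> consecutive blocks of
  length \<open>L\<close>. Their indices are at most of order \<open>(L + 1) * (n + 1)\<close>, so
  each block contributes at least a constant times \<open>(real n + 1) powr (-3/2)\<close>.\<close>

lemma r_lower:
  assumes "lbound (-3/2) (fps_nth (h * window L))"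
  shows "\<exists>c>0. \<forall>n. c * (real n + 1) powr (-1/2) \<le> r n"
proof -
  obtain c N where c: "c > 0" "\<And>n. n \<ge> N \<Longrightarrow> c * (real n + 1) powr (-3/2) \<le> (h * window L) $ n"
    by (rule lboundE[OF assms]) blast
  define c' where "c' = 4 * c * (real L + 1) powr (-3/2)"
  have c': "c' > 0" using c by (simp add: c'_def)
  have large: "c' * (real n + 1) powr (-1/2) \<le> r n" if n: "n \<ge> N" for n
  proof -
    have "r (n + K * L) + real K * (c' * (real n + 1) powr (-3/2)) \<le> r n" if "K \<le> n + 1" for K
      using that
    proof (induction K)
      case (Suc K)
      have "real (n + K * L + L) + 1 \<le> (real L + 1) * (real n + 1)"
      proof -
        have "K * L + L \<le> (n + 1) * L" using Suc.prems mult_le_mono1[of "Suc K" "n + 1" L] by simp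
        then have "n + K * L + L + 1 \<le> (L + 1) * (n + 1)" by (simp add: algebra_simps)
        then have "real (n + K * L + L + 1) \<le> real ((L + 1) * (n + 1))" by (rule of_nat_mono)
        then show ?thesis by (simp add: algebra_simps)
      qed
      then have "((real L + 1) * (real n + 1)) powr (-3/2) \<le> (real (n + K * L + L) + 1) powr (-3/2)"
        using of_nat_0_le_iff[of "n + K * L + L", where ?'a = real] by (intro powr_mono2') linarith+
      then have "(real L + 1) powr (-3/2) * (real n + 1) powr (-3/2) \<le> (real (n + K * L + L) + 1) powr (-3/2)"
        by (simp add: powr_mult)
      then have "4 * c * ((real L + 1) powr (-3/2) * (real n + 1) powr (-3/2)) \<le> 4 * c * (real (n + K * L + L) + 1) powr (-3/2)"
        using c(1) by (intro mult_left_mono) auto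
      then have "c' * (real n + 1) powr (-3/2) \<le> 4 * (c * (real (n + K * L + L) + 1) powr (-3/2))"
        by (simp add: c'_def mult.assoc)
      also have "\<dots> \<le> 4 * (h * window L) $ (n + K * L + L)"
        using n by (intro mult_left_mono c) auto
      also have "\<dots> = r (n + K * L) - r (n + Suc K * L)"
        using r_diff_window[of "n + K * L" L] by (simp add: algebra_simps)
      finally show ?case using Suc by (simp add: algebra_simps)
    qed simp
    from this[of "n + 1"] have "real (n + 1) * (c' * (real n + 1) powr (-3/2)) \<le> r n"
      using r_nonneg[of "n + (n + 1) * L"] by linarith
    then have "(real n + 1) * (c' * (real n + 1) powr (-3/2)) \<le> r n" by (simp only: of_nat_add of_nat_1)
    moreover have "(real n + 1) * (real n + 1) powr (-3/2) = (real n + 1) powr (-1/2)"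
      using powr_mult_base[of "real n + 1" "-3/2"] by simp
    ultimately show ?thesis by (simp add: mult.left_commute)
  qed
  \<comment> \<open>The threshold \<open>N\<close> is removed by monotonicity: \<open>r n\<close> is
    at least \<open>r (n + N)\<close>, and \<open>n + N + 1 \<le> (N + 1) * (n + 1)\<close>.\<close>
  have "c' * (real N + 1) powr (-1/2) * (real n + 1) powr (-1/2) \<le> r n" for n
  proof -
    have "((real N + 1) * (real n + 1)) powr (-1/2) \<le> (real (n + N) + 1) powr (-1/2)"
      by (intro powr_mono2') (auto simp: algebra_simps)
    then have "c' * ((real N + 1) powr (-1/2) * (real n + 1) powr (-1/2)) \<le> c' * (real (n + N) + 1) powr (-1/2)"
      using c' by (intro mult_left_mono) (auto simp: powr_mult)
    also have "\<dots> \<le> r (n + N)" by (rule large) simp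
    also have "\<dots> \<le> r n" by (rule r_antimono) simp
    finally show ?thesis by (simp add: mult.assoc)
  qed
  then show ?thesis using c' by (intro exI[of _ "c' * (real N + 1) powr (-1/2)"]) auto
qed

end

text \<open>Here \<open>X h'\<close> is only of order \<open>-1/2\<close> and not summable, so
  \<open>D\<^sup>2 \<le> 1\<close> no longer bounds \<open>X h' D\<^sup>2\<close>; the comparison
  with the tail \<open>r\<close> takes its place. In the lower bound the exponents
  \<open>\<delta>\<close> of the partial sums of \<open>D\<^sup>2\<close> and \<open>-1/2\<close> of
  \<open>X h'\<close> cancel.\<close>

proposition (in critical_exponent_fps) critical_heavy_tail:
  assumes \<delta>: "\<delta> = 1/2" and hu: "ubound (-3/2) (fps_nth h)" and hl: "lbound (-3/2) (fps_nth (h * window L))"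
  shows "ubound (-3/4) (fps_nth D)" "lbound (-3/4) (fps_nth (D * window L))"
    "ubound (-5/4) (fps_nth w)" "lbound (-5/4) (fps_nth (w * window L))"
proof -
  let ?g = "fps_X * fps_deriv h"
  obtain c where c: "c > 0" "\<And>n. c * (real n + 1) powr (-1/2) \<le> r n" using r_lower[OF hl] by blast
  have gu: "ubound (-1/2) (fps_nth ?g)" by (rule ubound_X_deriv) (use hu h_nonneg in auto)
  then obtain C where C: "C \<ge> 0" "\<And>n. ?g $ n \<le> C * (real n + 1) powr (-1/2)"
    unfolding ubound_def by blast
  \<comment> \<open>\<open>n h n\<close> is dominated by the tail \<open>r n\<close>, and \<open>r * D\<^sup>2\<close> is the constant sequence 1.\<close>
  have V: "(?g * D\<^sup>2) $ n \<le> C / c" for n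
  proof -
    have "(?g * D\<^sup>2) $ n \<le> (fps_const (C / c) * Abs_fps r * D\<^sup>2) $ n"
    proof (rule fps_mult_mono[OF X_deriv_h_nonneg _ D_square_nonneg order_refl])
      fix n
      have "?g $ n \<le> C * (real n + 1) powr (-1/2)" by (rule C)
      also have "\<dots> \<le> C * (r n / c)" using c by (intro mult_left_mono C) (simp add: field_simps)
      finally show "?g $ n \<le> (fps_const (C / c) * Abs_fps r) $ n" by simp
    qed
    also have "fps_const (C / c) * Abs_fps r * D\<^sup>2 = fps_const (C / c) * (D\<^sup>2 * Abs_fps r)"
      by (simp only: mult_ac)
    also have "\<dots> = fps_const (C / c) * Abs_fps (\<lambda>_. 1)" by (simp only: D_square_conv_r)
    finally show ?thesis by simp
  qed
  have g1: "\<And>n. 0 \<le> (?g * window L) $ n" by (rule fps_mult_nonneg[OF X_deriv_h_nonneg window_nonneg])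
  have gl: "lbound (-(1/2)) (fps_nth (?g * window L))"
    by (rule lbound_X_deriv_window) (use hl h_nonneg in auto)
  show D: "ubound (-3/4) (fps_nth D)" using D_ubound[OF V] \<delta> by simp
  have "lbound (\<delta> - 1/2) (fps_nth (?g * window L * D\<^sup>2))"
    by (rule lbound_fps_mult[OF gl g1 _ D_square_partial_sums D_square_nonneg]) simp
  moreover have "?g * window L * D\<^sup>2 = ?g * D\<^sup>2 * window L" by (simp only: mult_ac)
  ultimately have "lbound 0 (fps_nth (?g * D\<^sup>2 * window L))" using \<delta> by simp
  from D_window_lbound[OF this] show "lbound (-3/4) (fps_nth (D * window L))" using \<delta> by simp
  have "ubound (1 - 1/2 - 3/4) (fps_nth (?g * D))"
  proof (rule ubound_fps_mult_partial_sums[OF _ X_deriv_h_nonneg _ _ _ D_nonneg])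
    show "ubound (1 - 1/2) (\<lambda>n. sum (($) ?g) {..n})"
      using ubound_partial_sums_half[OF gu] by simp
    show "ubound (1 - 3/4) (\<lambda>n. sum (($) D) {..n})" using D_partial_sums(1) \<delta> by simp
  qed (use gu D in auto)
  then have "ubound (-1/4) (fps_nth (fps_X * fps_deriv w))" unfolding w_deriv by simp
  from ubound_of_X_deriv[OF this, of 0] show "ubound (-5/4) (fps_nth w)" by (simp add: w_zero)
  have "lbound (\<delta> / 2 - 1/2) (fps_nth (?g * window L * D))"
    by (rule lbound_fps_mult[OF gl g1 _ D_partial_sums(2) D_nonneg]) simp
  moreover have "?g * window L * D = fps_X * fps_deriv w * window L"
    unfolding w_deriv by (simp only: mult_ac)
  ultimately have "lbound (-1/4) (fps_nth (fps_X * fps_deriv w * window L))" using \<delta> by simp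
  from lbound_window_of_X_deriv[OF this w_nonneg] show "lbound (-5/4) (fps_nth (w * window L))" by simp
qed

section \<open>Generating functions of terms by level\<close>

definition level_terms :: "nat \<Rightarrow> nat \<Rightarrow> nat \<Rightarrow> lam set" where
  "level_terms k i n =
     {t. closed_below i t \<and> (\<forall>(c, l) \<in># nodes i t. l \<le> k) \<and> size (nodes i t) = n}"

lemma closed_terms_eq: "closed_terms k n = level_terms k 0 n"
  by (simp add: closed_terms_def level_terms_def)

lemma finite_level_terms [simp]: "finite (level_terms k i n)"
  by (rule finite_subset[OF _ finite_closed_below[of i n]]) (auto simp: level_terms_def)

lemma level_terms_0 [simp]: "level_terms k i 0 = {}"
proof -
  have "nodes i t \<noteq> {#}" for t by (cases t) auto
  then show ?thesis by (auto simp: level_terms_def)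
qed

lemma level_terms_above: "k < i \<Longrightarrow> level_terms k i n = {}"
  using ex_node_at_root[of i] by (fastforce simp: level_terms_def)

lemma level_terms_Suc:
  assumes "i \<le> k"
  shows "level_terms k i (Suc n) = (if n = 0 then Var ` {1..i} else {}) \<union> Abs ` level_terms k (Suc i) n
    \<union> (\<Union>p\<in>{0..n}. case_prod App ` (level_terms k i p \<times> level_terms k i (n - p)))"
    (is "?L = ?R")
proof (intro equalityI subsetI)
  fix t assume "t \<in> ?L"
  then show "t \<in> ?R"
  proof (cases t)
    case (App t1 t2)
    define p where "p = size (nodes i t1)"
    have "t1 \<in> level_terms k i p" "t2 \<in> level_terms k i (n - p)" "p \<in> {0..n}"
      using \<open>t \<in> ?L\<close> App by (auto simp: level_terms_def p_def)
    then have "t \<in> (\<Union>p\<in>{0..n}. case_prod App ` (level_terms k i p \<times> level_terms k i (n - p)))"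
      unfolding App by (intro UN_I[of p] image_eqI[of _ _ "(t1, t2)"]) auto
    then show ?thesis by blast
  qed (auto simp: level_terms_def)
next
  fix t assume "t \<in> ?R"
  then show "t \<in> ?L"
    using assms by (auto simp: level_terms_def split: if_splits)
qed

lemma sum_level_terms_Suc:
  fixes F :: "lam \<Rightarrow> real"
  assumes "i \<le> k"
  shows "(\<Sum>t\<in>level_terms k i (Suc n). F t) = (if n = 0 then \<Sum>j=1..i. F (Var j) else 0)
    + (\<Sum>t\<in>level_terms k (Suc i) n. F (Abs t))
    + (\<Sum>p=0..n. \<Sum>s\<in>level_terms k i p. \<Sum>t\<in>level_terms k i (n - p). F (App s t))"
proof -
  let ?A = "if n = 0 then Var ` {1..i} else {}" and ?B = "Abs ` level_terms k (Suc i) n"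
    and ?C = "\<lambda>p. case_prod App ` (level_terms k i p \<times> level_terms k i (n - p))"
  have A: "sum F ?A = (if n = 0 then \<Sum>j=1..i. F (Var j) else 0)"
    by (auto simp: sum.reindex inj_on_def)
  have B: "sum F ?B = (\<Sum>t\<in>level_terms k (Suc i) n. F (Abs t))"
    by (subst sum.reindex) (auto simp: inj_on_def)
  have C: "sum F (?C p) = (\<Sum>s\<in>level_terms k i p. \<Sum>t\<in>level_terms k i (n - p). F (App s t))" for p
    by (subst sum.reindex) (auto simp: inj_on_def sum.cartesian_product intro!: sum.cong)
  have U: "sum F (\<Union>p\<in>{0..n}. ?C p) = (\<Sum>p=0..n. sum F (?C p))"
    by (intro sum.UNION_disjoint ballI impI finite_atLeastAtMost finite_imageI finite_cartesian_product
        finite_level_terms) (auto simp: level_terms_def)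
  have "sum F (level_terms k i (Suc n)) = sum F (?A \<union> ?B) + sum F (\<Union>p\<in>{0..n}. ?C p)"
    unfolding level_terms_Suc[OF assms] by (rule sum.union_disjoint) (auto split: if_splits)
  also have "sum F (?A \<union> ?B) = sum F ?A + sum F ?B"
    by (rule sum.union_disjoint) (auto split: if_splits)
  finally show ?thesis unfolding A B U C .
qed

text \<open>The weight \<open>F\<close> is left open so that the same recursion serves for counting
  terms and for counting their nodes.\<close>

definition term_fps :: "nat \<Rightarrow> real \<Rightarrow> nat \<Rightarrow> (lam \<Rightarrow> real) \<Rightarrow> real fps" where
  "term_fps k \<rho> i F = Abs_fps (\<lambda>n. \<rho> ^ n * (\<Sum>t\<in>level_terms k i n. F t))"

lemma term_fps_above: "k < i \<Longrightarrow> term_fps k \<rho> i F = 0"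
  by (simp add: term_fps_def level_terms_above fps_eq_iff)

lemma term_fps_add: "term_fps k \<rho> i (\<lambda>t. F t + G t) = term_fps k \<rho> i F + term_fps k \<rho> i G"
  by (simp add: term_fps_def fps_eq_iff sum.distrib algebra_simps)

lemma term_fps_mult:
  "(term_fps k \<rho> i F * term_fps k \<rho> i G) $ n
     = \<rho> ^ n * (\<Sum>p=0..n. \<Sum>s\<in>level_terms k i p. \<Sum>t\<in>level_terms k i (n - p). F s * G t)"
proof -
  have "(term_fps k \<rho> i F * term_fps k \<rho> i G) $ n
      = (\<Sum>p=0..n. \<rho> ^ p * \<rho> ^ (n - p) * (sum F (level_terms k i p) * sum G (level_terms k i (n - p))))"
    by (simp add: fps_mult_nth term_fps_def mult_ac)
  also have "\<dots> = (\<Sum>p=0..n. \<rho> ^ n * (\<Sum>s\<in>level_terms k i p. \<Sum>t\<in>level_terms k i (n - p). F s * G t))"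
    by (intro sum.cong refl) (simp add: power_add[symmetric] sum_product)
  finally show ?thesis by (simp only: sum_distrib_left)
qed

definition rX :: "real \<Rightarrow> real fps" where
  "rX \<rho> = fps_const \<rho> * fps_X"

lemma rX_nth_0 [simp]: "rX \<rho> $ 0 = 0"
  by (simp add: rX_def)

lemma rX_mult_nth: "(rX \<rho> * f) $ n = (if n = 0 then 0 else \<rho> * f $ (n - 1))"
  by (simp add: rX_def mult.assoc)

text \<open>The applications enter through an abstract series \<open>P\<close>: for constant
  \<open>F\<close> it is a square, for an additive \<open>F\<close> a sum of several
  products.\<close>

lemma term_fps_rec:
  assumes "i \<le> k"
    and app: "\<And>n. P $ n = \<rho> ^ n * (\<Sum>p=0..n. \<Sum>s\<in>level_terms k i p. \<Sum>t\<in>level_terms k i (n - p). F (App s t))"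
  shows "term_fps k \<rho> i F = rX \<rho> * (fps_const (\<Sum>j=1..i. F (Var j)) + term_fps k \<rho> (Suc i) (\<lambda>t. F (Abs t)) + P)"
proof (rule fps_ext)
  fix n
  show "term_fps k \<rho> i F $ n = (rX \<rho> * (fps_const (\<Sum>j=1..i. F (Var j)) + term_fps k \<rho> (Suc i) (\<lambda>t. F (Abs t)) + P)) $ n"
  proof (cases n)
    case (Suc m)
    show ?thesis
      unfolding Suc rX_mult_nth
      by (simp add: term_fps_def app sum_level_terms_Suc[OF assms(1)] algebra_simps)
  qed (simp add: term_fps_def rX_mult_nth)
qed

text \<open>
  The factor \<open>\<rho> X\<close> turns the recursion of the counting series into the quadratic equation of
  \<open>quadratic_fps\<close>; coefficient \<open>n + 1\<close> belongs to terms of size \<open>n\<close>.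
\<close>

definition level_fps :: "nat \<Rightarrow> real \<Rightarrow> nat \<Rightarrow> real fps" where
  "level_fps k \<rho> i = rX \<rho> * term_fps k \<rho> i (\<lambda>_. 1)"

text \<open>This is \<open>h i\<close>, the part of the level that does not come from applications.
  A leaf has one factor \<open>rX \<rho>\<close> for its size and one for the shift, hence the
  square.\<close>

definition inner_fps :: "nat \<Rightarrow> real \<Rightarrow> nat \<Rightarrow> real fps" where
  "inner_fps k \<rho> i = fps_const (real i) * (rX \<rho>)\<^sup>2 + rX \<rho> * level_fps k \<rho> (Suc i)"

lemma level_fps_above: "k < i \<Longrightarrow> level_fps k \<rho> i = 0"
  by (simp add: level_fps_def term_fps_above)

lemma level_fps_rec:
  assumes "i \<le> k"
  shows "level_fps k \<rho> i = inner_fps k \<rho> i + (level_fps k \<rho> i)\<^sup>2"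
proof -
  let ?f = "\<lambda>i. term_fps k \<rho> i (\<lambda>_. 1)"
  have "?f i = rX \<rho> * (fps_const (real i) + ?f (Suc i) + ?f i * ?f i)"
    using term_fps_rec[OF assms, of "?f i * ?f i" \<rho> "\<lambda>_. 1"] by (simp add: term_fps_mult)
  then have "rX \<rho> * ?f i = rX \<rho> * (rX \<rho> * (fps_const (real i) + ?f (Suc i) + ?f i * ?f i))"
    by (rule arg_cong)
  also have "\<dots> = fps_const (real i) * (rX \<rho>)\<^sup>2 + rX \<rho> * (rX \<rho> * ?f (Suc i)) + (rX \<rho> * ?f i)\<^sup>2"
    by (simp add: algebra_simps power2_eq_square)
  finally show ?thesis unfolding level_fps_def inner_fps_def .
qed

text \<open>The same shift as in \<open>level_fps\<close>, so that both series are compared at the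
  same index.\<close>

definition node_fps :: "nat \<Rightarrow> real \<Rightarrow> kind \<Rightarrow> nat \<Rightarrow> nat \<Rightarrow> real fps" where
  "node_fps k \<rho> c l i = rX \<rho> * term_fps k \<rho> i (\<lambda>t. real (count (nodes i t) (c, l)))"

lemma level_fps_nonneg: "0 \<le> \<rho> \<Longrightarrow> 0 \<le> level_fps k \<rho> i $ n"
  unfolding level_fps_def rX_mult_nth by (simp add: term_fps_def)

lemma level_fps_zero: "level_fps k \<rho> i $ 0 = 0"
  by (simp add: level_fps_def rX_mult_nth)

lemma inner_fps_nth: "inner_fps k \<rho> i $ n
    = (if n = 2 then real i * \<rho>\<^sup>2 else 0) + (if n = 0 then 0 else \<rho> * level_fps k \<rho> (Suc i) $ (n - 1))"
proof -
  have "(fps_const (real i) * (rX \<rho>)\<^sup>2) $ n = (if n = 2 then real i * \<rho>\<^sup>2 else 0)"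
    by (simp add: power_mult_distrib rX_def fps_const_power fps_X_power_iff mult.assoc[symmetric])
  then show ?thesis
    unfolding inner_fps_def fps_add_nth rX_mult_nth by simp
qed

lemma inner_fps_nonneg: "0 \<le> \<rho> \<Longrightarrow> 0 \<le> inner_fps k \<rho> i $ n"
  unfolding inner_fps_nth using level_fps_nonneg by simp

lemma quadratic_level_fps:
  assumes "i \<le> k" "0 \<le> \<rho>"
  shows "quadratic_fps (level_fps k \<rho> i) (inner_fps k \<rho> i)"
  by unfold_locales
    (use assms in \<open>simp_all add: level_fps_zero level_fps_nonneg inner_fps_nonneg level_fps_rec[symmetric]\<close>)

text \<open>Marking a node acts as a derivation: in an application the mark lies in the left or in
  the right part, whence \<open>2 * level_fps k \<rho> i\<close>. The last two summands are the
  cases in which the root itself is marked.\<close>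

lemma node_fps_rec:
  assumes "i \<le> k" "c \<noteq> Leaf"
  shows "node_fps k \<rho> c l i = rX \<rho> * node_fps k \<rho> c l (Suc i) + 2 * level_fps k \<rho> i * node_fps k \<rho> c l i
    + (if c = Unary \<and> l = i then rX \<rho> * level_fps k \<rho> (Suc i) else 0)
    + (if c = Binary \<and> l = i then (level_fps k \<rho> i)\<^sup>2 else 0)"
proof -
  let ?f = "\<lambda>i. term_fps k \<rho> i (\<lambda>_. 1)" and ?N = "\<lambda>i t. real (count (nodes i t) (c, l))"
  let ?u = "if c = Unary \<and> l = i then 1 else 0 :: real" and ?b = "if c = Binary \<and> l = i then 1 else 0 :: real"
  let ?F = "\<lambda>i. term_fps k \<rho> i (?N i)"
  have P: "(?F i * ?f i + ?f i * ?F i + fps_const ?b * (?f i * ?f i)) $ n =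
    \<rho> ^ n * (\<Sum>p=0..n. \<Sum>s\<in>level_terms k i p. \<Sum>t\<in>level_terms k i (n - p). ?N i (App s t))" for n
  proof -
    \<comment> \<open>The trivial factors bring every summand into the product form of
      \<open>term_fps_mult\<close>.\<close>
    have N: "?N i (App s t) = ?N i s * 1 + 1 * ?N i t + ?b * (1 * 1)" for s t by simp
    show ?thesis
      unfolding N fps_add_nth fps_mult_left_const_nth term_fps_mult sum.distrib sum_distrib_left[symmetric]
      by (simp add: algebra_simps)
  qed
  have "term_fps k \<rho> (Suc i) (\<lambda>t. ?N i (Abs t)) = term_fps k \<rho> (Suc i) (\<lambda>t. ?N (Suc i) t + ?u)"
    by (intro arg_cong[of _ _ "term_fps k \<rho> (Suc i)"]) auto
  also have "\<dots> = ?F (Suc i) + fps_const ?u * ?f (Suc i)"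
    unfolding term_fps_add by (simp add: term_fps_def fps_eq_iff)
  finally have "?F i = rX \<rho> * (fps_const 0 + (?F (Suc i) + fps_const ?u * ?f (Suc i))
      + (?F i * ?f i + ?f i * ?F i + fps_const ?b * (?f i * ?f i)))"
    using term_fps_rec[OF assms(1) P] assms(2) by simp
  then have "rX \<rho> * ?F i = rX \<rho> * (rX \<rho> * (fps_const 0 + (?F (Suc i) + fps_const ?u * ?f (Suc i))
      + (?F i * ?f i + ?f i * ?F i + fps_const ?b * (?f i * ?f i))))"
    by (rule arg_cong)
  also have "\<dots> = rX \<rho> * (rX \<rho> * ?F (Suc i)) + 2 * (rX \<rho> * ?f i) * (rX \<rho> * ?F i)
      + fps_const ?u * (rX \<rho> * (rX \<rho> * ?f (Suc i))) + fps_const ?b * (rX \<rho> * ?f i)\<^sup>2"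
    by (simp only: fps_const_0_eq_0 algebra_simps power2_eq_square) simp
  also have "fps_const ?u * (rX \<rho> * (rX \<rho> * ?f (Suc i)))
      = (if c = Unary \<and> l = i then rX \<rho> * (rX \<rho> * ?f (Suc i)) else 0)" by simp
  also have "fps_const ?b * (rX \<rho> * ?f i)\<^sup>2 = (if c = Binary \<and> l = i then (rX \<rho> * ?f i)\<^sup>2 else 0)" by simp
  finally show ?thesis unfolding node_fps_def level_fps_def .
qed

lemma nodes_level_ge: "(c, l) \<in># nodes i t \<Longrightarrow> i \<le> l"
  by (induction t arbitrary: i) (auto, fastforce)

lemma node_fps_above: "l < i \<Longrightarrow> node_fps k \<rho> c l i = 0"
proof -
  assume "l < i"
  then have "count (nodes i t) (c, l) = 0" for t
    using nodes_level_ge[of c l i t] by (auto simp: count_eq_zero_iff)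
  then show ?thesis by (simp add: node_fps_def term_fps_def fps_zero_def[symmetric])
qed

definition source_fps :: "nat \<Rightarrow> real \<Rightarrow> kind \<Rightarrow> nat \<Rightarrow> real fps" where
  "source_fps k \<rho> c l = (if c = Unary then rX \<rho> * level_fps k \<rho> (Suc l) else (level_fps k \<rho> l)\<^sup>2)"

text \<open>The linear recursion is solved along the path to the marked node: each level up to
  \<open>l\<close> contributes the applications passed there, that is \<open>D i\<close>, and each
  of the \<open>l\<close> abstractions a factor \<open>rX \<rho>\<close>.\<close>

lemma node_fps_eq:
  assumes "l \<le> k" "c \<noteq> Leaf" "0 \<le> \<rho>"
  shows "node_fps k \<rho> c l 0 = (rX \<rho>) ^ l * (\<Prod>i\<le>l. fps_res (level_fps k \<rho> i)) * source_fps k \<rho> c l"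
proof -
  let ?D = "\<lambda>i. fps_res (level_fps k \<rho> i)"
  have step: "node_fps k \<rho> c l i = ?D i * (rX \<rho> * node_fps k \<rho> c l (Suc i)
      + (if l = i then source_fps k \<rho> c l else 0))" if "i \<le> l" for i
  proof -
    interpret quadratic_fps "level_fps k \<rho> i" "inner_fps k \<rho> i"
      by (rule quadratic_level_fps) (use that assms in auto)
    let ?R = "rX \<rho> * node_fps k \<rho> c l (Suc i) + (if l = i then source_fps k \<rho> c l else 0)"
    have "node_fps k \<rho> c l i = 2 * level_fps k \<rho> i * node_fps k \<rho> c l i + ?R"
      using node_fps_rec[of i k c \<rho> l] that assms by (cases c) (auto simp: source_fps_def add_ac)
    then have "node_fps k \<rho> c l i * (1 - 2 * level_fps k \<rho> i) = ?R" by (simp add: algebra_simps)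
    then have "node_fps k \<rho> c l i * (D * (1 - 2 * level_fps k \<rho> i)) = D * ?R"
      by (metis mult.left_commute)
    then show ?thesis by (simp only: D_mult mult_1_right)
  qed
  \<comment> \<open>Induction from level \<open>l\<close> down to the root, starting from
    \<open>node_fps k \<rho> c l (Suc l) = 0\<close>.\<close>
  have "m \<le> l \<Longrightarrow> node_fps k \<rho> c l (l - m) = (rX \<rho>) ^ m * (\<Prod>i\<in>{l-m..l}. ?D i) * source_fps k \<rho> c l" for m
  proof (induction m)
    case 0
    then show ?case using step[of l] by (simp add: node_fps_above)
  next
    case (Suc m)
    then have "{l - Suc m..l} = insert (l - Suc m) {l - m..l}" "Suc (l - Suc m) = l - m" by auto
    moreover have "l \<noteq> l - Suc m" using Suc.prems by simp
    ultimately show ?case using step[of "l - Suc m"] Suc by (simp add: mult_ac)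
  qed
  from this[of l] show ?thesis by (simp add: atMost_atLeast0)
qed

text \<open>The powers of \<open>\<rho>\<close> cancel in the quotient, and \<open>Suc n\<close>
  reflects the shift of both series.\<close>

lemma expected_nodes_eq:
  assumes "closed_terms k n \<noteq> {}" "0 < \<rho>"
  shows "expected_nodes c l k n = node_fps k \<rho> c l 0 $ Suc n / level_fps k \<rho> 0 $ Suc n"
  using assms unfolding expected_nodes_def node_fps_def level_fps_def rX_mult_nth
  by (simp add: integral_pmf_of_set finite_closed_terms term_fps_def closed_terms_eq field_simps)

lemma closed_terms_nonempty_iff:
  assumes "0 < \<rho>"
  shows "closed_terms k n \<noteq> {} \<longleftrightarrow> level_fps k \<rho> 0 $ Suc n > 0"
  using assms unfolding level_fps_def rX_mult_nth
  by (simp add: closed_terms_eq term_fps_def card_gt_0_iff zero_less_mult_iff)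

lemma expected_nodes_le:
  assumes "closed_terms k n \<noteq> {}"
  shows "0 \<le> expected_nodes c l k n" "expected_nodes c l k n \<le> real n"
proof -
  have e: "expected_nodes c l k n = (\<Sum>t\<in>closed_terms k n. real (count (nodes 0 t) (c, l))) / card (closed_terms k n)"
    using assms by (simp add: expected_nodes_def integral_pmf_of_set finite_closed_terms)
  show "0 \<le> expected_nodes c l k n" unfolding e by (simp add: sum_nonneg)
  have "(\<Sum>t\<in>closed_terms k n. real (count (nodes 0 t) (c, l))) \<le> (\<Sum>t\<in>closed_terms k n. real n)"
    by (intro sum_mono) (auto simp: closed_terms_def count_le_size)
  then show "expected_nodes c l k n \<le> real n"
    unfolding e using assms by (simp add: finite_closed_terms card_gt_0_iff field_simps)
qed

text \<open>Prefixing an abstraction embeds the terms of level \<open>i + 1\<close> into those of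
  level \<open>i\<close>; lower bounds and positivity travel towards the root in this way.\<close>

lemma level_fps_shift:
  assumes "i \<le> k" "0 \<le> \<rho>"
  shows "\<rho> * level_fps k \<rho> (Suc i) $ n \<le> level_fps k \<rho> i $ Suc n"
proof -
  interpret quadratic_fps "level_fps k \<rho> i" "inner_fps k \<rho> i"
    by (rule quadratic_level_fps) (use assms in auto)
  have "level_fps k \<rho> i $ Suc n = inner_fps k \<rho> i $ Suc n + ((level_fps k \<rho> i)\<^sup>2) $ Suc n"
    by (subst level_fps_rec[OF assms(1)]) simp
  moreover have "0 \<le> ((level_fps k \<rho> i)\<^sup>2) $ Suc n"
    unfolding power2_eq_square by (intro fps_mult_nonneg w_nonneg)
  moreover have "\<rho> * level_fps k \<rho> (Suc i) $ n \<le> inner_fps k \<rho> i $ Suc n"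
    unfolding inner_fps_nth by (simp add: assms)
  ultimately show ?thesis by linarith
qed

text \<open>On the top level there are only leaves and applications, so sizes are odd and, after the
  shift, indices even. A leaf exists because \<open>1 \<le> k\<close>, and applications add
  indices.\<close>

lemma level_fps_top_pos:
  assumes "1 \<le> k" "0 < \<rho>"
  shows "level_fps k \<rho> k $ (2 * m + 2) > 0"
proof -
  interpret quadratic_fps "level_fps k \<rho> k" "inner_fps k \<rho> k"
    by (rule quadratic_level_fps) (use assms in auto)
  have two: "level_fps k \<rho> k $ 2 > 0"
  proof -
    have "inner_fps k \<rho> k $ 2 > 0"
      unfolding inner_fps_nth using assms level_fps_nonneg[of \<rho> k "Suc k" 1] by (simp add: add_pos_nonneg)
    moreover have "0 \<le> ((level_fps k \<rho> k)\<^sup>2) $ 2"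
      unfolding power2_eq_square by (intro fps_mult_nonneg w_nonneg)
    ultimately show ?thesis by (subst w_eq) simp
  qed
  show ?thesis
  proof (induction m)
    case 0
    then show ?case using two by (simp add: numeral_2_eq_2)
  next
    case (Suc m)
    have "0 < level_fps k \<rho> k $ (2 * m + 2) * level_fps k \<rho> k $ 2"
      by (rule mult_pos_pos[OF Suc.IH two])
    also have "\<dots> \<le> level_fps k \<rho> k $ (2 * Suc m + 2)"
      using w_superadditive[of "2 * m + 2" 2] by simp
    finally show ?case .
  qed
qed

text \<open>Both parities occur as soon as one abstraction is available: on level
  \<open>k - 1\<close> an abstraction over a top-level term has odd index, and an application of two
  such terms has even index. Further abstractions pass this on to the lower levels.\<close>

lemma level_fps_pos:
  assumes "1 \<le> k" "0 < \<rho>" "i < k"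
  shows "\<exists>s. \<forall>n\<ge>s. level_fps k \<rho> i $ n > 0"
  using \<open>i < k\<close>
proof (induction "k - Suc i" arbitrary: i)
  case 0
  then have k: "k = Suc i" by simp
  interpret quadratic_fps "level_fps k \<rho> i" "inner_fps k \<rho> i"
    by (rule quadratic_level_fps) (use assms k in auto)
  have odd: "level_fps k \<rho> i $ (2 * m + 3) > 0" for m
  proof -
    have "0 < \<rho> * level_fps k \<rho> (Suc i) $ (2 * m + 2)"
      using level_fps_top_pos[OF assms(1,2), of m] assms(2) k by (intro mult_pos_pos) auto
    also have "\<dots> \<le> level_fps k \<rho> i $ Suc (2 * m + 2)"
      using assms(2) k by (intro level_fps_shift) auto
    finally show ?thesis by (simp add: numeral_3_eq_3)
  qed
  \<comment> \<open>The index is the sum of the odd indices \<open>2 * m + 3\<close> and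
    \<open>3\<close>.\<close>
  have even: "level_fps k \<rho> i $ (2 * m + 6) > 0" for m
    using w_superadditive[of "2 * m + 3" 3] mult_pos_pos[OF odd[of m] odd[of 0]] by (simp add: add.commute)
  have "level_fps k \<rho> i $ n > 0" if "n \<ge> 6" for n
  proof (cases "even n")
    case True
    then obtain m where "n = 2 * m" by auto
    then have "2 * (m - 3) + 6 = n" using that by linarith
    then show ?thesis using even[of "m - 3"] by simp
  next
    case False
    then obtain m where "n = 2 * m + 1" by (auto elim: oddE)
    then have "2 * (m - 1) + 3 = n" using that by linarith
    then show ?thesis using odd[of "m - 1"] by simp
  qed
  then show ?case by blast
next
  case (Suc d)
  then have "d = k - Suc (Suc i)" "Suc i < k" by linarith+
  then obtain s where s: "\<And>n. n \<ge> s \<Longrightarrow> level_fps k \<rho> (Suc i) $ n > 0"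
    using Suc.hyps(1) by blast
  have "level_fps k \<rho> i $ n > 0" if n: "n \<ge> Suc s" for n
  proof -
    have "0 < \<rho> * level_fps k \<rho> (Suc i) $ (n - 1)" using n assms by (intro mult_pos_pos s) auto
    also have "\<dots> \<le> level_fps k \<rho> i $ Suc (n - 1)" using Suc.prems assms by (intro level_fps_shift) auto
    finally show ?thesis using n by simp
  qed
  then show ?case by blast
qed

section \<open>The dominant singularity\<close>

text \<open>Monotone iteration towards a fixed point, for all levels at once: the partial sum up to
  \<open>Suc n\<close> is computed from partial sums up to \<open>n\<close>, because one coefficient
  is lost to the shift in the linear part and, by the vanishing constant term, one in the
  square.\<close>

lemma level_fps_partial_sum_le:
  assumes "0 \<le> \<rho>" "\<And>i. i \<le> Suc k \<Longrightarrow> 0 \<le> W i"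
    and W: "\<And>i. i \<le> k \<Longrightarrow> W i = real i * \<rho>\<^sup>2 + \<rho> * W (Suc i) + (W i)\<^sup>2"
    and "i \<le> Suc k"
  shows "(\<Sum>m\<le>n. level_fps k \<rho> i $ m) \<le> W i"
  using \<open>i \<le> Suc k\<close>
proof (induction n arbitrary: i)
  case 0
  then show ?case using assms(2) by (simp add: level_fps_zero)
next
  case (Suc n)
  show ?case
  proof (cases "i = Suc k")
    case True
    then show ?thesis using assms(2) by (simp add: level_fps_above)
  next
    case False
    then have i: "i \<le> k" using Suc.prems by simp
    let ?w = "level_fps k \<rho> i"
    \<comment> \<open>The truncation at \<open>n\<close>; since
      \<open>level_fps k \<rho> i $ 0 = 0\<close>, the square does not notice it up to index
      \<open>Suc n\<close>.\<close>
    define v where "v = Abs_fps (\<lambda>m. if m \<le> n then ?w $ m else 0)"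
    have v0: "0 \<le> v $ m" for m using assms(1) by (simp add: v_def level_fps_nonneg)
    have sq: "(?w\<^sup>2) $ m = (v * v) $ m" if "m \<le> Suc n" for m
      unfolding power2_eq_square fps_mult_nth
    proof (rule sum.cong[OF refl])
      fix p assume p: "p \<in> {0..m}"
      show "?w $ p * ?w $ (m - p) = v $ p * v $ (m - p)"
      proof (cases "p = 0 \<or> m - p = 0")
        case True
        then show ?thesis by (auto simp: v_def level_fps_zero)
      next
        case False
        then show ?thesis using p that by (auto simp: v_def)
      qed
    qed
    have "(\<Sum>m\<le>Suc n. ?w $ m) = (\<Sum>m\<le>Suc n. inner_fps k \<rho> i $ m) + (\<Sum>m\<le>Suc n. (?w\<^sup>2) $ m)"
      by (subst level_fps_rec[OF i]) (simp add: sum.distrib)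
    also have "(\<Sum>m\<le>Suc n. inner_fps k \<rho> i $ m) \<le> real i * \<rho>\<^sup>2 + \<rho> * W (Suc i)"
    proof -
      have "(\<Sum>m\<le>Suc n. inner_fps k \<rho> i $ m) = (\<Sum>m\<le>Suc n. if m = 2 then real i * \<rho>\<^sup>2 else 0)
          + (\<Sum>m\<le>Suc n. if m = 0 then 0 else \<rho> * level_fps k \<rho> (Suc i) $ (m - 1))"
        by (simp only: inner_fps_nth sum.distrib)
      also have "(\<Sum>m\<le>Suc n. if m = 2 then real i * \<rho>\<^sup>2 else 0) \<le> real i * \<rho>\<^sup>2" by simp
      also have "(\<Sum>m\<le>Suc n. if m = 0 then 0 else \<rho> * level_fps k \<rho> (Suc i) $ (m - 1))
          = \<rho> * (\<Sum>m\<le>n. level_fps k \<rho> (Suc i) $ m)"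
        by (subst sum.atMost_Suc_shift) (simp add: sum_distrib_left)
      also have "\<dots> \<le> \<rho> * W (Suc i)"
        using i assms(1) by (intro mult_left_mono Suc.IH) auto
      finally show ?thesis by simp
    qed
    also have "(\<Sum>m\<le>Suc n. (?w\<^sup>2) $ m) \<le> (W i)\<^sup>2"
    proof -
      have "(\<Sum>m\<le>Suc n. (?w\<^sup>2) $ m) = (\<Sum>m\<le>Suc n. (v * v) $ m)"
        by (intro sum.cong sq) auto
      also have "\<dots> \<le> (\<Sum>m\<le>Suc n. v $ m) * (\<Sum>m\<le>Suc n. v $ m)"
        using fps_mult_partial_sum_le[of v v 1 "Suc n"] v0 by simp
      also have "(\<Sum>m\<le>Suc n. v $ m) = (\<Sum>m\<le>n. ?w $ m)" by (simp add: v_def)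
      also have "(\<Sum>m\<le>n. ?w $ m) * (\<Sum>m\<le>n. ?w $ m) \<le> W i * W i"
        using Suc.IH[OF Suc.prems] assms(1) by (intro mult_mono' sum_nonneg) (auto simp: level_fps_nonneg)
      finally show ?thesis by (simp add: power2_eq_square)
    qed
    finally show ?thesis using W[OF i] by simp
  qed
qed

text \<open>Going down from level \<open>k + 1\<close>, the sum \<open>S\<close> exists by the
  previous bound and solves the same quadratic equation as \<open>W i\<close>. The conditions
  \<open>S \<le> W i \<le> 1/2\<close> exclude the larger root.\<close>

lemma level_fps_sums:
  assumes "0 \<le> \<rho>" "W (Suc k) = 0" "\<And>i. i \<le> k \<Longrightarrow> 0 \<le> W i" "\<And>i. i \<le> k \<Longrightarrow> W i \<le> 1/2"
    and W: "\<And>i. i \<le> k \<Longrightarrow> W i = real i * \<rho>\<^sup>2 + \<rho> * W (Suc i) + (W i)\<^sup>2"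
    and "i \<le> Suc k"
  shows "fps_nth (level_fps k \<rho> i) sums W i"
  using \<open>i \<le> Suc k\<close>
proof (induction "Suc k - i" arbitrary: i)
  case 0
  then have "i = Suc k" by simp
  then show ?case using assms(2) by (simp add: level_fps_above)
next
  case (Suc d)
  then have i: "i \<le> k" by simp
  have IH: "fps_nth (level_fps k \<rho> (Suc i)) sums W (Suc i)"
    using Suc.hyps i by simp
  let ?w = "level_fps k \<rho> i"
  have W0: "0 \<le> W i" if "i \<le> Suc k" for i
    using that assms(2) assms(3)[of i] by (cases "i = Suc k") auto
  have le: "(\<Sum>m\<le>n. ?w $ m) \<le> W i" for n
    using i by (intro level_fps_partial_sum_le assms(1) W0 W) auto
  have w0: "0 \<le> ?w $ n" for n by (rule level_fps_nonneg[OF assms(1)])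
  have "summable (fps_nth ?w)"
    by (rule bounded_imp_summable[OF w0 le])
  then obtain S where S: "fps_nth ?w sums S" by blast
  have SW: "S \<le> W i"
    using S le by (intro LIMSEQ_le_const2[of "\<lambda>n. \<Sum>m\<le>n. ?w $ m"]) (auto simp: sums_def_le)
  have sq: "(\<lambda>n. (?w * ?w) $ n * 1 ^ n) sums (S * S)"
    by (rule fps_mult_sums) (use w0 S in auto)
  have sh: "(\<lambda>n. if n = 0 then 0 else \<rho> * level_fps k \<rho> (Suc i) $ (n - 1)) sums (\<rho> * W (Suc i))"
    using sums_Suc[of "\<lambda>n. if n = 0 then 0 else \<rho> * level_fps k \<rho> (Suc i) $ (n - 1)" "\<rho> * W (Suc i)"]
      sums_mult[OF IH, of \<rho>] by simp
  have "(\<lambda>n. (if n = 2 then real i * \<rho>\<^sup>2 else 0) + (if n = 0 then 0 else \<rho> * level_fps k \<rho> (Suc i) $ (n - 1))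
      + (?w * ?w) $ n * 1 ^ n) sums (real i * \<rho>\<^sup>2 + \<rho> * W (Suc i) + S * S)"
    by (intro sums_add sh sq) (use sums_single[of 2 "\<lambda>_. real i * \<rho>\<^sup>2"] in simp)
  moreover have "(if n = 2 then real i * \<rho>\<^sup>2 else 0) + (if n = 0 then 0 else \<rho> * level_fps k \<rho> (Suc i) $ (n - 1))
      + (?w * ?w) $ n * 1 ^ n = ?w $ n" for n
    using arg_cong[OF level_fps_rec[OF i, of \<rho>], of "\<lambda>f. f $ n"]
    by (simp add: inner_fps_nth power2_eq_square)
  ultimately have "fps_nth ?w sums (real i * \<rho>\<^sup>2 + \<rho> * W (Suc i) + S * S)" by simp
  then have "S = real i * \<rho>\<^sup>2 + \<rho> * W (Suc i) + S * S" by (rule sums_unique2[OF S])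
  \<comment> \<open>The second root is \<open>1 - W i\<close>, which is at least \<open>1/2\<close>;
    if \<open>S\<close> equals it, both roots are \<open>1/2\<close>.\<close>
  then have "(W i - S) * (1 - W i - S) = 0"
    using W[OF i] by (simp add: power2_eq_square algebra_simps)
  then have "S = W i" using SW assms(4)[OF i] by auto
  then show ?case using S by simp
qed

text \<open>
  With \<open>\<rho> = 1/(2s)\<close> and \<open>q i = s (1 - 2 w i)\<close>, where \<open>w i\<close> is the value of the series of level \<open>i\<close>
  at the singularity, the recursion between levels reads \<open>(q i)\<^sup>2 = s\<^sup>2 - s - i + q (i + 1)\<close> with
  \<open>q (k + 1) = s\<close>. Starting from a critical level \<open>c\<close>, where \<open>q c = 0\<close>, the values upwards are
  \<open>q (c + p) = q_seq B p\<close> with \<open>B = c - (s\<^sup>2 - s)\<close> and those downwards are \<open>q (c - m) = z_seq B m\<close>. For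
  \<open>B = 0\<close> and \<open>B = 1\<close> the upward values are the numbers \<open>u_seq\<close>; this is where \<open>N_seq\<close> enters.
\<close>

fun q_seq :: "real \<Rightarrow> nat \<Rightarrow> real" where
  "q_seq B 0 = 0"
| "q_seq B (Suc p) = (q_seq B p)\<^sup>2 + real p + B"

lemma q_seq_one: "q_seq 1 p = real (u_seq p)"
  by (induction p) auto

lemma q_seq_zero: "q_seq 0 (Suc p) = real (u_seq p)"
  by (induction p) auto

lemma continuous_q_seq [continuous_intros]: "continuous_on S f \<Longrightarrow> continuous_on S (\<lambda>x. q_seq (f x) p)"
  by (induction p) (auto intro!: continuous_intros)

lemma q_seq_nonneg: "0 \<le> B \<Longrightarrow> 0 \<le> q_seq B p"
  by (induction p) auto

lemma q_seq_pos: "0 \<le> B \<Longrightarrow> 2 \<le> p \<or> (B > 0 \<and> 1 \<le> p) \<Longrightarrow> 0 < q_seq B p"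
proof (cases p)
  case (Suc m)
  assume "0 \<le> B" "2 \<le> p \<or> (B > 0 \<and> 1 \<le> p)"
  then have "0 < real m + B" using Suc by auto
  then show ?thesis using Suc by (simp add: add_nonneg_pos add.assoc)
qed auto

fun z_seq :: "real \<Rightarrow> nat \<Rightarrow> real" where
  "z_seq B 0 = 0"
| "z_seq B (Suc m) = sqrt (real m + 1 - B + z_seq B m)"

lemma z_seq_nonneg: "B < 1 \<Longrightarrow> 0 \<le> z_seq B m"
  by (induction m) auto

lemma N_seq_real: "real (N_seq j) = (real (u_seq j))\<^sup>2 - real (u_seq j) + real j"
proof -
  have "u_seq j \<le> (u_seq j)\<^sup>2" by (simp add: power2_eq_square)
  then show ?thesis by (simp add: N_seq_def of_nat_diff)
qed

lemma diff_square_strict_mono: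
  fixes x y :: real
  assumes "1/2 \<le> y" "x\<^sup>2 - x < y\<^sup>2 - y"
  shows "x < y"
proof (rule ccontr)
  assume "\<not> x < y"
  then have "0 \<le> (x - y) * (x + y - 1)" using assms by (intro mult_nonneg_nonneg) auto
  then show False using assms by (simp add: power2_eq_square algebra_simps)
qed

lemma u_seq_pos: "j > 0 \<Longrightarrow> u_seq j \<ge> 1"
  by (cases j) auto

text \<open>Level \<open>k - j\<close> is declared critical and \<open>s\<close> is determined by
  the condition \<open>q (k + 1) = s\<close>. At \<open>B = 0\<close> the sequence ends in
  \<open>u_seq j\<close>, too small if \<open>N_seq j < k\<close>; at \<open>B = 1\<close> it ends
  in \<open>u_seq (j + 1)\<close>, too large if \<open>k < N_seq (j + 1)\<close>. The intermediate
  value theorem gives a solution with \<open>0 < B < 1\<close>. If \<open>k = N_seq j\<close>, then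
  \<open>s = u_seq j\<close> solves the condition with \<open>B = 0\<close>.\<close>

lemma exists_scale:
  assumes "1 \<le> k" "k = N_seq j \<or> N_seq j < k \<and> k < N_seq (j + 1)"
  obtains s B where "1 \<le> s" "0 \<le> B" "B < 1" "s\<^sup>2 - s = real k - real j - B" "q_seq B (Suc j) = s"
    "B = 0 \<longleftrightarrow> k = N_seq j"
proof (cases "k = N_seq j")
  case True
  then have "j > 0" using assms(1) by (cases j) (auto simp: N_seq_def)
  then show ?thesis
    using True u_seq_pos[of j] by (intro that[of "real (u_seq j)" 0]) (auto simp: q_seq_zero N_seq_real simp del: q_seq.simps)
next
  case False
  then have k: "N_seq j < k" "k < N_seq (j + 1)" using assms(2) by auto
  define c where "c = real k - real j"
  have c1: "c \<ge> 1"
  proof -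
    have "N_seq j \<ge> j" by (simp add: N_seq_def)
    then show ?thesis using k by (simp add: c_def)
  qed
  define root where "root = (\<lambda>d. (1 + sqrt (1 + 4 * d)) / 2)"
  have root: "(root d)\<^sup>2 - root d = d" "1 \<le> root d" if "d \<ge> 0" for d
  proof -
    have "(sqrt (1 + 4 * d))\<^sup>2 = 1 + 4 * d" using that by simp
    then show "(root d)\<^sup>2 - root d = d" by (simp add: root_def power2_eq_square field_simps)
    have "1 \<le> sqrt (1 + 4 * d)" using that by simp
    then show "1 \<le> root d" by (simp add: root_def)
  qed
  define s1 s2 where "s1 = root c" and "s2 = root (c - 1)"
  have s1: "s1\<^sup>2 - s1 = c" "1 \<le> s1" and s2: "s2\<^sup>2 - s2 = c - 1" "1 \<le> s2"
    using root c1 by (auto simp: s1_def s2_def)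
  have s12: "s2 \<le> s1"
    using diff_square_strict_mono[of s1 s2] s1 s2 by simp
  \<comment> \<open>The parameter \<open>B\<close> is regarded as a function of \<open>s\<close>,
    decreasing from 1 at \<open>s2\<close> to 0 at \<open>s1\<close>; a zero of \<open>g\<close> is
    a solution of the end condition.\<close>
  define g where "g = (\<lambda>s. q_seq (c - s\<^sup>2 + s) (Suc j) - s)"
  have k1: "real (N_seq j) < real k" using k by simp
  have "real (u_seq j) < s1"
    by (rule diff_square_strict_mono) (use s1 k1 in \<open>auto simp: N_seq_real c_def\<close>)
  moreover have "c - s1\<^sup>2 + s1 = 0" using s1 by simp
  ultimately have g1: "g s1 < 0" by (simp add: g_def q_seq_zero del: q_seq.simps)
  have "real (k + 1) \<le> real (N_seq (j + 1))" using k by (intro of_nat_mono) auto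
  then have k2: "s2\<^sup>2 - s2 \<le> (real (u_seq (Suc j)))\<^sup>2 - real (u_seq (Suc j)) - 1"
    using N_seq_real[of "Suc j"] s2 by (simp add: c_def del: u_seq.simps)
  have "s2 < real (u_seq (Suc j))"
    by (rule diff_square_strict_mono) (use k2 u_seq_pos[of "Suc j"] in \<open>auto simp del: u_seq.simps\<close>)
  moreover have "c - s2\<^sup>2 + s2 = 1" using s2 by simp
  ultimately have g2: "g s2 > 0" by (simp add: g_def q_seq_one del: q_seq.simps u_seq.simps)
  have "continuous_on {s2..s1} g"
    unfolding g_def by (intro continuous_intros)
  then obtain s where s: "s2 \<le> s" "s \<le> s1" "g s = 0"
    using IVT2'[of g s1 0 s2] g1 g2 s12 by auto
  define B where "B = c - s\<^sup>2 + s"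
  have "s \<noteq> s1" "s \<noteq> s2" using s g1 g2 by auto
  have "0 < B"
  proof (rule ccontr)
    assume "\<not> 0 < B"
    then have "s1\<^sup>2 - s1 \<le> s\<^sup>2 - s" using s1 by (simp add: B_def)
    moreover have "(s1 - s) * (s1 + s - 1) > 0" using s s1 s2 \<open>s \<noteq> s1\<close> by (intro mult_pos_pos) auto
    ultimately show False by (simp add: power2_eq_square algebra_simps)
  qed
  moreover have "B < 1"
  proof (rule ccontr)
    assume "\<not> B < 1"
    then have "s\<^sup>2 - s \<le> s2\<^sup>2 - s2" using s2 by (simp add: B_def)
    moreover have "(s - s2) * (s + s2 - 1) > 0" using s s1 s2 \<open>s \<noteq> s2\<close> by (intro mult_pos_pos) auto
    ultimately show False by (simp add: power2_eq_square algebra_simps)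
  qed
  moreover have "q_seq B (Suc j) = s" using s by (simp add: g_def B_def)
  ultimately show ?thesis
    using that[of s B] s s2 False by (auto simp: B_def c_def)
qed

text \<open>The requirements \<open>0 \<le> W i\<close> and \<open>W i \<le> 1/2\<close> of
  \<open>level_fps_sums\<close> translate into \<open>q i \<le> s\<close> and
  \<open>0 \<le> q i\<close>. The identity for \<open>\<rho>\<close> in the case
  \<open>k = N_seq j\<close> is the fixed-point equation at level \<open>k - j\<close> with two
  values \<open>1/2\<close>; it makes the constant term of \<open>1 - 4 * H\<close> cancel in
  \<open>double_critical_exponent\<close>.\<close>

lemma exists_critical_radius:
  assumes "1 \<le> k" "k = N_seq j \<or> N_seq j < k \<and> k < N_seq (j + 1)"
  obtains \<rho> W where "0 < \<rho>" "\<And>i. i \<le> Suc k \<Longrightarrow> fps_nth (level_fps k \<rho> i) sums W i"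
    "W (k - j) = 1/2" "\<And>i. i < k - j \<Longrightarrow> W i < 1/2" "\<And>i. k - j + 1 < i \<Longrightarrow> i \<le> k \<Longrightarrow> W i < 1/2"
    "k = N_seq j \<Longrightarrow> W (k - j + 1) = 1/2" "k \<noteq> N_seq j \<Longrightarrow> W (k - j + 1) < 1/2"
    "k = N_seq j \<Longrightarrow> 4 * real (k - j) * \<rho>\<^sup>2 + 2 * \<rho> = 1" "0 < j" "j \<le> k"
proof -
  obtain s B where sB: "1 \<le> s" "0 \<le> B" "B < 1" "s\<^sup>2 - s = real k - real j - B" "q_seq B (Suc j) = s"
    "B = 0 \<longleftrightarrow> k = N_seq j"
    by (rule exists_scale[OF assms])
  have j: "0 < j" "j \<le> k"
  proof -
    show "0 < j" using assms by (cases j) (auto simp: N_seq_def)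
    have "j \<le> N_seq j" by (simp add: N_seq_def)
    then show "j \<le> k" using assms(2) by linarith
  qed
  define c where "c = k - j"
  define q where "q = (\<lambda>i. if c \<le> i then q_seq B (i - c) else z_seq B (c - i))"
  have q0: "0 \<le> q i" for i
    using sB by (simp add: q_def q_seq_nonneg z_seq_nonneg)
  have qrec: "(q i)\<^sup>2 = s\<^sup>2 - s - real i + q (Suc i)" for i
  proof (cases "c \<le> i")
    case True
    then have "q (Suc i) = (q i)\<^sup>2 + real (i - c) + B" by (simp add: q_def Suc_diff_le)
    then show ?thesis using True j sB by (simp add: c_def of_nat_diff)
  next
    case False
    define m where "m = c - Suc i"
    have m: "c - i = Suc m" using False by (simp add: m_def)
    have q1: "q (Suc i) = z_seq B m" using False by (auto simp: q_def m_def)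
    have "q i = sqrt (real m + 1 - B + z_seq B m)" using False by (simp add: q_def m)
    then have "(q i)\<^sup>2 = real m + 1 - B + z_seq B m"
      using z_seq_nonneg[of B m] sB by simp
    moreover have "real m + 1 = real k - real j - real i"
      using False j by (simp add: m_def c_def of_nat_diff)
    ultimately show ?thesis using sB q1 by simp
  qed
  have qk: "q (Suc k) = s" using j sB by (simp add: q_def c_def Suc_diff_diff)
  \<comment> \<open>Downward from \<open>q (Suc k) = s\<close>: the recursion gives
    \<open>(q i)\<^sup>2 \<le> s\<^sup>2 - s + s\<close>.\<close>
  have qle: "i \<le> Suc k \<Longrightarrow> q i \<le> s" for i
  proof (induction "Suc k - i" arbitrary: i)
    case 0
    then show ?case using qk by simp
  next
    case (Suc d)
    then have "q (Suc i) \<le> s" by simp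
    then have "(q i)\<^sup>2 \<le> s\<^sup>2" using qrec[of i] by simp
    then show ?case by (rule power2_le_imp_le) (use sB in simp)
  qed
  define \<rho> where "\<rho> = 1 / (2 * s)"
  define W where "W = (\<lambda>i. (1 - q i / s) / 2)"
  have Wlt: "W i < 1/2" if "q i > 0" for i
    using that sB by (simp add: W_def)
  have Weq: "W i = 1/2" if "q i = 0" for i using that by (simp add: W_def)
  have Wrec: "W i = real i * \<rho>\<^sup>2 + \<rho> * W (Suc i) + (W i)\<^sup>2" for i
  proof -
    have "W i - (W i)\<^sup>2 = (s\<^sup>2 - (q i)\<^sup>2) / (4 * s\<^sup>2)"
      using sB by (simp add: W_def power2_eq_square field_simps)
    also have "\<dots> = real i * \<rho>\<^sup>2 + \<rho> * W (Suc i)"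
      unfolding qrec using sB by (simp add: W_def \<rho>_def power2_eq_square field_simps)
    finally show ?thesis by simp
  qed
  have sums: "fps_nth (level_fps k \<rho> i) sums W i" if "i \<le> Suc k" for i
  proof (rule level_fps_sums[OF _ _ _ _ Wrec that])
    show "0 \<le> \<rho>" using sB by (simp add: \<rho>_def)
    show "W (Suc k) = 0" using qk sB by (simp add: W_def)
    show "0 \<le> W i" if "i \<le> k" for i using qle[of i] that sB by (simp add: W_def)
    show "W i \<le> 1/2" for i using q0[of i] sB by (simp add: W_def)
  qed
  have qc: "q c = 0" "q (Suc c) = B" by (auto simp: q_def)
  show ?thesis
  proof (rule that[of \<rho> W, OF _ sums])
    show "0 < \<rho>" using sB by (simp add: \<rho>_def)
    show "W (k - j) = 1/2" using Weq qc by (simp add: c_def)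
    show "W i < 1/2" if i: "i < k - j" for i
    proof (rule Wlt)
      obtain m where m: "c - i = Suc m" using i by (metis Suc_diff_Suc c_def)
      \<comment> \<open>Here \<open>B < 1\<close> keeps all levels below \<open>k - j\<close>
        strictly subcritical.\<close>
      have "0 < real m + 1 - B + z_seq B m" using z_seq_nonneg[of B m] sB by simp
      then show "0 < q i" using i m by (simp add: q_def c_def)
    qed
    show "W i < 1/2" if "k - j + 1 < i" for i
    proof (rule Wlt)
      have "2 \<le> i - c" using that by (simp add: c_def)
      then have "0 < q_seq B (i - c)" using sB by (intro q_seq_pos) auto
      then show "0 < q i" using \<open>2 \<le> i - c\<close> by (simp add: q_def)
    qed
    show "W (k - j + 1) = 1/2" if "k = N_seq j" using that sB qc Weq[of "Suc c"] by (simp add: c_def)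
    show "W (k - j + 1) < 1/2" if "k \<noteq> N_seq j" using that sB qc Wlt[of "Suc c"] by (simp add: c_def)
    show "4 * real (k - j) * \<rho>\<^sup>2 + 2 * \<rho> = 1" if "k = N_seq j"
    proof -
      have "W c = 1/2" "W (Suc c) = 1/2" using that Weq qc sB by auto
      then have "1/2 = real c * \<rho>\<^sup>2 + \<rho> * (1/2) + (1/2)\<^sup>2" using Wrec[of c] by (simp only:)
      then show ?thesis by (simp add: c_def power2_eq_square mult.assoc)
    qed
  qed (use j in auto)
qed

section \<open>Expected numbers of nodes\<close>

lemma ubound_rX_mult:
  assumes "ubound e (fps_nth f)" "0 \<le> \<rho>"
  shows "ubound e (fps_nth (rX \<rho> * f))"
proof -
  have "fps_nth (rX \<rho> * f) = (\<lambda>n. \<rho> * (if n < 1 then 0 else f $ (n - 1)))"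
    unfolding fun_eq_iff rX_mult_nth by simp
  then show ?thesis using ubound_cmult[OF ubound_shift[OF assms(1), of 1] assms(2)] by simp
qed

lemma ubound_rX_power_mult:
  assumes "ubound e (fps_nth f)" "0 \<le> \<rho>"
  shows "ubound e (fps_nth (rX \<rho> ^ l * f))"
proof (induction l)
  case (Suc l)
  from ubound_rX_mult[OF this assms(2)] show ?case by (simp add: mult.assoc)
qed (use assms in simp)

lemma rX_mult_nonneg: "0 \<le> \<rho> \<Longrightarrow> (\<And>n. 0 \<le> f $ n) \<Longrightarrow> 0 \<le> (rX \<rho> * f) $ n"
  unfolding rX_mult_nth by simp

lemma rX_power_nonneg: "0 \<le> \<rho> \<Longrightarrow> 0 \<le> (rX \<rho> ^ l) $ n"
  by (simp add: rX_def power_mult_distrib fps_const_power fps_X_power_iff)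

lemma rX_power_nth_self: "0 < \<rho> \<Longrightarrow> 0 < (rX \<rho> ^ l) $ l"
  by (simp add: rX_def power_mult_distrib fps_const_power fps_X_power_iff)

lemma lbound_rX_mult:
  assumes "lbound e (fps_nth f)" "0 < \<rho>" "\<And>n. 0 \<le> f $ n"
  shows "lbound e (fps_nth (rX \<rho> * f))"
  using rX_power_nth_self[of \<rho> 1] rX_power_nonneg[of \<rho> 1] assms
  by (intro lbound_mult_coeff[of e f "rX \<rho>" 1]) auto

lemma prod_fps_nonneg:
  fixes f :: "nat \<Rightarrow> real fps"
  assumes "\<And>i n. i \<in> A \<Longrightarrow> 0 \<le> f i $ n"
  shows "0 \<le> (\<Prod>i\<in>A. f i) $ n"
  using assms
proof (induction A arbitrary: n rule: infinite_finite_induct)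
  case (insert x A)
  then show ?case by (simp add: fps_mult_nonneg)
qed auto

lemma prod_fps_nth_0:
  fixes f :: "nat \<Rightarrow> real fps"
  assumes "\<And>i. i \<in> A \<Longrightarrow> f i $ 0 = 1"
  shows "(\<Prod>i\<in>A. f i) $ 0 = 1"
  using assms by (induction A rule: infinite_finite_induct) auto

lemma ubound_prod_fps:
  fixes f :: "nat \<Rightarrow> real fps"
  assumes "1 < \<gamma>" "finite A" "\<And>i n. i \<in> A \<Longrightarrow> 0 \<le> f i $ n" "\<And>i. i \<in> A \<Longrightarrow> ubound (-\<gamma>) (fps_nth (f i))"
  shows "ubound (-\<gamma>) (fps_nth (\<Prod>i\<in>A. f i))"
  using assms(2-4)
proof (induction A)
  case empty
  then show ?case by (intro ubound_finite_support[of 0]) auto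
next
  case (insert x A)
  have "ubound (-\<gamma>) (fps_nth (f x * (\<Prod>i\<in>A. f i)))"
    using insert assms(1) by (intro ubound_fps_mult prod_fps_nonneg) auto
  then show ?case using insert by simp
qed

text \<open>The quotient is taken at index \<open>Suc n\<close>, hence \<open>real n + 2\<close>.
  The lower bound in the denominator also makes \<open>closed_terms k n\<close> nonempty for large
  \<open>n\<close>.\<close>

lemma expected_nodes_upper:
  assumes "0 < \<rho>" "lbound (-\<gamma>) (fps_nth (level_fps k \<rho> 0))" "ubound e (fps_nth (node_fps k \<rho> c l 0))"
  shows "(\<lambda>n. expected_nodes c l k n) \<in> O(\<lambda>n. (real n + 2) powr (e + \<gamma>))"
proof -
  obtain c0 N where c0: "c0 > 0" "\<And>n. n \<ge> N \<Longrightarrow> c0 * (real n + 1) powr (-\<gamma>) \<le> level_fps k \<rho> 0 $ n"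
    by (rule lboundE[OF assms(2)]) blast
  obtain C where C: "C \<ge> 0" "\<And>n. node_fps k \<rho> c l 0 $ n \<le> C * (real n + 1) powr e"
    using assms(3) by (auto simp: ubound_def)
  have "norm (expected_nodes c l k n) \<le> C / c0 * norm ((real n + 2) powr (e + \<gamma>))" if n: "n \<ge> N" for n
  proof -
    have w: "c0 * (real n + 2) powr (-\<gamma>) \<le> level_fps k \<rho> 0 $ Suc n" using c0(2)[of "Suc n"] n by (simp add: add_ac)
    have p: "0 < c0 * (real n + 2) powr (-\<gamma>)" using c0 by simp
    have ne: "closed_terms k n \<noteq> {}"
      using w p closed_terms_nonempty_iff[OF assms(1)] by simp
    have "expected_nodes c l k n \<le> C * (real n + 2) powr e / (c0 * (real n + 2) powr (-\<gamma>))"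
      unfolding expected_nodes_eq[OF ne assms(1)]
      using C(2)[of "Suc n"] by (intro frac_le w p mult_nonneg_nonneg C) (auto simp: add_ac)
    also have "\<dots> = C / c0 * (real n + 2) powr (e + \<gamma>)"
      by (simp add: powr_add powr_minus field_simps)
    finally show ?thesis using expected_nodes_le(1)[OF ne] by simp
  qed
  then show ?thesis by (intro bigoI[of _ "C / c0"]) (auto simp: eventually_sequentially)
qed

lemma expected_nodes_lower:
  assumes "0 < \<rho>" "lbound (-\<gamma>) (fps_nth (level_fps k \<rho> 0))" "ubound (-\<gamma>) (fps_nth (level_fps k \<rho> 0))"
    and "lbound e (fps_nth (node_fps k \<rho> c l 0))"
  shows "(\<lambda>n. expected_nodes c l k n) \<in> \<Omega>(\<lambda>n. (real n + 2) powr (e + \<gamma>))"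
proof -
  obtain c0 N where c0: "c0 > 0" "\<And>n. n \<ge> N \<Longrightarrow> c0 * (real n + 1) powr (-\<gamma>) \<le> level_fps k \<rho> 0 $ n"
    by (rule lboundE[OF assms(2)]) blast
  obtain c1 N' where c1: "c1 > 0" "\<And>n. n \<ge> N' \<Longrightarrow> c1 * (real n + 1) powr e \<le> node_fps k \<rho> c l 0 $ n"
    by (rule lboundE[OF assms(4)]) blast
  obtain C where C: "C \<ge> 0" "\<And>n. level_fps k \<rho> 0 $ n \<le> C * (real n + 1) powr (-\<gamma>)"
    using assms(3) by (auto simp: ubound_def)
  have Cp: "C > 0"
  proof -
    have "0 < c0 * (real N + 1) powr (-\<gamma>)" using c0(1) by (simp add: add_nonneg_eq_0_iff)
    also have "\<dots> \<le> C * (real N + 1) powr (-\<gamma>)" by (rule order_trans[OF c0(2)[OF order_refl] C(2)])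
    finally show ?thesis by (simp add: zero_less_mult_iff)
  qed
  have "c1 / C * norm ((real n + 2) powr (e + \<gamma>)) \<le> norm (expected_nodes c l k n)" if n: "n \<ge> max N N'" for n
  proof -
    have "0 < c0 * (real n + 2) powr (-\<gamma>)" using c0 by simp
    also have "\<dots> \<le> level_fps k \<rho> 0 $ Suc n" using c0(2)[of "Suc n"] n by (simp add: add_ac)
    finally have w: "0 < level_fps k \<rho> 0 $ Suc n" .
    then have ne: "closed_terms k n \<noteq> {}" using closed_terms_nonempty_iff[OF assms(1)] by simp
    have "c1 / C * (real n + 2) powr (e + \<gamma>) = c1 * (real n + 2) powr e / (C * (real n + 2) powr (-\<gamma>))"
      by (simp add: powr_add powr_minus field_simps)
    also have "\<dots> \<le> node_fps k \<rho> c l 0 $ Suc n / level_fps k \<rho> 0 $ Suc n"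
    proof (rule frac_le[OF _ _ w])
      have "0 \<le> c1 * (real n + 2) powr e" using c1 by simp
      moreover show "c1 * (real n + 2) powr e \<le> node_fps k \<rho> c l 0 $ Suc n" using c1(2)[of "Suc n"] n by (simp add: add_ac)
      ultimately show "0 \<le> node_fps k \<rho> c l 0 $ Suc n" by linarith
      show "level_fps k \<rho> 0 $ Suc n \<le> C * (real n + 2) powr (-\<gamma>)" using C(2)[of "Suc n"] by (simp add: add_ac)
    qed
    also have "\<dots> = expected_nodes c l k n" by (rule expected_nodes_eq[OF ne assms(1), symmetric])
    finally show ?thesis using expected_nodes_le(1)[OF ne] by simp
  qed
  then show ?thesis using c1 Cp
    by (intro landau_omega.bigI[of "c1 / C"]) (auto simp: eventually_sequentially intro!: exI[of _ "max N N'"])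
qed

text \<open>The bound by the size is immediate; the asymptotics only ensure that the set of terms is
  eventually nonempty, so that the expectation has its intended value.\<close>

lemma expected_nodes_linear:
  assumes "0 < \<rho>" "lbound (-\<gamma>) (fps_nth (level_fps k \<rho> 0))"
  shows "(\<lambda>n. expected_nodes c l k n) \<in> O(\<lambda>n. real n)"
proof -
  obtain c0 N where c0: "c0 > 0" "\<And>n. n \<ge> N \<Longrightarrow> c0 * (real n + 1) powr (-\<gamma>) \<le> level_fps k \<rho> 0 $ n"
    by (rule lboundE[OF assms(2)]) blast
  have "norm (expected_nodes c l k n) \<le> 1 * norm (real n)" if n: "n \<ge> N" for n
  proof -
    have "0 < c0 * (real n + 2) powr (-\<gamma>)" using c0 by simp
    also have "\<dots> \<le> level_fps k \<rho> 0 $ Suc n" using c0(2)[of "Suc n"] n by (simp add: add_ac)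
    finally have "closed_terms k n \<noteq> {}" using closed_terms_nonempty_iff[OF assms(1)] by simp
    from expected_nodes_le[OF this] show ?thesis by simp
  qed
  then show ?thesis by (intro bigoI[of _ 1]) (auto simp: eventually_sequentially)
qed

text \<open>Meant for \<open>c = k - j\<close>, the lowest critical level, with
  \<open>\<gamma> = 3/2\<close> or \<open>\<gamma> = 5/4\<close>. The levels below \<open>c\<close>
  are subcritical and inherit this order.\<close>

locale level_asymptotics =
  fixes k c :: nat and \<rho> \<gamma> :: real
  assumes k: "c < k" and \<rho>: "0 < \<rho>" and \<gamma>: "1 < \<gamma>"
    and crit_lower: "lbound (-\<gamma>) (fps_nth (level_fps k \<rho> c))"
    and crit_upper: "ubound (-\<gamma>) (fps_nth (level_fps k \<rho> c))"
    and below: "\<And>i. i < c \<Longrightarrow> ubound (-\<gamma>) (fps_nth (level_fps k \<rho> i))"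
    and below_res: "\<And>i. i < c \<Longrightarrow> ubound (-\<gamma>) (fps_nth (fps_res (level_fps k \<rho> i)))"
begin

abbreviation w where "w \<equiv> level_fps k \<rho>"
abbreviation res where "res i \<equiv> fps_res (level_fps k \<rho> i)"

lemma res_nonneg: "i \<le> k \<Longrightarrow> 0 \<le> res i $ n" and res_zero: "i \<le> k \<Longrightarrow> res i $ 0 = 1"
proof -
  assume "i \<le> k"
  then interpret quadratic_fps "w i" "inner_fps k \<rho> i" by (rule quadratic_level_fps) (use \<rho> in simp)
  show "0 \<le> res i $ n" "res i $ 0 = 1" by (rule D_nonneg, rule D_zero)
qed

lemma w_nonneg: "0 \<le> w i $ n"
  using \<rho> by (intro level_fps_nonneg) simp

lemma source_nonneg: "0 \<le> source_fps k \<rho> a l $ n"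
  using rX_mult_nonneg[of \<rho> "w (Suc l)"] fps_mult_nonneg[of "w l" "w l"] w_nonneg \<rho>
  by (simp add: source_fps_def power2_eq_square)

lemma w_pos_coeff:
  assumes "i \<le> k"
  shows "\<exists>m. w i $ m > 0"
proof (cases "i = k")
  case True
  then show ?thesis using level_fps_top_pos[of k \<rho> 0] k \<rho> by auto
next
  case False
  then show ?thesis using level_fps_pos[of k \<rho> i] k \<rho> assms by force
qed

text \<open>The two ranges differ because a unary node on level \<open>k\<close> would need a term
  rooted on level \<open>k + 1\<close>, and that series is 0.\<close>

lemma source_pos_coeff:
  assumes "a = Unary \<and> l < k \<or> a = Binary \<and> l \<le> k"
  shows "\<exists>m. source_fps k \<rho> a l $ m > 0"
proof (cases "a = Unary")
  case True
  then obtain m where "w (Suc l) $ m > 0" using w_pos_coeff[of "Suc l"] assms by auto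
  then have "(rX \<rho> * w (Suc l)) $ Suc m > 0" unfolding rX_mult_nth using \<rho> by simp
  then show ?thesis using True by (auto simp: source_fps_def)
next
  case False
  then obtain m where m: "w l $ m > 0" using w_pos_coeff[of l] assms by auto
  then have "(w l * w l) $ (m + m) > 0"
    using fps_mult_nth_ge[OF w_nonneg w_nonneg, of l m l m] mult_pos_pos[OF m m] by linarith
  then show ?thesis using False by (auto simp: source_fps_def power2_eq_square)
qed

lemma root_lower: "lbound (-\<gamma>) (fps_nth (w 0))"
proof -
  have "m \<le> c \<Longrightarrow> lbound (-\<gamma>) (fps_nth (w (c - m)))" for m
  proof (induction m)
    case 0
    then show ?case using crit_lower by simp
  next
    case (Suc m)
    then have "lbound (-\<gamma>) (\<lambda>n. w (Suc (c - Suc m)) $ (n - 1))"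
      by (intro lbound_shift) (simp add: Suc_diff_Suc)
    then show ?case
    proof (rule lbound_le[OF _ \<rho>, of _ _ 1])
      fix n :: nat assume "1 \<le> n"
      then show "\<rho> * w (Suc (c - Suc m)) $ (n - 1) \<le> w (c - Suc m) $ n"
        using level_fps_shift[of "c - Suc m" k \<rho> "n - 1"] k \<rho> by simp
    qed
  qed
  from this[of c] show ?thesis by simp
qed

lemma root_upper: "ubound (-\<gamma>) (fps_nth (w 0))"
  using crit_upper below[of 0] by (cases "c = 0") auto

text \<open>The levels are split into those in \<open>A\<close>, whose factors have the fast decay
  \<open>\<gamma>\<close>, and those in \<open>B\<close>, whose product decays more slowly. Factors
  of summable order do not change the slower one.\<close>

lemma node_fps_upper:
  assumes "l \<le> k" "a \<noteq> Leaf" "finite A" "{..l} = A \<union> B" "A \<inter> B = {}"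
    and "\<And>i. i \<in> A \<Longrightarrow> ubound (-\<gamma>) (fps_nth (res i))"
    and "ubound (-\<gamma>) (fps_nth (source_fps k \<rho> a l))"
    and "0 \<le> \<delta>" "\<delta> \<le> \<gamma>" "ubound (-\<delta>) (fps_nth (\<Prod>i\<in>B. res i))"
  shows "ubound (-\<delta>) (fps_nth (node_fps k \<rho> a l 0))"
proof -
  have sub: "A \<subseteq> {..l}" "B \<subseteq> {..l}" and fin: "finite B" using assms(4) by auto (metis finite_Un finite_atMost)
  have A: "0 \<le> (\<Prod>i\<in>A. res i) $ n" and B: "0 \<le> (\<Prod>i\<in>B. res i) $ n" for n
    using sub assms(1) by (auto intro!: prod_fps_nonneg res_nonneg)
  have "ubound (-\<gamma>) (fps_nth (\<Prod>i\<in>A. res i))"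
  proof (rule ubound_prod_fps[OF \<gamma> assms(3) res_nonneg assms(6)])
    show "i \<le> k" if "i \<in> A" for i using sub(1) that assms(1) by auto
  qed auto
  from ubound_fps_mult[OF this A assms(7) source_nonneg \<gamma>] \<gamma>
  have 1: "ubound (-\<gamma>) (fps_nth ((\<Prod>i\<in>A. res i) * source_fps k \<rho> a l))" by simp
  have "ubound (-\<delta>) (fps_nth ((\<Prod>i\<in>A. res i) * source_fps k \<rho> a l * (\<Prod>i\<in>B. res i)))"
    by (rule ubound_fps_mult[OF 1 fps_mult_nonneg[OF A source_nonneg] assms(10) B \<gamma> assms(8,9)])
  from ubound_rX_power_mult[OF this, of \<rho> l]
  have "ubound (-\<delta>) (fps_nth (rX \<rho> ^ l * ((\<Prod>i\<in>A. res i) * source_fps k \<rho> a l * (\<Prod>i\<in>B. res i))))"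
    using \<rho> by simp
  moreover have "(\<Prod>i\<le>l. res i) = (\<Prod>i\<in>A. res i) * (\<Prod>i\<in>B. res i)"
    using prod.union_disjoint[OF assms(3) fin assms(5), of res] assms(4) by simp
  ultimately show ?thesis
    using node_fps_eq[OF assms(1,2), of \<rho>] \<rho> by (simp add: mult_ac)
qed

text \<open>Discarded factors cannot hurt: the remaining \<open>D i\<close> have constant
  coefficient 1, and the source and the power of \<open>rX \<rho>\<close> have some positive
  coefficient, which only shifts the bound.\<close>

lemma node_fps_lower:
  assumes "a = Unary \<and> l < k \<or> a = Binary \<and> l \<le> k" "B \<subseteq> {..l}" "lbound e (fps_nth (\<Prod>i\<in>B. res i))"
  shows "lbound e (fps_nth (node_fps k \<rho> a l 0))"
proof -
  let ?A = "{..l} - B"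
  have l: "l \<le> k" "a \<noteq> Leaf" using assms(1) by auto
  have A: "0 \<le> (\<Prod>i\<in>?A. res i) $ n" and B: "0 \<le> (\<Prod>i\<in>B. res i) $ n" for n
    using assms(2) l by (auto intro!: prod_fps_nonneg res_nonneg)
  have A0: "(\<Prod>i\<in>?A. res i) $ 0 > 0"
    using l by (subst prod_fps_nth_0) (auto intro: res_zero)
  obtain m where m: "source_fps k \<rho> a l $ m > 0" using source_pos_coeff[OF assms(1)] by blast
  have "lbound e (fps_nth ((\<Prod>i\<in>?A. res i) * (\<Prod>i\<in>B. res i)))"
    by (rule lbound_mult_coeff[OF assms(3) A0 A B])
  from lbound_mult_coeff[OF this m source_nonneg fps_mult_nonneg[OF A B]]
  have "lbound e (fps_nth (source_fps k \<rho> a l * ((\<Prod>i\<in>?A. res i) * (\<Prod>i\<in>B. res i))))" .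
  from lbound_mult_coeff[OF this rX_power_nth_self[OF \<rho>, of l] rX_power_nonneg
      fps_mult_nonneg[OF source_nonneg fps_mult_nonneg[OF A B]]]
  have "lbound e (fps_nth (rX \<rho> ^ l * (source_fps k \<rho> a l * ((\<Prod>i\<in>?A. res i) * (\<Prod>i\<in>B. res i)))))"
    using \<rho> by simp
  moreover have "(\<Prod>i\<le>l. res i) = (\<Prod>i\<in>?A. res i) * (\<Prod>i\<in>B. res i)"
    using assms(2) by (intro prod.subset_diff) auto
  ultimately show ?thesis
    using node_fps_eq[OF l, of \<rho>] \<rho> by (simp add: mult_ac)
qed

lemma expected_below:
  assumes "l < c" "a \<noteq> Leaf"
  shows "(\<lambda>n. expected_nodes a l k n) \<in> O(\<lambda>n. 1)"
proof -
  have "ubound (-\<gamma>) (fps_nth (source_fps k \<rho> a l))"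
  proof (cases "a = Unary")
    case True
    have "ubound (-\<gamma>) (fps_nth (w (Suc l)))"
      using assms crit_upper below[of "Suc l"] by (cases "Suc l = c") auto
    then show ?thesis using True \<rho> by (simp add: source_fps_def ubound_rX_mult)
  next
    case False
    have "ubound (-\<gamma>) (fps_nth (w l * w l))"
      using assms \<gamma> below w_nonneg by (intro ubound_fps_mult) auto
    then show ?thesis using False by (simp add: source_fps_def power2_eq_square)
  qed
  then have "ubound (-\<gamma>) (fps_nth (node_fps k \<rho> a l 0))"
    using assms k \<gamma> below_res
    \<comment> \<open>No level up to \<open>l\<close> is critical; the empty product is 1 and has
      decay of any order.\<close>
    by (intro node_fps_upper[of l a "{..l}" "{}"]) (auto intro!: ubound_finite_support[of 0])
  from expected_nodes_upper[OF \<rho> root_lower this]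
  have "(\<lambda>n. expected_nodes a l k n) \<in> O(\<lambda>n. (real n + 2) powr 0)" by simp
  moreover have "(\<lambda>n. (real n + 2) powr 0) = (\<lambda>n. 1)" by (auto simp: fun_eq_iff)
  ultimately show ?thesis by simp
qed

text \<open>Used with \<open>B = {c}\<close> and order \<open>-1/2\<close> for one critical level,
  with \<open>B = {c, c + 1}\<close> and order \<open>-1/4\<close> for two; in both cases this is
  \<open>1 - \<gamma>\<close>. The growth of the other factors is irrelevant because the upper bound
  is trivial.\<close>

lemma expected_above:
  assumes "a = Unary \<and> l < k \<or> a = Binary \<and> l \<le> k" "B \<subseteq> {..l}" "lbound (1 - \<gamma>) (fps_nth (\<Prod>i\<in>B. res i))"
  shows "(\<lambda>n. expected_nodes a l k n) \<in> \<Theta>(\<lambda>n. real n)"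
proof (rule bigthetaI)
  show "(\<lambda>n. expected_nodes a l k n) \<in> O(\<lambda>n. real n)"
    by (rule expected_nodes_linear[OF \<rho> root_lower])
  have "(\<lambda>n. expected_nodes a l k n) \<in> \<Omega>(\<lambda>n. (real n + 2) powr (1 - \<gamma> + \<gamma>))"
    by (rule expected_nodes_lower[OF \<rho> root_lower root_upper node_fps_lower[OF assms]])
  moreover have "(\<lambda>n. (real n + 2) powr 1) \<in> \<Omega>(\<lambda>n. real n)" by real_asymp
  ultimately show "(\<lambda>n. expected_nodes a l k n) \<in> \<Omega>(\<lambda>n. real n)"
    using landau_omega.big_trans by fastforce
qed

end

section \<open>Orders of the individual levels, from the top down to the root\<close>

lemma inner_fps_ubound:
  assumes "ubound e (fps_nth (level_fps k \<rho> (Suc i)))" "0 \<le> \<rho>"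
  shows "ubound e (fps_nth (inner_fps k \<rho> i))"
proof -
  have "ubound e (\<lambda>n. if n = 2 then real i * \<rho>\<^sup>2 else 0)"
    by (rule ubound_finite_support[of 2]) auto
  from ubound_add[OF this ubound_rX_mult[OF assms]]
  show ?thesis unfolding inner_fps_nth rX_mult_nth .
qed

text \<open>Decay propagates downwards from a level \<open>m\<close> at which it is known: from
  \<open>m = k + 1\<close>, where the series is 0, to the levels above the critical ones, and from
  the critical level \<open>m = c\<close> to the root.\<close>

lemma level_fps_subcritical:
  assumes "0 \<le> \<rho>" "1 < \<gamma>" "m \<le> Suc k" "ubound (-\<gamma>) (fps_nth (level_fps k \<rho> m))"
    and sums: "\<And>i. i \<le> k \<Longrightarrow> fps_nth (level_fps k \<rho> i) sums W i"
    and W: "\<And>i. a \<le> i \<Longrightarrow> i < m \<Longrightarrow> W i < 1/2"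
    and "a \<le> i" "i \<le> m"
  shows "ubound (-\<gamma>) (fps_nth (level_fps k \<rho> i))
    \<and> (i < m \<longrightarrow> ubound (-\<gamma>) (fps_nth (fps_res (level_fps k \<rho> i))))"
  using \<open>a \<le> i\<close> \<open>i \<le> m\<close>
proof (induction "m - i" arbitrary: i)
  case 0
  then show ?case using assms(4) by simp
next
  case (Suc d)
  then have i: "i \<le> k" "i < m" using assms(3) by auto
  interpret quadratic_fps "level_fps k \<rho> i" "inner_fps k \<rho> i"
    by (rule quadratic_level_fps[OF i(1) assms(1)])
  have "ubound (-\<gamma>) (fps_nth (level_fps k \<rho> (Suc i)))"
    using Suc.hyps(1)[of "Suc i"] Suc.hyps(2) Suc.prems by simp
  from inner_fps_ubound[OF this assms(1)] show ?case
    using subcritical[OF assms(2) _ sums[OF i(1)]] W[of i] Suc.prems i by simp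
qed

text \<open>The restriction \<open>i < k\<close> is essential: on the top level every second
  coefficient is 0.\<close>

lemma level_fps_unwindow:
  assumes "i < k" "0 < \<rho>"
  shows "lbound e (fps_nth (level_fps k \<rho> i * window L)) \<Longrightarrow> lbound e (fps_nth (level_fps k \<rho> i))"
    and "lbound e (fps_nth (fps_res (level_fps k \<rho> i) * window L)) \<Longrightarrow> lbound e (fps_nth (fps_res (level_fps k \<rho> i)))"
proof -
  interpret quadratic_fps "level_fps k \<rho> i" "inner_fps k \<rho> i"
    by (rule quadratic_level_fps) (use assms in auto)
  obtain s where s: "\<And>n. n \<ge> s \<Longrightarrow> level_fps k \<rho> i $ n > 0"
    using level_fps_pos[of k \<rho> i] assms by auto
  show "lbound e (fps_nth (level_fps k \<rho> i))" if "lbound e (fps_nth (level_fps k \<rho> i * window L))"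
    by (rule lbound_unwindow[OF that w_nonneg s w_superadditive])
  show "lbound e (fps_nth D)" if "lbound e (fps_nth (D * window L))"
    by (rule lbound_unwindow[OF that D_nonneg _ D_superadditive]) (use s in auto)
qed

lemma critical_level_fps:
  assumes "i \<le> k" "0 \<le> \<rho>" "fps_nth (level_fps k \<rho> i) sums x" "x = 1/2"
  shows "critical_fps (level_fps k \<rho> i) (inner_fps k \<rho> i)"
proof -
  interpret quadratic_fps "level_fps k \<rho> i" "inner_fps k \<rho> i"
    by (rule quadratic_level_fps[OF assms(1,2)])
  show ?thesis by unfold_locales (use assms(3,4) in simp)
qed

lemma level_fps_above_critical:
  assumes "0 \<le> \<rho>" "i \<le> k" "\<And>i. i \<le> k \<Longrightarrow> fps_nth (level_fps k \<rho> i) sums W i"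
    and "\<And>m. i < m \<Longrightarrow> m \<le> k \<Longrightarrow> W m < 1/2"
  shows "ubound (-3) (fps_nth (inner_fps k \<rho> i))"
proof (rule inner_fps_ubound[OF _ assms(1)])
  have "ubound (-3) (fps_nth (level_fps k \<rho> (Suc k)))"
    by (rule ubound_finite_support[of 0]) (simp add: level_fps_above)
  then show "ubound (-3) (fps_nth (level_fps k \<rho> (Suc i)))"
    using level_fps_subcritical[of \<rho> 3 "Suc k" k W "Suc i" "Suc i"] assms by auto
qed

lemma level_asymptoticsI:
  assumes "c < k" "0 < \<rho>" "1 < \<gamma>"
    and "lbound (-\<gamma>) (fps_nth (level_fps k \<rho> c))" "ubound (-\<gamma>) (fps_nth (level_fps k \<rho> c))"
    and "\<And>i. i \<le> k \<Longrightarrow> fps_nth (level_fps k \<rho> i) sums W i" "\<And>i. i < c \<Longrightarrow> W i < 1/2"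
  shows "level_asymptotics k c \<rho> \<gamma>"
  by unfold_locales (use assms level_fps_subcritical[of \<rho> \<gamma> c k W 0] in auto)

lemma simple_critical_level:
  assumes "c < k" "0 < \<rho>" and sums: "\<And>i. i \<le> k \<Longrightarrow> fps_nth (level_fps k \<rho> i) sums W i"
    and "W c = 1/2" "\<And>i. i < c \<Longrightarrow> W i < 1/2" "\<And>i. c < i \<Longrightarrow> i \<le> k \<Longrightarrow> W i < 1/2"
  shows "level_asymptotics k c \<rho> (3/2)" "lbound (-1/2) (fps_nth (fps_res (level_fps k \<rho> c)))"
proof -
  interpret critical_fps "level_fps k \<rho> c" "inner_fps k \<rho> c"
    by (rule critical_level_fps[OF _ _ sums]) (use assms in auto)
  have h: "ubound (-3) (fps_nth (inner_fps k \<rho> c))"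
    by (rule level_fps_above_critical[of _ _ _ W]) (use assms in auto)
  obtain L where L: "lbound (-1/2) (fps_nth (D * window L))" "lbound (-3/2) (fps_nth (level_fps k \<rho> c * window L))"
    using critical_finite_mean(4)[OF h] by blast
  show "lbound (-1/2) (fps_nth D)" by (rule level_fps_unwindow(2)[OF assms(1,2) L(1)])
  show "level_asymptotics k c \<rho> (3/2)"
    by (rule level_asymptoticsI[OF assms(1,2) _ _ _ sums])
      (use level_fps_unwindow(1)[OF assms(1,2) L(2)] critical_finite_mean(3)[OF h] assms in auto)
qed

text \<open>The value of \<open>w (c + 1)\<close> enters \<open>1 - 4 * H\<close> of level
  \<open>c\<close> linearly, and with it the square root of \<open>1 - 4 * H\<close> of level
  \<open>c + 1\<close>. The latter has exponent 1, so the root is of order \<open>sqrt t\<close> and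
  dominates all other terms, which are of order \<open>t\<close>.\<close>

lemma double_critical_exponent:
  assumes "c < k" "0 < \<rho>" and sums: "\<And>i. i \<le> k \<Longrightarrow> fps_nth (level_fps k \<rho> i) sums W i"
    and "W c = 1/2" "W (Suc c) = 1/2" "\<And>i. Suc c < i \<Longrightarrow> i \<le> k \<Longrightarrow> W i < 1/2"
    and \<rho>: "4 * real c * \<rho>\<^sup>2 + 2 * \<rho> = 1"
  shows "\<exists>a b. critical_exponent_fps (level_fps k \<rho> c) (inner_fps k \<rho> c) (1/2) a b"
proof -
  interpret Q: critical_fps "level_fps k \<rho> c" "inner_fps k \<rho> c"
    by (rule critical_level_fps[OF _ _ sums]) (use assms in auto)
  interpret S: critical_fps "level_fps k \<rho> (Suc c)" "inner_fps k \<rho> (Suc c)"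
    by (rule critical_level_fps[OF _ _ sums]) (use assms in auto)
  have h: "ubound (-3) (fps_nth (inner_fps k \<rho> (Suc c)))"
    by (rule level_fps_above_critical[of _ _ _ W]) (use assms in auto)
  define b where "b = 4 * S.\<mu>"
  interpret S: critical_exponent_fps "level_fps k \<rho> (Suc c)" "inner_fps k \<rho> (Suc c)" 1 "1/2" b
    unfolding b_def by (rule S.finite_mean_exponent[OF h])
  have eq: "1 - 4 * Q.H t = 4 * real c * \<rho>\<^sup>2 * (1 - exp (-t) ^ 2) + 2 * \<rho> * (1 - exp (-t))
      + 2 * \<rho> * exp (-t) * sqrt (1 - 4 * S.H t)" if t: "0 \<le> t" for t
  proof -
    let ?x = "exp (-t)" and ?W = "(1 - sqrt (1 - 4 * S.H t)) / 2"
    have "(\<lambda>n. \<rho> * ?x * (level_fps k \<rho> (Suc c) $ n * ?x ^ n)) sums (\<rho> * ?x * ?W)"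
      by (intro sums_mult S.w_exp_sums t)
    then have "(\<lambda>n. (if n = 0 then 0 else \<rho> * level_fps k \<rho> (Suc c) $ (n - 1)) * ?x ^ n) sums (\<rho> * ?x * ?W)"
      using sums_Suc[of "\<lambda>n. (if n = 0 then 0 else \<rho> * level_fps k \<rho> (Suc c) $ (n - 1)) * ?x ^ n" "\<rho> * ?x * ?W"]
      by (simp add: mult_ac)
    then have "(\<lambda>n. (if n = 2 then real c * \<rho>\<^sup>2 * ?x ^ 2 else 0)
        + (if n = 0 then 0 else \<rho> * level_fps k \<rho> (Suc c) $ (n - 1)) * ?x ^ n) sums (real c * \<rho>\<^sup>2 * ?x ^ 2 + \<rho> * ?x * ?W)"
      using sums_single[of 2 "\<lambda>_. real c * \<rho>\<^sup>2 * ?x ^ 2"] by (intro sums_add) simp_all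
    moreover have "(if n = 2 then real c * \<rho>\<^sup>2 * ?x ^ 2 else 0)
        + (if n = 0 then 0 else \<rho> * level_fps k \<rho> (Suc c) $ (n - 1)) * ?x ^ n = inner_fps k \<rho> c $ n * ?x ^ n" for n
      unfolding inner_fps_nth by (simp add: algebra_simps)
    ultimately have "(\<lambda>n. inner_fps k \<rho> c $ n * ?x ^ n) sums (real c * \<rho>\<^sup>2 * ?x ^ 2 + \<rho> * ?x * ?W)"
      by simp
    then have "Q.H t = real c * \<rho>\<^sup>2 * ?x ^ 2 + \<rho> * ?x * ?W"
      using Q.H_sums[OF t] sums_unique2 by blast
    moreover define y where "y = ?W"
    ultimately have 1: "1 - 4 * Q.H t = (4 * real c * \<rho>\<^sup>2 + 2 * \<rho>) - 4 * (real c * \<rho>\<^sup>2 * ?x ^ 2 + \<rho> * ?x * y)"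
      using \<rho> by simp
    have 2: "sqrt (1 - 4 * S.H t) = 1 - 2 * y" by (simp add: y_def field_simps)
    show ?thesis unfolding 2 using 1 by (simp add: algebra_simps)
  qed
  \<comment> \<open>In \<open>B\<close>, the three summands come from
    \<open>1 - exp (-t) ^ 2 \<le> 2 * t\<close>, from \<open>1 - exp (-t) \<le> t\<close> and from
    the root, with \<open>t \<le> sqrt t\<close>. In \<open>A\<close>, only the root is kept:
    \<open>exp (-1)\<close> bounds \<open>exp (-t)\<close> from below, and \<open>1/2\<close> is the
    lower constant of level \<open>c + 1\<close>.\<close>
  define B where "B = 8 * real c * \<rho>\<^sup>2 + 2 * \<rho> + 2 * \<rho> * sqrt b"
  define A where "A = 2 * \<rho> * exp (-1) * sqrt (1/2)"
  have "critical_exponent_fps (level_fps k \<rho> c) (inner_fps k \<rho> c) (1/2) A B"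
  proof
    show "A > 0" using assms(2) by (simp add: A_def)
    fix t :: real assume t: "0 < t" "t \<le> 1"
    let ?x = "exp (-t)"
    have x: "0 < ?x" "?x \<le> 1" "1 - ?x \<le> t" using t one_minus_exp_bounds[OF t] by auto
    have x2: "0 \<le> 1 - ?x ^ 2" "1 - ?x ^ 2 \<le> 2 * t"
    proof -
      have "1 - ?x ^ 2 = (1 - ?x) * (1 + ?x)" by (simp add: power2_eq_square algebra_simps)
      moreover have "(1 - ?x) * (1 + ?x) \<le> t * 2" using x t by (intro mult_mono) auto
      moreover have "0 \<le> (1 - ?x) * (1 + ?x)" using x by (intro mult_nonneg_nonneg) auto
      ultimately show "0 \<le> 1 - ?x ^ 2" "1 - ?x ^ 2 \<le> 2 * t" by auto
    qed
    have st: "t powr (1/2) = sqrt t" using t by (simp add: powr_half_sqrt)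
    have tle: "t \<le> sqrt t" using t by (intro real_le_rsqrt) (simp add: power2_eq_square mult_left_le)
    have "sqrt (1/2 * t) \<le> sqrt (1 - 4 * S.H t)" using S.H_lower[OF t] t by simp
    moreover have "exp (-1) \<le> ?x" using t by simp
    ultimately have "2 * \<rho> * exp (-1) * sqrt (1/2 * t) \<le> 2 * \<rho> * ?x * sqrt (1 - 4 * S.H t)"
      using assms(2) t by (intro mult_mono) auto
    moreover have "0 \<le> 4 * real c * \<rho>\<^sup>2 * (1 - ?x ^ 2)" "0 \<le> 2 * \<rho> * (1 - ?x)"
      using x x2 assms(2) by auto
    ultimately have "2 * \<rho> * exp (-1) * sqrt (1/2 * t) \<le> 1 - 4 * Q.H t"
      unfolding eq[OF less_imp_le[OF t(1)]] by linarith
    then show "A * t powr (1/2) \<le> 1 - 4 * Q.H t"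
      by (simp only: st A_def real_sqrt_mult mult.assoc)
    have "4 * real c * \<rho>\<^sup>2 * (1 - ?x ^ 2) \<le> 4 * real c * \<rho>\<^sup>2 * (2 * sqrt t)"
      using x2 tle by (intro mult_left_mono) auto
    moreover have "2 * \<rho> * (1 - ?x) \<le> 2 * \<rho> * sqrt t"
      using x tle assms(2) by (intro mult_left_mono) auto
    moreover have "2 * \<rho> * ?x * sqrt (1 - 4 * S.H t) \<le> 2 * \<rho> * 1 * sqrt (b * t)"
      using S.H_upper[OF t] S.H_lt[OF t] t x assms(2) by (intro mult_mono) auto
    ultimately have "1 - 4 * Q.H t \<le> 4 * real c * \<rho>\<^sup>2 * (2 * sqrt t) + 2 * \<rho> * sqrt t + 2 * \<rho> * 1 * sqrt (b * t)"
      unfolding eq[OF less_imp_le[OF t(1)]] by linarith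
    also have "\<dots> = B * t powr (1/2)"
      unfolding st B_def real_sqrt_mult by (simp add: algebra_simps)
    finally show "1 - 4 * Q.H t \<le> B * t powr (1/2)" .
  qed simp
  then show ?thesis by blast
qed

text \<open>For level \<open>c + 1\<close> only block sums and partial sums are bounded from below,
  since it may be the top level, as for \<open>k = 1\<close>. This is enough: level \<open>c\<close>
  needs \<open>h\<close> only through a window, and its own bounds become pointwise because
  \<open>c < k\<close>.\<close>

lemma double_critical_level:
  assumes "c < k" "0 < \<rho>" and sums: "\<And>i. i \<le> k \<Longrightarrow> fps_nth (level_fps k \<rho> i) sums W i"
    and "W c = 1/2" "W (Suc c) = 1/2" "\<And>i. i < c \<Longrightarrow> W i < 1/2" "\<And>i. Suc c < i \<Longrightarrow> i \<le> k \<Longrightarrow> W i < 1/2"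
    and \<rho>: "4 * real c * \<rho>\<^sup>2 + 2 * \<rho> = 1"
  shows "level_asymptotics k c \<rho> (5/4)"
    and "lbound (-3/4) (fps_nth (fps_res (level_fps k \<rho> c)))" "ubound (-3/4) (fps_nth (fps_res (level_fps k \<rho> c)))"
    and "lbound (-1/4) (fps_nth (fps_res (level_fps k \<rho> c) * fps_res (level_fps k \<rho> (Suc c))))"
    and "ubound (-5/4) (fps_nth (level_fps k \<rho> (Suc c)))"
proof -
  obtain a b where "critical_exponent_fps (level_fps k \<rho> c) (inner_fps k \<rho> c) (1/2) a b"
    using double_critical_exponent[OF assms(1-5) assms(7) \<rho>] by blast
  then interpret Q: critical_exponent_fps "level_fps k \<rho> c" "inner_fps k \<rho> c" "1/2" a b .
  interpret S: critical_fps "level_fps k \<rho> (Suc c)" "inner_fps k \<rho> (Suc c)"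
    by (rule critical_level_fps[OF _ _ sums]) (use assms in auto)
  have h: "ubound (-3) (fps_nth (inner_fps k \<rho> (Suc c)))"
    by (rule level_fps_above_critical[of _ _ _ W]) (use assms in auto)
  note S = S.critical_finite_mean[OF h]
  obtain L where L: "lbound (-3/2) (fps_nth (level_fps k \<rho> (Suc c) * window L))" using S(4) by blast
  have hu: "ubound (-3/2) (fps_nth (inner_fps k \<rho> c))"
    by (rule inner_fps_ubound) (use S(3) assms in auto)
  have "lbound (-3/2) (fps_nth (rX \<rho> * (level_fps k \<rho> (Suc c) * window L)))"
    by (rule lbound_rX_mult[OF L assms(2) fps_mult_nonneg[OF S.w_nonneg window_nonneg]])
  then have hl: "lbound (-3/2) (fps_nth (inner_fps k \<rho> c * window L))"
  proof (rule lbound_le[of _ _ 1 0])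
    fix n
    have "0 \<le> (fps_const (real c) * (rX \<rho>)\<^sup>2 * window L) $ n"
    proof (rule fps_mult_nonneg[OF _ window_nonneg])
      show "0 \<le> (fps_const (real c) * (rX \<rho>)\<^sup>2) $ n" for n
        using rX_power_nonneg[of \<rho> 2 n] assms(2) by simp
    qed
    then show "1 * (rX \<rho> * (level_fps k \<rho> (Suc c) * window L)) $ n \<le> (inner_fps k \<rho> c * window L) $ n"
      unfolding inner_fps_def distrib_right fps_add_nth by (simp add: mult.assoc)
  qed auto
  note Q = Q.critical_heavy_tail[OF refl hu hl]
  show Dc: "lbound (-3/4) (fps_nth Q.D)" by (rule level_fps_unwindow(2)[OF assms(1,2) Q(2)])
  show "ubound (-3/4) (fps_nth Q.D)" by (rule Q(1))
  show "level_asymptotics k c \<rho> (5/4)"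
    by (rule level_asymptoticsI[OF assms(1,2) _ _ _ sums])
      (use level_fps_unwindow(1)[OF assms(1,2) Q(4)] Q(3) assms in auto)
  show "ubound (-5/4) (fps_nth (level_fps k \<rho> (Suc c)))" by (rule ubound_mono[OF S(3)]) simp
  \<comment> \<open>Order \<open>-3/4\<close> pointwise at level \<open>c\<close>, combined with
    order \<open>1/2\<close> of the partial sums at level \<open>c + 1\<close>.\<close>
  have "lbound (1/2 - 3/4) (fps_nth (Q.D * S.D))"
    by (rule lbound_fps_mult[OF _ Q.D_nonneg _ S(2) S.D_nonneg]) (use Dc in auto)
  then show "lbound (-1/4) (fps_nth (Q.D * S.D))" by simp
qed

text \<open>On level \<open>c\<close> the product contains only one of the two critical factors, of
  order \<open>-3/4\<close>, while the denominator has order \<open>-5/4\<close>; the second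
  critical factor would only enter on the next level.\<close>

lemma (in level_asymptotics) expected_at_double_critical:
  assumes "a = Unary \<or> a = Binary" "\<gamma> = 5/4"
    and D: "lbound (-3/4) (fps_nth (res c))" "ubound (-3/4) (fps_nth (res c))"
    and w: "ubound (-\<gamma>) (fps_nth (w (Suc c)))"
  shows "(\<lambda>n. expected_nodes a c k n) \<in> \<Theta>(\<lambda>n. sqrt (real n))"
proof (rule bigthetaI)
  have "ubound (-\<gamma>) (fps_nth (source_fps k \<rho> a c))"
  proof (cases "a = Unary")
    case True
    then show ?thesis using ubound_rX_mult[OF w, of \<rho>] \<rho> by (simp add: source_fps_def)
  next
    case False
    have "ubound (-\<gamma>) (fps_nth (w c * w c))"
      using \<gamma> crit_upper w_nonneg by (intro ubound_fps_mult) auto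
    then show ?thesis using False by (simp add: source_fps_def power2_eq_square)
  qed
  then have "ubound (-(3/4)) (fps_nth (node_fps k \<rho> a c 0))"
    using assms(1,3,4) k \<gamma> below_res
    by (intro node_fps_upper[of c a "{..<c}" "{c}" "3/4"]) auto
  from expected_nodes_upper[OF \<rho> root_lower this]
  have "(\<lambda>n. expected_nodes a c k n) \<in> O(\<lambda>n. (real n + 2) powr (1/2))" using assms(2) by simp
  moreover have "(\<lambda>n. (real n + 2) powr (1/2)) \<in> O(\<lambda>n. sqrt (real n))" by real_asymp
  ultimately show "(\<lambda>n. expected_nodes a c k n) \<in> O(\<lambda>n. sqrt (real n))" by (rule landau_o.big_trans)
  have "lbound (-3/4) (fps_nth (node_fps k \<rho> a c 0))"
    using assms k by (intro node_fps_lower[of a c "{c}"]) auto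
  from expected_nodes_lower[OF \<rho> root_lower root_upper this]
  have "(\<lambda>n. expected_nodes a c k n) \<in> \<Omega>(\<lambda>n. (real n + 2) powr (1/2))" using assms(2) by simp
  moreover have "(\<lambda>n. (real n + 2) powr (1/2)) \<in> \<Omega>(\<lambda>n. sqrt (real n))" by real_asymp
  ultimately show "(\<lambda>n. expected_nodes a c k n) \<in> \<Omega>(\<lambda>n. sqrt (real n))" by (rule landau_omega.big_trans)
qed

theorem theorem2p8:
  fixes k :: nat
  assumes "k \<ge> 1"
  shows "(\<forall>j. N_seq j < k \<and> k < N_seq (j + 1) \<longrightarrow>
           (\<forall>l \<in> {..<k - j}.
              (\<lambda>n. expected_nodes Unary l k n) \<in> O(\<lambda>n. 1) \<and>
              (\<lambda>n. expected_nodes Binary l k n) \<in> O(\<lambda>n. 1)) \<and>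
           (\<forall>l \<in> {k - j..<k}. (\<lambda>n. expected_nodes Unary l k n) \<in> \<Theta>(\<lambda>n. real n)) \<and>
           (\<forall>l \<in> {k - j..k}. (\<lambda>n. expected_nodes Binary l k n) \<in> \<Theta>(\<lambda>n. real n)))
       \<and> (\<forall>j. k = N_seq j \<longrightarrow>
           (\<forall>l \<in> {..<k - j}.
              (\<lambda>n. expected_nodes Unary l k n) \<in> O(\<lambda>n. 1) \<and>
              (\<lambda>n. expected_nodes Binary l k n) \<in> O(\<lambda>n. 1)) \<and>
           (\<lambda>n. expected_nodes Unary (k - j) k n) \<in> \<Theta>(\<lambda>n. sqrt (real n)) \<and>
           (\<lambda>n. expected_nodes Binary (k - j) k n) \<in> \<Theta>(\<lambda>n. sqrt (real n)) \<and>
           (\<forall>l \<in> {k - j + 1..<k}. (\<lambda>n. expected_nodes Unary l k n) \<in> \<Theta>(\<lambda>n. real n)) \<and>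
           (\<forall>l \<in> {k - j + 1..k}. (\<lambda>n. expected_nodes Binary l k n) \<in> \<Theta>(\<lambda>n. real n)))"
proof (intro conjI allI impI)
  fix j assume "N_seq j < k \<and> k < N_seq (j + 1)"
  then have j: "k \<noteq> N_seq j" "k = N_seq j \<or> N_seq j < k \<and> k < N_seq (j + 1)" by auto
  obtain \<rho> W where W: "0 < \<rho>" "\<And>i. i \<le> Suc k \<Longrightarrow> fps_nth (level_fps k \<rho> i) sums W i"
    "W (k - j) = 1/2" "\<And>i. i < k - j \<Longrightarrow> W i < 1/2" "\<And>i. k - j + 1 < i \<Longrightarrow> i \<le> k \<Longrightarrow> W i < 1/2"
    "W (k - j + 1) < 1/2" "0 < j" "j \<le> k"
    by (rule exists_critical_radius[OF assms j(2)]) (use j(1) in metis)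
  have above: "W i < 1/2" if "k - j < i" "i \<le> k" for i
    using W(5)[of i] W(6) that by (cases "i = k - j + 1") auto
  have c: "k - j < k" using W(7,8) by simp
  note S = simple_critical_level[OF c W(1) W(2) W(3,4) above]
  interpret level_asymptotics k "k - j" \<rho> "3/2" by (rule S) auto
  have low: "lbound (1 - 3/2) (fps_nth (\<Prod>i\<in>{k - j}. res i))" using S(2) by simp
  show "\<forall>l \<in> {..<k - j}. (\<lambda>n. expected_nodes Unary l k n) \<in> O(\<lambda>n. 1) \<and>
    (\<lambda>n. expected_nodes Binary l k n) \<in> O(\<lambda>n. 1)"
    using expected_below by auto
  show "\<forall>l \<in> {k - j..<k}. (\<lambda>n. expected_nodes Unary l k n) \<in> \<Theta>(\<lambda>n. real n)"
    using expected_above[OF _ _ low] by auto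
  show "\<forall>l \<in> {k - j..k}. (\<lambda>n. expected_nodes Binary l k n) \<in> \<Theta>(\<lambda>n. real n)"
    using expected_above[OF _ _ low] by auto
next
  fix j assume "k = N_seq j"
  then have j: "k = N_seq j" "k = N_seq j \<or> N_seq j < k \<and> k < N_seq (j + 1)" by auto
  obtain \<rho> W where W: "0 < \<rho>" "\<And>i. i \<le> Suc k \<Longrightarrow> fps_nth (level_fps k \<rho> i) sums W i"
    "W (k - j) = 1/2" "\<And>i. i < k - j \<Longrightarrow> W i < 1/2" "\<And>i. k - j + 1 < i \<Longrightarrow> i \<le> k \<Longrightarrow> W i < 1/2"
    "W (k - j + 1) = 1/2" "4 * real (k - j) * \<rho>\<^sup>2 + 2 * \<rho> = 1" "0 < j" "j \<le> k"
    by (rule exists_critical_radius[OF assms j(2)]) (use j(1) in metis)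
  have c: "k - j < k" using W(8,9) by simp
  note S = double_critical_level[OF c W(1) W(2) W(3) W(6)[unfolded Suc_eq_plus1[symmetric]] W(4)
      W(5)[unfolded Suc_eq_plus1[symmetric]] W(7)]
  interpret level_asymptotics k "k - j" \<rho> "5/4" by (rule S) auto
  have low: "lbound (1 - 5/4) (fps_nth (\<Prod>i\<in>{k - j, k - j + 1}. res i))" using S(4) by simp
  show "\<forall>l \<in> {..<k - j}. (\<lambda>n. expected_nodes Unary l k n) \<in> O(\<lambda>n. 1) \<and>
    (\<lambda>n. expected_nodes Binary l k n) \<in> O(\<lambda>n. 1)"
    using expected_below by auto
  show "(\<lambda>n. expected_nodes Unary (k - j) k n) \<in> \<Theta>(\<lambda>n. sqrt (real n))"
    "(\<lambda>n. expected_nodes Binary (k - j) k n) \<in> \<Theta>(\<lambda>n. sqrt (real n))"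
    using S by (auto intro!: expected_at_double_critical)
  show "\<forall>l \<in> {k - j + 1..<k}. (\<lambda>n. expected_nodes Unary l k n) \<in> \<Theta>(\<lambda>n. real n)"
    using expected_above[OF _ _ low] by auto
  show "\<forall>l \<in> {k - j + 1..k}. (\<lambda>n. expected_nodes Binary l k n) \<in> \<Theta>(\<lambda>n. real n)"
    using expected_above[OF _ _ low] by auto
qed

end
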